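(* Let $S_x,S_y\subset\mathbb{R}^3$ be arbitrary positively oriented flat (non-degenerate) triangles with vertices $(\mathbf{x}_1,\mathbf{x}_2,\mathbf{x}_3)$ and $(\mathbf{y}_1,\mathbf{y}_2,\mathbf{y}_3)$ and areas $A_x,A_y$ (all relative locations are allowed). Then $$L=\int_{S_y}\int_{S_x}\frac{1}{|\mathbf{x}-\mathbf{y}|}\,dS(\mathbf{x})\,dS(\mathbf{y})=4A_xA_y\,I_4\big(\mathbf{x}_2-\mathbf{x}_1,\ \mathbf{x}_3-\mathbf{x}_1,\ -(\mathbf{y}_2-\mathbf{y}_1),\ -(\mathbf{y}_3-\mathbf{y}_1);\ \mathbf{x}_1-\mathbf{y}_1\big),$$ where $I_4$ is the finite expression in elementary functions defined by the recursion in the context with the terminal functions $F_1(P_1;h_1,h_2,h_3,h_4)$ given there. Moreover, for the parameters $\{h_1,h_2,h_3,h_4\}$ arising in the recursion: at least two of them are zero, $h_3h_4=0$, and $h_1+h_2\neq0$. As a result, only the following seven cases are possible: - #1: $h_4=h_3=h_2=0$, $h_1\ne0$; - #2: $h_4=h_3=h_1=0$, $h_2\neq0$; - #3: $h_4=h_3=0$, $h_2\ne0$, $h_1\neq0$; - #4: $h_4=h_2=0$, $h_3\neq0$, $h_1\ne0$; - #5: $h_4=h_1=0$, $h_3\neq0$, $h_2\neq0$; - #6: $h_3=h_2=0$, $h_4\neq0$, $h_1\neq0$; - #7: $h_3=h_1=0$, $h_4\ne0$, $h_2\neq0$. These are exactly the cases for which $F_1$ is given.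
   Context: Projections. For vectors $\mathbf{a}_1,\dots,\mathbf{a}_d,\mathbf{e}\in\mathbb{R}^3$ (in the given order, each $\mathbf{a}_j\ne\mathbf{0}$) write $\mathbf{e}=\mathbf{e}_{\Vert}+\mathbf{e}_{\perp}$ with $\mathbf{e}_{\Vert}=s_{10}\mathbf{a}_1+\dots+s_{d0}\mathbf{a}_d\in\mathrm{span}(\mathbf{a}_1,\dots,\mathbf{a}_d)$ and $\mathbf{e}_\perp$ orthogonal to that span; put $h_d=|\mathbf{e}_\perp|=|\mathbf{e}-\sum_i s_{i0}\mathbf{a}_i|$. The coefficients $s_{i0}$ (which need not be unique) are constructed by a Gram–Schmidt procedure that tolerates linear dependence: $\mathbf{u}_1=\mathbf{a}_1$, $\mathbf{u}_i=\mathbf{a}_i-\sum_{k=1}^{i-1}c_{ki}\mathbf{u}_k$ for $i=2,\dots,d$, where $c_{ki}=\mathbf{u}_k\cdot\mathbf{a}_i/u_k^2$ with $u_k^2=|\mathbf{u}_k|^2$ if $\mathbf{u}_k\neq\mathbf{0}$ and $u_k^2=1$ if $\mathbf{u}_k=\mathbf{0}$. With $A_{ji}=c_{ji}|\mathbf{u}_j|^2$ and $b_j=\mathbf{u}_j\cdot\mathbf{e}$, set for $j=d,d-1,\dots,1$ $$s_{j0}=\frac1{A_{jj}}\Big(b_j-\sum_{i=j+1}^dA_{ji}s_{i0}\Big)\ \text{ if }A_{jj}\neq0,\qquad s_{j0}=0\ \text{ if }A_{jj}=0.$$ Recursion. In each line below, $s_{i0}$, $\mathbf{e}_\Vert$ and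 $h_d$ are those of the arguments on the left-hand side ($d=4$ for $I_4$, $d=3$ for $I_3$, $d=2$ for $Q$ and $T$, $d=1$ for $I_1$). Each expression passes its own $h_d$, together with the values $h_{d+1},\dots,h_4$ it received from its parent, to its children. $$\begin{aligned} I_4(\mathbf{a}_1,\mathbf{a}_2,\mathbf{a}_3,\mathbf{a}_4;\mathbf{e})=&-s_{40}I_3(\mathbf{a}_1,\mathbf{a}_2,\mathbf{a}_3;\mathbf{e}_\Vert)+(1+s_{30}+s_{40})I_3(\mathbf{a}_1,\mathbf{a}_2,\mathbf{a}_4-\mathbf{a}_3;\mathbf{e}_\Vert+\mathbf{a}_3)\\&-s_{30}I_3(\mathbf{a}_1,\mathbf{a}_2,\mathbf{a}_4;\mathbf{e}_\Vert)-s_{20}I_3(\mathbf{a}_3,\mathbf{a}_4,\mathbf{a}_1;\mathbf{e}_\Vert)\\&+(1+s_{10}+s_{20})I_3(\mathbf{a}_3,\mathbf{a}_4,\mathbf{a}_2-\mathbf{a}_1;\mathbf{e}_\Vert+\mathbf{a}_1)-s_{10}I_3(\mathbf{a}_3,\mathbf{a}_4,\mathbf{a}_2;\mathbf{e}_\Vert),\\ I_3(\mathbf{a}_1,\mathbf{a}_2,\mathbf{a}_3;\mathbf{e})=&(1+s_{10}+s_{20})Q(\mathbf{a}_1-\mathbf{a}_2,\mathbf{a}_3;\mathbf{e}_\Vert+\mathbf{a}_2)-s_{10}Q(\mathbf{a}_2,\mathbf{a}_3;\mathbf{e}_\Vert)-s_{20}Q(\mathbf{a}_1,\mathbf{a}_3;\mathbf{e}_\Vert)\\&+(1+s_{30})T(\mathbf{a}_1,\mathbf{a}_2;\mathbf{e}_\Vert+\mathbf{a}_3)-s_{30}T(\mathbf{a}_1,\mathbf{a}_2;\mathbf{e}_\Vert),\\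 Q(\mathbf{a}_1,\mathbf{a}_2;\mathbf{e})=&(1+s_{10})I_1(\mathbf{a}_2;\mathbf{e}_\Vert+\mathbf{a}_1)-s_{10}I_1(\mathbf{a}_2;\mathbf{e}_\Vert)+(1+s_{20})I_1(\mathbf{a}_1;\mathbf{e}_\Vert+\mathbf{a}_2)-s_{20}I_1(\mathbf{a}_1;\mathbf{e}_\Vert),\\ T(\mathbf{a}_1,\mathbf{a}_2;\mathbf{e})=&-s_{10}I_1(\mathbf{a}_2;\mathbf{e}_\Vert)-s_{20}I_1(\mathbf{a}_1;\mathbf{e}_\Vert)+(1+s_{10}+s_{20})I_1(\mathbf{a}_1-\mathbf{a}_2;\mathbf{e}_\Vert+\mathbf{a}_2),\\ I_1(\mathbf{a}_1;\mathbf{e})=&(1+s_{10})F_1(|1+s_{10}||\mathbf{a}_1|;h_1,h_2,h_3,h_4)-s_{10}F_1(|s_{10}||\mathbf{a}_1|;h_1,h_2,h_3,h_4). \end{aligned}$$ Terminal functions. Put $h^2=h_1^2+h_2^2+h_3^2+h_4^2$, $R_4=\sqrt{P_1^2+h^2}$, $R_1=\sqrt{P_1^2+h_1^2}$, $R_2=\sqrt{P_1^2+h_2^2}$ and $$\Phi_1(P_1)=\frac1{P_1}\ln\frac{P_1+R_4}{h},\quad \Phi_2(P_1;\eta)=\frac1{P_1}\arctan\frac{\eta P_1}{h^2+R_4\sqrt{h^2-\eta^2}},$$ $$\Phi_3(P_1)=\frac1{R_1}\ln\frac{R_1+R_4}{\sqrt{h^2-h_1^2}},\quad \Phi_4(P_1;\eta)=\frac{\eta^2}{P_1^2h_2}\Big(\frac{R_2}{h_2}\ln\frac{R_2+R_4}{\eta}-\ln\frac{h_2+h}{\eta}\Big).$$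 In the cases #1–#7 listed in the claim (values at $P_1=0$ being the limits $P_1\to0$): - #1: $F_1=\frac16\Phi_1(P_1)$. - #2: $F_1=\frac16\big(\Phi_1(P_1)-\frac1{R_2+h_2}\big)$. - #3: $F_1=\frac16\big[\Phi_1(P_1)-\frac{h_2}{h_1}\Phi_2(P_1;h_1)\big]$. - #4: $F_1=\frac16\big[(1-\frac{h_3^2}{h_1^2})\Phi_1(P_1)-\frac{2h_3}{h_1}\Phi_2(P_1;h_1)+\frac{h_3^2}{h_1^2}\Phi_3(P_1)\big]$. - #5: $F_1=\frac16\big[\frac{h^2}{h_2^2}\Phi_1(P_1)-\frac1{R_4+h}-\Phi_4(P_1;h_3)\big]$. - #6: $F_1=\frac16\big[(1-\frac{3h_4^2}{h_1^2})\Phi_1(P_1)-(3-\frac{h_4^2}{h_1^2})\frac{h_4}{h_1}\Phi_2(P_1;h_1)+3\frac{h_4^2}{h_1^2}\Phi_3(P_1)-\frac{h_4^2}{h_1^2(R_4+h_4)}\big]$. - #7: $F_1=\frac16\big[(1+\frac{3h_4^2}{h_2^2})\Phi_1(P_1)-\frac{2h_4^3}{h_2^3}\Phi_2(P_1;h_2)-3\Phi_4(P_1;h_4)+\frac{2h_4^2-h_2^2}{h_2^2(R_4+h)}\big]$.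
   Formalization: The claims h1+h2≠0 and the seven cases are stated only for terms whose product of coefficients in the recursion is nonzero; terms with coefficient zero count as 0. Otherwise they fail: if x1=y1, some zero-coefficient terms have h1=h2=h3=h4=0. *)

theory Defs
  imports "HOL-Analysis.Analysis"
begin

section \<open>Flat triangles and surface integrals\<close>

text \<open>The area measure of a surface parametrised by r over the whole plane (r is assumed injective
  and differentiable): the image under r of the area element, the norm of the cross product of
  the two partial derivatives of r.\<close>

definition surface_measure :: "(real \<times> real \<Rightarrow> real^3) \<Rightarrow> (real^3) measure" where
  "surface_measure r =
     distr
       (density lborel (\<lambda>p. ennreal (norm
          (cross3 (frechet_derivative r (at p) (1, 0)) (frechet_derivative r (at p) (0, 1))))))
       borel r"

definition plane_param :: "real^3 \<Rightarrow> real^3 \<Rightarrow> real^3 \<Rightarrow> real \<times> real \<Rightarrow> real^3" where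
  "plane_param p1 p2 p3 = (\<lambda>(u, v). p1 + u *\<^sub>R (p2 - p1) + v *\<^sub>R (p3 - p1))"

text \<open>For non-collinear points, the area measure of the plane through them.\<close>

definition plane_measure :: "real^3 \<Rightarrow> real^3 \<Rightarrow> real^3 \<Rightarrow> (real^3) measure" where
  "plane_measure p1 p2 p3 = surface_measure (plane_param p1 p2 p3)"

definition flat_triangle :: "real^3 \<Rightarrow> real^3 \<Rightarrow> real^3 \<Rightarrow> (real^3) set" where
  "flat_triangle p1 p2 p3 = convex hull {p1, p2, p3}"

definition triangle_area :: "real^3 \<Rightarrow> real^3 \<Rightarrow> real^3 \<Rightarrow> real" where
  "triangle_area p1 p2 p3 = measure (plane_measure p1 p2 p3) (flat_triangle p1 p2 p3)"

section \<open>Projections\<close>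

text \<open>A family of d vectors is a list of length d; the mathematical indices start at 1.\<close>

definition vec_at :: "(real^3) list \<Rightarrow> nat \<Rightarrow> real^3" where
  "vec_at a i = a ! (i - 1)"

definition sq_or_one :: "real^3 \<Rightarrow> real" where
  "sq_or_one u = (if u \<noteq> 0 then (norm u)\<^sup>2 else 1)"

function gs_u :: "(real^3) list \<Rightarrow> nat \<Rightarrow> real^3" where
  "gs_u a i = vec_at a i -
     (\<Sum>k\<in>{1..<i}. (gs_u a k \<bullet> vec_at a i / sq_or_one (gs_u a k)) *\<^sub>R gs_u a k)"
  by pat_completeness auto
termination by (relation "Wellfounded.measure snd") auto

definition gs_c :: "(real^3) list \<Rightarrow> nat \<Rightarrow> nat \<Rightarrow> real" where
  "gs_c a k i = gs_u a k \<bullet> vec_at a i / sq_or_one (gs_u a k)"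

definition gs_A :: "(real^3) list \<Rightarrow> nat \<Rightarrow> nat \<Rightarrow> real" where
  "gs_A a j i = gs_c a j i * (norm (gs_u a j))\<^sup>2"

definition gs_b :: "(real^3) list \<Rightarrow> real^3 \<Rightarrow> nat \<Rightarrow> real" where
  "gs_b a e j = gs_u a j \<bullet> e"

text \<open>The coefficients s_{j0}, by back substitution from j = d down to j = 1.\<close>

function s_coeff :: "(real^3) list \<Rightarrow> real^3 \<Rightarrow> nat \<Rightarrow> real" where
  "s_coeff a e j =
     (if gs_A a j j \<noteq> 0
      then 1 / gs_A a j j *
             (gs_b a e j - (\<Sum>i\<in>{j+1..length a}. gs_A a j i * s_coeff a e i))
      else 0)"
  by pat_completeness auto
termination by (relation "Wellfounded.measure (\<lambda>(a, e, j). Suc (length a) - j)") auto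

declare gs_u.simps [simp del] s_coeff.simps [simp del]

definition e_par :: "(real^3) list \<Rightarrow> real^3 \<Rightarrow> real^3" where
  "e_par a e = (\<Sum>i\<in>{1..length a}. s_coeff a e i *\<^sub>R vec_at a i)"

definition h_dist :: "(real^3) list \<Rightarrow> real^3 \<Rightarrow> real" where
  "h_dist a e = norm (e - e_par a e)"

section \<open>Terminal functions\<close>

text \<open>In the Phi functions the argument h stands for the root of
  h_1^2 + h_2^2 + h_3^2 + h_4^2.\<close>

definition Phi1 :: "real \<Rightarrow> real \<Rightarrow> real" where
  "Phi1 h P = 1 / P * ln ((P + sqrt (P\<^sup>2 + h\<^sup>2)) / h)"

definition Phi2 :: "real \<Rightarrow> real \<Rightarrow> real \<Rightarrow> real" where
  "Phi2 h P \<eta> = 1 / P * arctan (\<eta> * P / (h\<^sup>2 + sqrt (P\<^sup>2 + h\<^sup>2) * sqrt (h\<^sup>2 - \<eta>\<^sup>2)))"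

definition Phi3 :: "real \<Rightarrow> real \<Rightarrow> real \<Rightarrow> real" where
  "Phi3 h h1 P =
     (let R4 = sqrt (P\<^sup>2 + h\<^sup>2); R1 = sqrt (P\<^sup>2 + h1\<^sup>2)
      in 1 / R1 * ln ((R1 + R4) / sqrt (h\<^sup>2 - h1\<^sup>2)))"

definition Phi4 :: "real \<Rightarrow> real \<Rightarrow> real \<Rightarrow> real \<Rightarrow> real" where
  "Phi4 h h2 P \<eta> =
     (let R4 = sqrt (P\<^sup>2 + h\<^sup>2); R2 = sqrt (P\<^sup>2 + h2\<^sup>2)
      in \<eta>\<^sup>2 / (P\<^sup>2 * h2) * (R2 / h2 * ln ((R2 + R4) / \<eta>) - ln ((h2 + h) / \<eta>)))"

text \<open>The seven closed forms, meant for P \<open>> 0\<close>; nothing is prescribed in any other case.\<close>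

definition F1_pos :: "real \<Rightarrow> real \<Rightarrow> real \<Rightarrow> real \<Rightarrow> real \<Rightarrow> real" where
  "F1_pos P h1 h2 h3 h4 =
     (let h = sqrt (h1\<^sup>2 + h2\<^sup>2 + h3\<^sup>2 + h4\<^sup>2);
          R4 = sqrt (P\<^sup>2 + h\<^sup>2);
          R2 = sqrt (P\<^sup>2 + h2\<^sup>2)
      in
      if h4 = 0 \<and> h3 = 0 \<and> h2 = 0 \<and> h1 \<noteq> 0 then
        1/6 * Phi1 h P
      else if h4 = 0 \<and> h3 = 0 \<and> h1 = 0 \<and> h2 \<noteq> 0 then
        1/6 * (Phi1 h P - 1 / (R2 + h2))
      else if h4 = 0 \<and> h3 = 0 \<and> h2 \<noteq> 0 \<and> h1 \<noteq> 0 then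
        1/6 * (Phi1 h P - h2 / h1 * Phi2 h P h1)
      else if h4 = 0 \<and> h2 = 0 \<and> h3 \<noteq> 0 \<and> h1 \<noteq> 0 then
        1/6 * ((1 - h3\<^sup>2 / h1\<^sup>2) * Phi1 h P - 2 * h3 / h1 * Phi2 h P h1
               + h3\<^sup>2 / h1\<^sup>2 * Phi3 h h1 P)
      else if h4 = 0 \<and> h1 = 0 \<and> h3 \<noteq> 0 \<and> h2 \<noteq> 0 then
        1/6 * (h\<^sup>2 / h2\<^sup>2 * Phi1 h P - 1 / (R4 + h) - Phi4 h h2 P h3)
      else if h3 = 0 \<and> h2 = 0 \<and> h4 \<noteq> 0 \<and> h1 \<noteq> 0 then
        1/6 * ((1 - 3 * h4\<^sup>2 / h1\<^sup>2) * Phi1 h P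
               - (3 - h4\<^sup>2 / h1\<^sup>2) * (h4 / h1) * Phi2 h P h1
               + 3 * (h4\<^sup>2 / h1\<^sup>2) * Phi3 h h1 P
               - h4\<^sup>2 / (h1\<^sup>2 * (R4 + h4)))
      else if h3 = 0 \<and> h1 = 0 \<and> h4 \<noteq> 0 \<and> h2 \<noteq> 0 then
        1/6 * ((1 + 3 * h4\<^sup>2 / h2\<^sup>2) * Phi1 h P
               - 2 * h4^3 / h2^3 * Phi2 h P h2
               - 3 * Phi4 h h2 P h4
               + (2 * h4\<^sup>2 - h2\<^sup>2) / (h2\<^sup>2 * (R4 + h)))
      else undefined)"

definition F1 :: "real \<Rightarrow> real \<Rightarrow> real \<Rightarrow> real \<Rightarrow> real \<Rightarrow> real" where
  "F1 P h1 h2 h3 h4 =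
     (if P = 0 then Lim (at_right 0) (\<lambda>p. F1_pos p h1 h2 h3 h4) else F1_pos P h1 h2 h3 h4)"

section \<open>The recursion\<close>

text \<open>The calls occurring in the recursion. The last argument of \<open>I4\<close>, \<open>I3\<close>, \<open>Q\<close>, \<open>T\<close>, \<open>I1\<close>
  is the offset e; \<open>F P\<close> is a terminal call with first argument P.\<close>

datatype expr =
    I4 "real^3" "real^3" "real^3" "real^3" "real^3"
  | I3 "real^3" "real^3" "real^3" "real^3"
  | Q "real^3" "real^3" "real^3"
  | T "real^3" "real^3" "real^3"
  | I1 "real^3" "real^3"
  | F real

text \<open>The right-hand sides of the recursion: each is the linear combination of its child calls
  with the listed coefficients.\<close>

fun children :: "expr \<Rightarrow> (real \<times> expr) list" where
  "children (I4 a1 a2 a3 a4 e) =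
     (let s = s_coeff [a1, a2, a3, a4] e; p = e_par [a1, a2, a3, a4] e in
      [(- s 4, I3 a1 a2 a3 p),
       (1 + s 3 + s 4, I3 a1 a2 (a4 - a3) (p + a3)),
       (- s 3, I3 a1 a2 a4 p),
       (- s 2, I3 a3 a4 a1 p),
       (1 + s 1 + s 2, I3 a3 a4 (a2 - a1) (p + a1)),
       (- s 1, I3 a3 a4 a2 p)])"
| "children (I3 a1 a2 a3 e) =
     (let s = s_coeff [a1, a2, a3] e; p = e_par [a1, a2, a3] e in
      [(1 + s 1 + s 2, Q (a1 - a2) a3 (p + a2)),
       (- s 1, Q a2 a3 p),
       (- s 2, Q a1 a3 p),
       (1 + s 3, T a1 a2 (p + a3)),
       (- s 3, T a1 a2 p)])"
| "children (Q a1 a2 e) =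
     (let s = s_coeff [a1, a2] e; p = e_par [a1, a2] e in
      [(1 + s 1, I1 a2 (p + a1)),
       (- s 1, I1 a2 p),
       (1 + s 2, I1 a1 (p + a2)),
       (- s 2, I1 a1 p)])"
| "children (T a1 a2 e) =
     (let s = s_coeff [a1, a2] e; p = e_par [a1, a2] e in
      [(- s 1, I1 a2 p),
       (- s 2, I1 a1 p),
       (1 + s 1 + s 2, I1 (a1 - a2) (p + a2))])"
| "children (I1 a1 e) =
     (let s = s_coeff [a1] e in
      [(1 + s 1, F (\<bar>1 + s 1\<bar> * norm a1)),
       (- s 1, F (\<bar>s 1\<bar> * norm a1))])"
| "children (F P) = []"

fun level :: "expr \<Rightarrow> nat" where
  "level (I4 a1 a2 a3 a4 e) = 4"
| "level (I3 a1 a2 a3 e) = 3"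
| "level (Q a1 a2 e) = 2"
| "level (T a1 a2 e) = 2"
| "level (I1 a1 e) = 1"
| "level (F P) = 0"

fun own_h :: "expr \<Rightarrow> real" where
  "own_h (I4 a1 a2 a3 a4 e) = h_dist [a1, a2, a3, a4] e"
| "own_h (I3 a1 a2 a3 e) = h_dist [a1, a2, a3] e"
| "own_h (Q a1 a2 e) = h_dist [a1, a2] e"
| "own_h (T a1 a2 e) = h_dist [a1, a2] e"
| "own_h (I1 a1 e) = h_dist [a1] e"
| "own_h (F P) = 0"

text \<open>\<open>h d\<close> is the value h_d handed down to a call; \<open>pass_h x h\<close> is what x passes on to its
  children.\<close>

definition pass_h :: "expr \<Rightarrow> (nat \<Rightarrow> real) \<Rightarrow> nat \<Rightarrow> real" where
  "pass_h x h = h(level x := own_h x)"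

lemma level_children: "(c, y) \<in> set (children x) \<Longrightarrow> level x = Suc (level y)"
  by (cases x) (auto simp: Let_def)

function val :: "expr \<Rightarrow> (nat \<Rightarrow> real) \<Rightarrow> real" where
  "val x h =
     (case x of
        F P \<Rightarrow> F1 P (h 1) (h 2) (h 3) (h 4)
      | _ \<Rightarrow> (\<Sum>(c, y) \<leftarrow> children x. c * val y (pass_h x h)))"
  by pat_completeness auto
termination
  by (relation "Wellfounded.measure (\<lambda>(x, h). level x)") (auto dest!: level_children simp: Let_def)

declare val.simps [simp del]

text \<open>The value of an \<open>I4\<close> call does not depend on the initial h, since all of h_1, ..., h_4 are
  overwritten before a terminal call is reached.\<close>

definition I4_val :: "real^3 \<Rightarrow> real^3 \<Rightarrow> real^3 \<Rightarrow> real^3 \<Rightarrow> real^3 \<Rightarrow> real" where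
  "I4_val a1 a2 a3 a4 e = val (I4 a1 a2 a3 a4 e) (\<lambda>_. 0)"

text \<open>\<open>arises x\<^sub>0 w y h\<close>: expanding the call \<open>x\<^sub>0\<close> produces the call y, with handed-down
  values h, and w is the product of the coefficients on the way from \<open>x\<^sub>0\<close> to y. Thus the
  expansion of \<open>x\<^sub>0\<close> contains w times the value of y.\<close>

inductive arises :: "expr \<Rightarrow> real \<Rightarrow> expr \<Rightarrow> (nat \<Rightarrow> real) \<Rightarrow> bool" for x\<^sub>0 where
  root: "arises x\<^sub>0 1 x\<^sub>0 (\<lambda>_. 0)"
| child: "arises x\<^sub>0 w x h \<Longrightarrow> (c, y) \<in> set (children x) \<Longrightarrow> arises x\<^sub>0 (w * c) y (pass_h x h)"

end

(*
Idea. Regularise 1/|r| to K_4(|r|^2) with K_4(t) = (t + eps^2)^(-1/2). On a d-dimensional call with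
offset e = e_par + e_perp one has |r|^2 = |w|^2 + h_d^2, where w = sum_i (s_i + s_i0) a_i, and
K_{d-1}(t) = int_0^1 l^(d-1) K_d(l^2 t + h_d^2) dl satisfies the Euler identity
d K_{d-1}(t) + 2 t K_{d-1}'(t) = K_d(t + h_d^2). Hence K_d(|r|^2) is the divergence of
(s + s_0) K_{d-1}(|w|^2) in the parameters s, and the divergence theorem is exactly one step of the
recursion, for every eps > 0 and without any singularity. The spans of the vectors of successive
calls lose at most one dimension per step; a dimension is lost iff h is nonzero, provided that the
coefficient of the child is nonzero. Since the dimension descends from 3 to 1, only the seven cases
survive, and there K_0(P^2) converges to F_1 as eps tends to 0: each iterated limit kernel is found by
exhibiting an antiderivative. Monotone convergence in the double integral gives integrability and the
formula together.
*)

theory Submission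
  imports Defs
begin

section \<open>Radial kernels\<close>

text \<open>The divergence is taken in the parameters \<open>s\<close>, not in space. Four vectors
  in three dimensions are always dependent, so a divergence in space would need an independent
  subfamily; in parameter space it suffices that \<open>e_par\<close> is some linear combination of
  the vectors and that the remainder is orthogonal to all of them, and non-unique coefficients do no
  harm. For smooth kernels the recursion therefore holds in every relative position, and degeneracy
  becomes a question about the limit alone. The obstacle sits there: when h_1 and h_2 both vanish no
  terminal function is prescribed, and if all four values vanish the limit kernel is even infinite.
  Such branches do occur, but only with a vanishing product of coefficients. So what has to be
  controlled is a branch together with its weight: the limit is carried along the tree of calls, and
  a child with coefficient zero is discarded before its limit is considered. A nonzero weight also
  forces P > 0, the range where convergence of the kernels is known.\<close>

definition next_kernel :: "nat \<Rightarrow> real \<Rightarrow> (real \<Rightarrow> real) \<Rightarrow> real \<Rightarrow> real" where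
  "next_kernel d h K t = integral {0..1} (\<lambda>l. l ^ (d - 1) * K (l\<^sup>2 * t + h\<^sup>2))"

text \<open>Kernels are evaluated at squared norms, so only t \<ge> 0 occurs. The endpoint t = 0
  belongs to the domain because w may vanish; the derivative there is one-sided.\<close>

definition c1_kernel :: "(real \<Rightarrow> real) \<Rightarrow> (real \<Rightarrow> real) \<Rightarrow> bool" where
  "c1_kernel K K' \<longleftrightarrow>
     (\<forall>t\<ge>0. (K has_real_derivative K' t) (at t within {0..})) \<and> continuous_on {0..} K'"

lemma c1_kernel_continuous: "c1_kernel K K' \<Longrightarrow> continuous_on {0..} K"
  unfolding c1_kernel_def by (auto simp: continuous_on_eq_continuous_within intro: DERIV_continuous)

text \<open>The chain rule asks for a derivative of \<open>K\<close> within the image of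
  \<open>g\<close>; nonnegativity of \<open>g\<close> puts that image inside the domain of the
  one-sided derivative.\<close>

lemma c1_kernel_compose:
  assumes "c1_kernel K K'" and "(g has_real_derivative D) (at x within S)"
    and "\<And>x. g x \<ge> 0" and "D' = K' (g x) * D"
  shows "((\<lambda>x. K (g x)) has_real_derivative D') (at x within S)"
proof -
  have "(K has_real_derivative K' (g x)) (at (g x) within {0..})"
    using assms(1,3) by (simp add: c1_kernel_def)
  then have "(K has_real_derivative K' (g x)) (at (g x) within g ` S)"
    by (rule DERIV_subset) (use assms(3) in auto)
  from DERIV_image_chain[OF this assms(2)] show ?thesis
    using assms(4) by (simp add: o_def)
qed

lemma continuous_on_kernel_arg:
  assumes "continuous_on {0..} (K :: real \<Rightarrow> real)"
  shows "continuous_on ({0..} \<times> {0..1::real}) (\<lambda>(t, l). l ^ m * K (l\<^sup>2 * t + h\<^sup>2))"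
  unfolding case_prod_beta
  by (intro continuous_intros continuous_on_compose2[OF assms]) (auto simp: mult_nonneg_nonneg)

text \<open>Differentiation under the integral sign: the inner derivative contributes l^2, which
  turns the exponent d - 1 into d + 1.\<close>

lemma c1_kernel_next:
  assumes K: "c1_kernel K K'" and d: "d \<ge> 1"
  shows "c1_kernel (next_kernel d h K) (\<lambda>t. integral {0..1} (\<lambda>l. l ^ (d + 1) * K' (l\<^sup>2 * t + h\<^sup>2)))"
  unfolding c1_kernel_def
proof (intro conjI allI impI)
  have contK': "continuous_on {0..} K'" and contK: "continuous_on {0..} K"
    using K c1_kernel_continuous by (auto simp: c1_kernel_def)
  fix t :: real assume t: "t \<ge> 0"
  have "((\<lambda>t. integral (cbox 0 1) (\<lambda>l. l ^ (d - 1) * K (l\<^sup>2 * t + h\<^sup>2))) has_real_derivative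
      integral (cbox 0 1) (\<lambda>l. l ^ (d + 1) * K' (l\<^sup>2 * t + h\<^sup>2))) (at t within {0..})"
  proof (rule leibniz_rule_field_derivative)
    fix x l :: real assume x: "x \<in> {0..}" and l: "l \<in> cbox 0 1"
    have "((\<lambda>x. K (l\<^sup>2 * x + h\<^sup>2)) has_real_derivative K' (l\<^sup>2 * x + h\<^sup>2) * l\<^sup>2) (at x within {0..})"
    proof -
      have "(K has_real_derivative K' (l\<^sup>2 * x + h\<^sup>2)) (at (l\<^sup>2 * x + h\<^sup>2) within {0..})"
        using K x by (simp add: c1_kernel_def)
      then have "(K has_real_derivative K' (l\<^sup>2 * x + h\<^sup>2)) 
          (at (l\<^sup>2 * x + h\<^sup>2) within (\<lambda>x. l\<^sup>2 * x + h\<^sup>2) ` {0..})"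
        by (rule DERIV_subset) auto
      moreover have "((\<lambda>x. l\<^sup>2 * x + h\<^sup>2) has_real_derivative l\<^sup>2) (at x within {0..})"
        by (auto intro!: derivative_eq_intros)
      ultimately show ?thesis
        by (drule_tac DERIV_image_chain) (auto simp: o_def)
    qed
    from DERIV_cmult[OF this, of "l ^ (d - 1)"]
    show "((\<lambda>x. l ^ (d - 1) * K (l\<^sup>2 * x + h\<^sup>2)) has_real_derivative
        l ^ (d + 1) * K' (l\<^sup>2 * x + h\<^sup>2)) (at x within {0..})"
      using d by (cases d) (auto simp: power2_eq_square algebra_simps)
  next
    fix x :: real assume "x \<in> {0..}"
    then show "(\<lambda>l. l ^ (d - 1) * K (l\<^sup>2 * x + h\<^sup>2)) integrable_on cbox 0 1"
      by (intro integrable_continuous continuous_intros continuous_on_compose2[OF contK])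
         (auto simp: mult_nonneg_nonneg)
  next
    show "continuous_on ({0..} \<times> cbox 0 1) (\<lambda>(x, l). l ^ (d + 1) * K' (l\<^sup>2 * x + h\<^sup>2))"
      using continuous_on_kernel_arg[OF contK', of "d + 1" h] by (simp only: cbox_interval)
  qed (use t in auto)
  then show "(next_kernel d h K has_real_derivative
      integral {0..1} (\<lambda>l. l ^ (d + 1) * K' (l\<^sup>2 * t + h\<^sup>2))) (at t within {0..})"
    by (simp add: next_kernel_def[abs_def])
next
  have contK': "continuous_on {0..} K'" using K by (auto simp: c1_kernel_def)
  show "continuous_on {0..} (\<lambda>t. integral {0..1} (\<lambda>l. l ^ (d + 1) * K' (l\<^sup>2 * t + h\<^sup>2)))"
    using integral_continuous_on_param[of "{0..}" "0::real" 1 "\<lambda>t l. l ^ (d + 1) * K' (l\<^sup>2 * t + h\<^sup>2)"]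
      continuous_on_kernel_arg[OF contK', of "d + 1" h] by simp
qed

text \<open>Euler's identity: with \<open>g(\<rho>) = next_kernel d h K (\<rho>\<^sup>2)\<close>, the field \<open>g(|x|) x\<close> on a
  \<open>d\<close>-dimensional space has divergence \<open>K (|x|\<^sup>2 + h\<^sup>2)\<close>.\<close>

lemma next_kernel_Euler:
  assumes K: "c1_kernel K K'" and d: "d \<ge> 1" and t: "t \<ge> 0"
  shows "real d * next_kernel d h K t +
    2 * t * integral {0..1} (\<lambda>l. l ^ (d + 1) * K' (l\<^sup>2 * t + h\<^sup>2)) = K (t + h\<^sup>2)"
proof -
  have contK': "continuous_on {0..} K'" and contK: "continuous_on {0..} K"
    using K c1_kernel_continuous by (auto simp: c1_kernel_def)
  let ?f = "\<lambda>l. l ^ (d - 1) * K (l\<^sup>2 * t + h\<^sup>2)" and ?g = "\<lambda>l. l ^ (d + 1) * K' (l\<^sup>2 * t + h\<^sup>2)"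
  have f: "?f integrable_on {0..1}"
    using t by (intro integrable_continuous_interval continuous_intros continuous_on_compose2[OF contK])
      (auto simp: mult_nonneg_nonneg)
  have g: "?g integrable_on {0..1}"
    using t by (intro integrable_continuous_interval continuous_intros continuous_on_compose2[OF contK'])
      (auto simp: mult_nonneg_nonneg)
  \<comment> \<open>The integrand is the l-derivative of l^d K(l^2 t + h^2). Its value at l = 0
    vanishes because d \<ge> 1, so only K(t + h^2) remains.\<close>
  have "((\<lambda>l. real d * ?f l + 2 * t * ?g l) has_integral
      (1 ^ d * K (1\<^sup>2 * t + h\<^sup>2) - 0 ^ d * K (0\<^sup>2 * t + h\<^sup>2))) {0..1}"
  proof (rule fundamental_theorem_of_calculus)
    fix l :: real assume "l \<in> {0..1}"
    have "((\<lambda>l. K (l\<^sup>2 * t + h\<^sup>2)) has_real_derivative K' (l\<^sup>2 * t + h\<^sup>2) * (2 * l * t)) (at l within {0..1})"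
      by (rule c1_kernel_compose[OF K]) (use t in \<open>auto intro!: derivative_eq_intros\<close>)
    moreover have "((\<lambda>l. l ^ d) has_real_derivative real d * l ^ (d - 1)) (at l within {0..1})"
      by (auto intro!: derivative_eq_intros)
    ultimately have "((\<lambda>l. l ^ d * K (l\<^sup>2 * t + h\<^sup>2)) has_real_derivative
      (real d * l ^ (d - 1) * K (l\<^sup>2 * t + h\<^sup>2) + K' (l\<^sup>2 * t + h\<^sup>2) * (2 * l * t) * l ^ d))
      (at l within {0..1})"
      by (drule_tac DERIV_mult) auto
    then show "((\<lambda>l. l ^ d * K (l\<^sup>2 * t + h\<^sup>2)) has_vector_derivative real d * ?f l + 2 * t * ?g l)
      (at l within {0..1})"
      by (simp add: has_real_derivative_iff_has_vector_derivative algebra_simps)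
  qed auto
  then have "integral {0..1} (\<lambda>l. real d * ?f l + 2 * t * ?g l) = K (t + h\<^sup>2)"
    using d by (subst integral_unique) (auto simp: power_0_left)
  moreover have "integral {0..1} (\<lambda>l. real d * ?f l + 2 * t * ?g l) =
      real d * integral {0..1} ?f + 2 * t * integral {0..1} ?g"
    using f g by (subst integral_add) (auto simp: integrable_on_mult_right)
  ultimately show ?thesis by (simp add: next_kernel_def)
qed

text \<open>The bound by the limit itself is what makes dominated convergence applicable at the next level.\<close>

definition approximates :: "(nat \<Rightarrow> real \<Rightarrow> real) \<Rightarrow> (real \<Rightarrow> real) \<Rightarrow> bool" where
  "approximates K k \<longleftrightarrow>
     (\<forall>t>0. (\<forall>n. 0 \<le> K n t \<and> K n t \<le> k t) \<and> (\<lambda>n. K n t) \<longlonglongrightarrow> k t)"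

text \<open>Substituting l r for the variable of \<open>M\<close>, with r = sqrt t, identifies the
  limit integral over l in [0, 1] with \<open>M r / r ^ d\<close>. An explicit antiderivative thus
  serves twice: it gives the value, and it shows that the limit integrand is integrable and can act
  as majorant.\<close>

lemma approximates_next_kernel:
  assumes cont: "\<And>n. continuous_on {0..} (K n)" and app: "approximates K k"
    and M0: "(M \<longlongrightarrow> 0) (at_right 0)"
    and M: "\<And>r. r > 0 \<Longrightarrow> (M has_real_derivative r ^ (d - 1) * k (r\<^sup>2 + h\<^sup>2)) (at r)"
    and d: "d \<ge> 1" and k': "\<And>r. r > 0 \<Longrightarrow> k' (r\<^sup>2) = M r / r ^ d"
  shows "approximates (\<lambda>n. next_kernel d h (K n)) k'"
  unfolding approximates_def
proof (rule allI, rule impI)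
  fix t :: real assume t: "t > 0"
  define r where "r = sqrt t"
  have r: "r > 0" and tr: "t = r\<^sup>2" using t by (auto simp: r_def)
  \<comment> \<open>The value at 0 is imposed: \<open>M\<close> is only known to tend to 0 there,
    and its closed form may involve a quotient that is meaningless at 0.\<close>
  define G where "G l = (if l = 0 then 0 else M (l * r) / r ^ d)" for l
  let ?k = "\<lambda>l. l ^ (d - 1) * k (l\<^sup>2 * t + h\<^sup>2)"
  let ?f = "\<lambda>n l. l ^ (d - 1) * K n (l\<^sup>2 * t + h\<^sup>2)"
  have DG: "(G has_real_derivative ?k l) (at l)" if "l > 0" for l
  proof -
    have "(M has_real_derivative (l * r) ^ (d - 1) * k ((l * r)\<^sup>2 + h\<^sup>2)) (at (l * r))"
      using that r by (intro M) auto
    moreover have "((\<lambda>l. l * r) has_real_derivative r) (at l)"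
      by (auto intro!: derivative_eq_intros)
    ultimately have "((\<lambda>l. M (l * r)) has_real_derivative
        (l * r) ^ (d - 1) * k ((l * r)\<^sup>2 + h\<^sup>2) * r) (at l)"
      by (rule DERIV_chain2)
    then have "((\<lambda>l. M (l * r) / r ^ d) has_real_derivative
        (l * r) ^ (d - 1) * k ((l * r)\<^sup>2 + h\<^sup>2) * r / r ^ d) (at l)"
      by (rule DERIV_cdivide)
    also have "(l * r) ^ (d - 1) * k ((l * r)\<^sup>2 + h\<^sup>2) * r / r ^ d = ?k l"
      using d r by (cases d) (auto simp: tr power_mult_distrib)
    finally show ?thesis
      by (rule has_field_derivative_transform_within_open[where S = "{0<..}"])
        (use that in \<open>auto simp: G_def\<close>)
  qed
  have G0: "(G \<longlongrightarrow> 0) (at_right 0)"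
  proof -
    have "filterlim (\<lambda>l. l * r) (at_right 0) (at_right 0)"
      unfolding filterlim_at
      using r by (auto intro!: tendsto_eq_intros eventually_at_right_less simp: eventually_at_filter)
    then have "((\<lambda>l. M (l * r)) \<longlongrightarrow> 0) (at_right 0)"
      by (rule filterlim_compose[OF M0])
    then have "((\<lambda>l. M (l * r) / r ^ d) \<longlongrightarrow> 0 / r ^ d) (at_right 0)"
      by (rule tendsto_divide) (use r in auto)
    then have "((\<lambda>l. M (l * r) / r ^ d) \<longlongrightarrow> 0) (at_right 0)" by simp
    then show ?thesis
      by (rule Lim_transform_eventually) (auto simp: eventually_at_filter G_def)
  qed
  have "(?k has_integral (G 1 - G 0)) {0..1}"
  proof (rule fundamental_theorem_of_calculus_interior)
    show "continuous_on {0..1} G"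
      unfolding continuous_on_eq_continuous_within
    proof
      fix l :: real assume l: "l \<in> {0..1}"
      show "continuous (at l within {0..1}) G"
      proof (cases "l = 0")
        case True
        have "(G \<longlongrightarrow> G 0) (at 0 within {0..1})"
          using G0 by (simp add: G_def at_within_Icc_at_right)
        then show ?thesis using True by (simp add: continuous_within)
      next
        case False
        then show ?thesis using DG[of l] l
          by (auto intro: DERIV_continuous has_field_derivative_at_within)
      qed
    qed
  qed (use DG in \<open>auto simp flip: has_real_derivative_iff_has_vector_derivative\<close>)
  moreover have "G 1 - G 0 = k' t" using k'[OF r] by (simp add: G_def tr)
  ultimately have kint: "(?k has_integral k' t) {0..1}" by simp
  \<comment> \<open>On the open interval l^2 t + h^2 is positive. At l = 0 with h = 0 it would be 0,
    where \<open>approximates\<close> says nothing.\<close>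
  then have kint': "?k integrable_on {0<..<1}" and kI: "integral {0<..<1} ?k = k' t"
    by (auto simp: has_integral_Icc_iff_Ioo integrable_on_def integral_unique)
  have fint: "?f n integrable_on {0..1}" for n
    using t by (intro integrable_continuous_interval continuous_intros continuous_on_compose2[OF cont])
      (auto simp: mult_nonneg_nonneg)
  have app': "0 \<le> K n (l\<^sup>2 * t + h\<^sup>2) \<and> K n (l\<^sup>2 * t + h\<^sup>2) \<le> k (l\<^sup>2 * t + h\<^sup>2)"
    "(\<lambda>n. K n (l\<^sup>2 * t + h\<^sup>2)) \<longlonglongrightarrow> k (l\<^sup>2 * t + h\<^sup>2)" if "l > 0" for l n
  proof -
    have "l\<^sup>2 * t + h\<^sup>2 > 0" using that t by (simp add: add_pos_nonneg)
    then show "0 \<le> K n (l\<^sup>2 * t + h\<^sup>2) \<and> K n (l\<^sup>2 * t + h\<^sup>2) \<le> k (l\<^sup>2 * t + h\<^sup>2)"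
      "(\<lambda>n. K n (l\<^sup>2 * t + h\<^sup>2)) \<longlonglongrightarrow> k (l\<^sup>2 * t + h\<^sup>2)"
      using app by (auto simp: approximates_def)
  qed
  have nk: "next_kernel d h (K n) t = integral {0<..<1} (?f n)" for n
    by (simp add: next_kernel_def integral_open_interval_real)
  have fint': "?f n integrable_on {0<..<1}" for n
    using fint[of n] by (simp add: integrable_on_Icc_iff_Ioo)
  have bound: "0 \<le> ?f n l \<and> ?f n l \<le> ?k l" if "l \<in> {0<..<1}" for l n
    using app'(1)[of l n] that by (auto intro: mult_left_mono)
  have "(\<lambda>n. integral {0<..<1} (?f n)) \<longlonglongrightarrow> integral {0<..<1} ?k"
  proof (rule dominated_convergence(2)[OF fint' kint'])
    fix n l assume "l \<in> {0<..<1::real}"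
    then show "norm (?f n l) \<le> ?k l" using bound[of l n] by (simp add: abs_if)
  next
    show "(\<lambda>n. ?f n l) \<longlonglongrightarrow> ?k l" if "l \<in> {0<..<1}" for l
      using that by (auto intro!: tendsto_mult app'(2))
  qed
  moreover have "0 \<le> integral {0<..<1} (?f n)" for n
    by (rule integral_nonneg[OF fint']) (use bound in blast)
  moreover have "integral {0<..<1} (?f n) \<le> integral {0<..<1} ?k" for n
    by (rule integral_le[OF fint' kint']) (use bound in blast)
  ultimately show "(\<forall>n. 0 \<le> next_kernel d h (K n) t \<and> next_kernel d h (K n) t \<le> k' t) \<and>
      (\<lambda>n. next_kernel d h (K n) t) \<longlonglongrightarrow> k' t"
    unfolding nk kI by blast
qed

section \<open>Limits of the iterated kernels\<close>

lemmas DERIV_rules = DERIV_const DERIV_ident DERIV_cdivide DERIV_cmult DERIV_add DERIV_diff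
  DERIV_mult DERIV_divide DERIV_power

text \<open>Passes from squared distances to distances, the variable in which all closed forms below
  are written.\<close>

lemma approximates_step:
  assumes "\<And>n. continuous_on {0..} (K n)" and "approximates K (\<lambda>t. f (sqrt t))"
    and "(M \<longlongrightarrow> 0) (at_right 0)"
    and "\<And>r. r > 0 \<Longrightarrow> (M has_real_derivative r ^ (d - 1) * f (sqrt (r\<^sup>2 + h\<^sup>2))) (at r)"
    and "d \<ge> 1" and "\<And>r. r > 0 \<Longrightarrow> g r = M r / r ^ d"
  shows "approximates (\<lambda>n. next_kernel d h (K n)) (\<lambda>t. g (sqrt t))"
  proof (rule approximates_next_kernel[OF assms(1-5)])
  show "g (sqrt (r\<^sup>2)) = M r / r ^ d" if "r > 0" for r
    using assms(6)[OF that] that by simp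
qed

section \<open>The logarithm and the angle occurring in the terminal functions\<close>

lemma has_real_derivative_sqrt_sum:
  "r\<^sup>2 + c > 0 \<Longrightarrow> ((\<lambda>r. sqrt (r\<^sup>2 + c)) has_real_derivative r / sqrt (r\<^sup>2 + c)) (at r)"
  by (auto intro!: derivative_eq_intros simp: field_simps)

text \<open>For h > 0 this is arsinh(r / h).\<close>

definition logsum :: "real \<Rightarrow> real \<Rightarrow> real" where
  "logsum h r = ln ((r + sqrt (r\<^sup>2 + h\<^sup>2)) / h)"

lemma logsum_0 [simp]: "h > 0 \<Longrightarrow> logsum h 0 = 0"
  by (simp add: logsum_def)

lemma has_real_derivative_logsum [derivative_intros]:
  assumes h: "h > 0" and g: "(g has_real_derivative g') (at x within A)"
  shows "((\<lambda>x. logsum h (g x)) has_real_derivative g' / sqrt ((g x)\<^sup>2 + h\<^sup>2)) (at x within A)"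
proof -
  have "(logsum h has_real_derivative 1 / sqrt (x\<^sup>2 + h\<^sup>2)) (at x)" for x
  proof -
    define R where "R = sqrt (x\<^sup>2 + h\<^sup>2)"
    have s: "x\<^sup>2 + h\<^sup>2 > 0" using h by (simp add: add_nonneg_pos)
    then have R: "R > 0" by (simp add: R_def)
    have "\<bar>x\<bar> < R" unfolding R_def using h by (intro real_less_rsqrt) auto
    then have pos: "x + R > 0" by simp
    have "((\<lambda>x. (x + sqrt (x\<^sup>2 + h\<^sup>2)) / h) has_real_derivative (1 + x / R) / h) (at x)"
      unfolding R_def by (rule DERIV_cdivide DERIV_add DERIV_ident has_real_derivative_sqrt_sum s)+
    from DERIV_chain2[OF DERIV_ln this, unfolded R_def[symmetric]]
    have "(logsum h has_real_derivative inverse ((x + R) / h) * ((1 + x / R) / h)) (at x)"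
      unfolding logsum_def[abs_def] using pos h by simp
    also have "1 + x / R = (x + R) / R"
      using R by (simp add: field_simps)
    also have "inverse ((x + R) / h) * ((x + R) / R / h) = 1 / R"
      using pos h R by simp
    finally show ?thesis by (simp add: R_def)
  qed
  from DERIV_chain2[OF this g] show ?thesis by simp
qed

text \<open>Since \<open>logsum h 0 = 0\<close>, the quotient is the difference quotient of
  \<open>logsum h\<close> at 0.\<close>

lemma logsum_over_tendsto:
  assumes "h > 0"
  shows "((\<lambda>r. logsum h r / r) \<longlongrightarrow> 1 / h) (at_right 0)"
proof -
  have "(logsum h has_real_derivative 1 / h) (at 0)"
    using assms by (auto intro!: derivative_eq_intros)
  then have "((\<lambda>r. logsum h r / r) \<longlongrightarrow> 1 / h) (at 0)"
    using assms by (simp add: has_field_derivative_iff)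
  then show ?thesis by (rule filterlim_mono) (auto simp: at_within_le_at)
qed

text \<open>The angle of \<open>\<Phi>\<^sub>2\<close>; here \<open>h\<^sup>2 = a\<^sup>2 + b\<^sup>2\<close>, so that \<open>sqrt (h\<^sup>2 - a\<^sup>2) = b\<close>.\<close>

lemma has_real_derivative_angle:
  fixes a b r :: real
  assumes a: "a > 0" and b: "b > 0"
  defines "R \<equiv> sqrt (r\<^sup>2 + (a\<^sup>2 + b\<^sup>2))"
  shows "((\<lambda>r. arctan (a * r / (a\<^sup>2 + b\<^sup>2 + sqrt (r\<^sup>2 + (a\<^sup>2 + b\<^sup>2)) * b)))
    has_real_derivative a / (R * (R + b))) (at r)"
proof -
  have s: "r\<^sup>2 + (a\<^sup>2 + b\<^sup>2) > 0" using a by (simp add: add_nonneg_pos add_pos_nonneg)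
  then have R: "R > 0" and R2: "R * R = r\<^sup>2 + (a\<^sup>2 + b\<^sup>2)" by (auto simp: R_def)
  define D where "D = a\<^sup>2 + b\<^sup>2 + R * b"
  have D: "D > 0" using a b R by (simp add: D_def add_pos_pos)
  have DR: "((\<lambda>r. sqrt (r\<^sup>2 + (a\<^sup>2 + b\<^sup>2))) has_real_derivative r / R) (at r)"
    using has_real_derivative_sqrt_sum[OF s] by (simp add: R_def)
  have "((\<lambda>r. a * r / (a\<^sup>2 + b\<^sup>2 + sqrt (r\<^sup>2 + (a\<^sup>2 + b\<^sup>2)) * b)) has_real_derivative
      (a * D - a * r * (r / R * b)) / (D * D)) (at r)"
    by (rule derivative_eq_intros DR refl)+ (use D in \<open>auto simp: D_def R_def\<close>)
  from DERIV_chain2[OF DERIV_arctan this, folded R_def, folded D_def]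
  have "((\<lambda>r. arctan (a * r / (a\<^sup>2 + b\<^sup>2 + sqrt (r\<^sup>2 + (a\<^sup>2 + b\<^sup>2)) * b)))
    has_real_derivative inverse (1 + (a * r / D)\<^sup>2) * ((a * D - a * r * (r / R * b)) / (D * D))) (at r)"
    by simp
  also have "inverse (1 + (a * r / D)\<^sup>2) * ((a * D - a * r * (r / R * b)) / (D * D)) =
      (a * D - a * r * (r / R * b)) / (D\<^sup>2 + (a * r)\<^sup>2)"
  proof -
    have "1 + (a * r / D)\<^sup>2 = (D\<^sup>2 + (a * r)\<^sup>2) / (D * D)"
      using D by (simp add: power_divide power2_eq_square add_divide_distrib)
    then show ?thesis using D by simp
  qed
  also have "\<dots> = a / (R * (R + b))"
  proof -
    \<comment> \<open>Modulo \<open>R2\<close> the denominator contains the numerator as a factor,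
      with R + b as cofactor; this produces the short derivative.\<close>
    have "(D * R - r\<^sup>2 * b) * (R + b) = D\<^sup>2 + (a * r)\<^sup>2"
      using R2 unfolding D_def power2_eq_square by algebra
    moreover define E where "E = D\<^sup>2 + (a * r)\<^sup>2"
    moreover have "E > 0" using D by (simp add: E_def add_pos_nonneg)
    moreover have "a * D - a * r * (r / R * b) = a * (D * R - r\<^sup>2 * b) / R"
      using R by (simp add: field_simps power2_eq_square)
    moreover have "R + b \<noteq> 0" using R b by simp
    ultimately have "(a * D - a * r * (r / R * b)) / E = a / (R * (R + b))"
      using R by (simp add: divide_simps)
    then show ?thesis by (simp only: E_def)
  qed
  finally show ?thesis .
qed

text \<open>At h = 0 a kernel proportional to the inverse distance keeps this form, and only the
  constant is divided by d - 1. Starting from 1, the levels 4 and 3 give 1/3 and then 1/6, the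
  factor seen in the terminal functions with h_3 = h_4 = 0.\<close>

lemma approximates_next_zero:
  assumes "\<And>n. continuous_on {0..} (K n)" and "approximates K (\<lambda>t. c / sqrt t)" and "d \<ge> 2"
  shows "approximates (\<lambda>n. next_kernel d 0 (K n)) (\<lambda>t. c / real (d - 1) / sqrt t)"
proof (rule approximates_step[OF assms(1), where f = "\<lambda>r. c / r" and M = "\<lambda>r. c / real (d - 1) * r ^ (d - 1)"])
  show "((\<lambda>r. c / real (d - 1) * r ^ (d - 1)) \<longlongrightarrow> 0) (at_right 0)"
    using assms(3) by (auto intro!: tendsto_eq_intros)
next
  fix r :: real assume r: "r > 0"
  show "((\<lambda>r. c / real (d - 1) * r ^ (d - 1)) has_real_derivative
         r ^ (d - 1) * (c / sqrt (r\<^sup>2 + 0\<^sup>2))) (at r)"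
    apply (rule derivative_eq_intros refl)+
    using r assms(3) by (cases d; cases "d - 1") (auto simp: field_simps)
next
  fix r :: real assume r: "r > 0"
  show "c / real (d - 1) / r = c / real (d - 1) * r ^ (d - 1) / r ^ d"
    using r assms(3) by (cases d) (auto simp: field_simps)
qed (use assms in auto)

text \<open>The limit after level 4 for h_4 = h > 0. It is the antiderivative over r^4, simplified
  by (R - h)(R + h) = r^2 with R = \<open>sqrt (r\<^sup>2 + h\<^sup>2)\<close>.\<close>

definition lim3 :: "real \<Rightarrow> real \<Rightarrow> real" where
  "lim3 h r = (sqrt (r\<^sup>2 + h\<^sup>2) + 2 * h) / (3 * (sqrt (r\<^sup>2 + h\<^sup>2) + h)\<^sup>2)"

text \<open>In the variable R, the integral of r^3 / R becomes that of R^2 - h^2 from h on, which is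
  (R^3 - 3 h^2 R + 2 h^3) / 3 = (R - h)^2 (R + 2 h) / 3.\<close>

lemma approximates_h4:
  assumes "\<And>n. continuous_on {0..} (K n)" and "approximates K (\<lambda>t. 1 / sqrt t)" and h: "h > 0"
  shows "approximates (\<lambda>n. next_kernel 4 h (K n)) (\<lambda>t. lim3 h (sqrt t))"
proof (rule approximates_step[OF assms(1), where f = "\<lambda>r. 1 / r" and
    M = "\<lambda>r. (sqrt (r\<^sup>2 + h\<^sup>2) - h)\<^sup>2 * (sqrt (r\<^sup>2 + h\<^sup>2) + 2 * h) / 3"])
  show "((\<lambda>r. (sqrt (r\<^sup>2 + h\<^sup>2) - h)\<^sup>2 * (sqrt (r\<^sup>2 + h\<^sup>2) + 2 * h) / 3) \<longlongrightarrow> 0) (at_right 0)"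
    using h by (auto intro!: tendsto_eq_intros)
next
  fix r :: real assume r: "r > 0"
  define R where "R = sqrt (r\<^sup>2 + h\<^sup>2)"
  have s: "r\<^sup>2 + h\<^sup>2 > 0" using h by (simp add: add_nonneg_pos)
  then have R: "R > 0" "R * R = r\<^sup>2 + h\<^sup>2" by (auto simp: R_def)
  note dR = has_real_derivative_sqrt_sum[OF s, folded R_def]
  note dL = has_real_derivative_logsum[OF h DERIV_ident, of r, folded R_def]
  have "((\<lambda>r. (sqrt (r\<^sup>2 + h\<^sup>2) - h)\<^sup>2 * (sqrt (r\<^sup>2 + h\<^sup>2) + 2 * h) / 3) has_real_derivative
     (2 * (R - h) * (r / R) * (R + 2 * h) + (R - h)\<^sup>2 * (r / R)) / 3) (at r)"
    by (rule DERIV_cong, (rule dR DERIV_rules)+, fold R_def)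
      (use R in \<open>simp add: field_simps power2_eq_square\<close>)
  also have "(2 * (R - h) * (r / R) * (R + 2 * h) + (R - h)\<^sup>2 * (r / R)) / 3 = r ^ (4 - 1) * (1 / R)"
  proof -
    have "2 * (R - h) * r * (R + 2 * h) + (R - h)\<^sup>2 * r = 3 * r ^ 3"
      using R(2) unfolding power2_eq_square power3_eq_cube by algebra
    then show ?thesis using R(1) by (simp add: divide_simps)
  qed
  finally show "((\<lambda>r. (sqrt (r\<^sup>2 + h\<^sup>2) - h)\<^sup>2 * (sqrt (r\<^sup>2 + h\<^sup>2) + 2 * h) / 3) has_real_derivative
     r ^ (4 - 1) * (1 / sqrt (r\<^sup>2 + h\<^sup>2))) (at r)"
    by (simp only: R_def)
next
  fix r :: real assume r: "r > 0"
  define R where "R = sqrt (r\<^sup>2 + h\<^sup>2)"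
  have s: "r\<^sup>2 + h\<^sup>2 > 0" using h by (simp add: add_nonneg_pos)
  then have R: "R > 0" "R * R = r\<^sup>2 + h\<^sup>2" by (auto simp: R_def)
  note dR = has_real_derivative_sqrt_sum[OF s, folded R_def]
  note dL = has_real_derivative_logsum[OF h DERIV_ident, of r, folded R_def]
  have "(R - h)\<^sup>2 * (R + h)\<^sup>2 = r ^ 4"
    using R(2) by algebra
  then show "lim3 h r = (sqrt (r\<^sup>2 + h\<^sup>2) - h)\<^sup>2 * (sqrt (r\<^sup>2 + h\<^sup>2) + 2 * h) / 3 / r ^ 4"
    using R h r unfolding lim3_def R_def[symmetric]
    by (simp add: frac_eq_eq)
qed (use assms in auto)

text \<open>The limit after level 3 for h_3 = h > 0 and h_4 = 0. Its counterpart
  \<open>lim2b\<close> belongs to h_4 = h > 0 and h_3 = 0.\<close>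

definition lim2a :: "real \<Rightarrow> real \<Rightarrow> real" where
  "lim2a h r = (r * sqrt (r\<^sup>2 + h\<^sup>2) - h\<^sup>2 * logsum h r) / (6 * r ^ 3)"

lemma approximates_h3:
  assumes "\<And>n. continuous_on {0..} (K n)" and "approximates K (\<lambda>t. 1 / 3 / sqrt t)" and h: "h > 0"
  shows "approximates (\<lambda>n. next_kernel 3 h (K n)) (\<lambda>t. lim2a h (sqrt t))"
proof (rule approximates_step[OF assms(1), where f = "\<lambda>r. 1 / 3 / r" and
    M = "\<lambda>r. (r * sqrt (r\<^sup>2 + h\<^sup>2) - h\<^sup>2 * logsum h r) / 6"])
  have "isCont (logsum h) 0"
    using has_real_derivative_logsum[OF h DERIV_ident] by (rule DERIV_isCont)
  then have "(logsum h \<longlongrightarrow> 0) (at_right 0)"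
    using h by (auto simp: isCont_def intro: tendsto_mono[OF at_le])
  then show "((\<lambda>r. (r * sqrt (r\<^sup>2 + h\<^sup>2) - h\<^sup>2 * logsum h r) / 6) \<longlongrightarrow> 0) (at_right 0)"
    using h by (auto intro!: tendsto_eq_intros)
next
  fix r :: real assume r: "r > 0"
  define R where "R = sqrt (r\<^sup>2 + h\<^sup>2)"
  have s: "r\<^sup>2 + h\<^sup>2 > 0" using h by (simp add: add_nonneg_pos)
  then have R: "R > 0" "R * R = r\<^sup>2 + h\<^sup>2" by (auto simp: R_def)
  note dR = has_real_derivative_sqrt_sum[OF s, folded R_def]
  note dL = has_real_derivative_logsum[OF h DERIV_ident, of r, folded R_def]
  have "((\<lambda>r. (r * sqrt (r\<^sup>2 + h\<^sup>2) - h\<^sup>2 * logsum h r) / 6) has_real_derivative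
     (R + r * (r / R) - h\<^sup>2 * (1 / R)) / 6) (at r)"
    by (rule DERIV_cong, (rule dR dL DERIV_rules)+, fold R_def) simp
  also have "(R + r * (r / R) - h\<^sup>2 * (1 / R)) / 6 = r ^ (3 - 1) * (1 / 3 / R)"
    using R by (simp add: field_simps power2_eq_square)
  finally show "((\<lambda>r. (r * sqrt (r\<^sup>2 + h\<^sup>2) - h\<^sup>2 * logsum h r) / 6) has_real_derivative
     r ^ (3 - 1) * (1 / 3 / sqrt (r\<^sup>2 + h\<^sup>2))) (at r)"
    by (simp only: R_def)
qed (use assms in \<open>auto simp: lim2a_def\<close>)

definition lim2b :: "real \<Rightarrow> real \<Rightarrow> real" where
  "lim2b h r = (r * sqrt (r\<^sup>2 + h\<^sup>2) / 2 - 3 / 2 * h\<^sup>2 * logsum h r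
     + 2 * h\<^sup>2 * (r / (sqrt (r\<^sup>2 + h\<^sup>2) + h))) / (3 * r ^ 3)"

text \<open>Since r^2 = (R - h)(R + h), the integrand r^2 \<open>lim3 h r\<close> equals (R - 2 h^2
  / (R + h)) / 3, and 1 / (R + h) is the derivative of \<open>logsum h r\<close> - r / (R +
  h).\<close>

lemma approximates_h4_h3_zero:
  assumes "\<And>n. continuous_on {0..} (K n)" and "approximates K (\<lambda>t. lim3 h (sqrt t))" and h: "h > 0"
  shows "approximates (\<lambda>n. next_kernel 3 0 (K n)) (\<lambda>t. lim2b h (sqrt t))"
proof (rule approximates_step[OF assms(1), where f = "lim3 h" and
    M = "\<lambda>r. (r * sqrt (r\<^sup>2 + h\<^sup>2) / 2 - 3 / 2 * h\<^sup>2 * logsum h r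
     + 2 * h\<^sup>2 * (r / (sqrt (r\<^sup>2 + h\<^sup>2) + h))) / 3"])
  have "isCont (logsum h) 0"
    using has_real_derivative_logsum[OF h DERIV_ident] by (rule DERIV_isCont)
  then have "(logsum h \<longlongrightarrow> 0) (at_right 0)"
    using h by (auto simp: isCont_def intro: tendsto_mono[OF at_le])
  then show "((\<lambda>r. (r * sqrt (r\<^sup>2 + h\<^sup>2) / 2 - 3 / 2 * h\<^sup>2 * logsum h r
     + 2 * h\<^sup>2 * (r / (sqrt (r\<^sup>2 + h\<^sup>2) + h))) / 3) \<longlongrightarrow> 0) (at_right 0)"
    using h by (auto intro!: tendsto_eq_intros)
next
  fix r :: real assume r: "r > 0"
  define R where "R = sqrt (r\<^sup>2 + h\<^sup>2)"
  have s: "r\<^sup>2 + h\<^sup>2 > 0" using h by (simp add: add_nonneg_pos)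
  then have R: "R > 0" "R * R = r\<^sup>2 + h\<^sup>2" by (auto simp: R_def)
  note dR = has_real_derivative_sqrt_sum[OF s, folded R_def]
  note dL = has_real_derivative_logsum[OF h DERIV_ident, of r, folded R_def]
  have Rh: "sqrt (r\<^sup>2 + h\<^sup>2) + h \<noteq> 0" using R(1) h unfolding R_def by linarith
  have "((\<lambda>r. (r * sqrt (r\<^sup>2 + h\<^sup>2) / 2 - 3 / 2 * h\<^sup>2 * logsum h r
     + 2 * h\<^sup>2 * (r / (sqrt (r\<^sup>2 + h\<^sup>2) + h))) / 3) has_real_derivative
     ((R + r * (r / R)) / 2 - 3 / 2 * h\<^sup>2 * (1 / R) +
       2 * h\<^sup>2 * ((R + h - r * (r / R)) / (R + h)\<^sup>2)) / 3) (at r)"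
    by (rule DERIV_cong, (rule dR dL Rh DERIV_rules)+, fold R_def) (simp add: power2_eq_square)
  also have "((R + r * (r / R)) / 2 - 3 / 2 * h\<^sup>2 * (1 / R) +
       2 * h\<^sup>2 * ((R + h - r * (r / R)) / (R + h)\<^sup>2)) / 3 = r\<^sup>2 * ((R + 2 * h) / (3 * (R + h)\<^sup>2))"
  proof -
    have "((R * R + r * r) - 3 * h\<^sup>2) * (R + h)\<^sup>2 + 4 * h\<^sup>2 * (R * R + h * R - r * r)
       = 2 * R * r\<^sup>2 * (R + 2 * h)"
      using R(2) unfolding power2_eq_square by algebra
    then show ?thesis using R(1) h
      by (simp add: divide_simps) (simp add: algebra_simps power2_eq_square)
  qed
  finally show "((\<lambda>r. (r * sqrt (r\<^sup>2 + h\<^sup>2) / 2 - 3 / 2 * h\<^sup>2 * logsum h r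
     + 2 * h\<^sup>2 * (r / (sqrt (r\<^sup>2 + h\<^sup>2) + h))) / 3) has_real_derivative
     r ^ (3 - 1) * lim3 h (sqrt (r\<^sup>2 + 0\<^sup>2))) (at r)"
    using r by (simp add: lim3_def R_def)
qed (use assms in \<open>auto simp: lim2b_def\<close>)

text \<open>In two dimensions the substitution of sqrt(r^2 + h^2) for r turns the radial integral
  into one of r f(r) starting at h. One antiderivative \<open>N\<close> therefore serves every h_2,
  which enters only through the base point. The right-hand limit \<open>c\<close> replaces
  \<open>N h\<close> because \<open>N\<close> may be a quotient by r and h may be 0.\<close>

lemma approximates_h2:
  assumes cont: "\<And>n. continuous_on {0..} (K n)" and app: "approximates K (\<lambda>t. f (sqrt t))"
    and h: "h \<ge> 0" and lim: "(N \<longlongrightarrow> c) (at_right h)"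
    and N: "\<And>r. r > 0 \<Longrightarrow> (N has_real_derivative r * f r) (at r)"
  shows "approximates (\<lambda>n. next_kernel 2 h (K n)) (\<lambda>t. (N (sqrt ((sqrt t)\<^sup>2 + h\<^sup>2)) - c) / (sqrt t)\<^sup>2)"
proof (rule approximates_step[OF cont app, where M = "\<lambda>r. N (sqrt (r\<^sup>2 + h\<^sup>2)) - c"])
  have "h < sqrt (r\<^sup>2 + h\<^sup>2)" if "r \<noteq> 0" for r
    using h that by (intro real_less_rsqrt) auto
  then have "filterlim (\<lambda>r. sqrt (r\<^sup>2 + h\<^sup>2)) (at_right h) (at_right 0)"
    unfolding filterlim_at using h
    by (auto intro!: tendsto_eq_intros always_eventually simp: eventually_at_filter less_imp_neq[THEN not_sym])
  then have "((\<lambda>r. N (sqrt (r\<^sup>2 + h\<^sup>2))) \<longlongrightarrow> c) (at_right 0)"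
    by (rule filterlim_compose[OF lim])
  then show "((\<lambda>r. N (sqrt (r\<^sup>2 + h\<^sup>2)) - c) \<longlongrightarrow> 0) (at_right 0)"
    using LIM_zero by blast
next
  fix r :: real assume r: "r > 0"
  define R where "R = sqrt (r\<^sup>2 + h\<^sup>2)"
  have s: "r\<^sup>2 + h\<^sup>2 > 0" using r by (simp add: add_pos_nonneg)
  then have R: "R > 0" by (simp add: R_def)
  from DERIV_chain2[OF N[OF this, unfolded R_def] has_real_derivative_sqrt_sum[OF s]] R
  have "((\<lambda>r. N (sqrt (r\<^sup>2 + h\<^sup>2))) has_real_derivative r * f R) (at r)"
    by (simp add: R_def[symmetric] mult.commute)
  then show "((\<lambda>r. N (sqrt (r\<^sup>2 + h\<^sup>2)) - c) has_real_derivative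
      r ^ (2 - 1) * f (sqrt (r\<^sup>2 + h\<^sup>2))) (at r)"
    by (auto intro!: derivative_eq_intros simp: R_def)
qed auto

section \<open>Antiderivatives for the levels 2 and 1\<close>

definition prim2a :: "real \<Rightarrow> real \<Rightarrow> real" where
  "prim2a h r = (sqrt (r\<^sup>2 + h\<^sup>2) + h\<^sup>2 * (logsum h r / r)) / 6"

definition prim2b :: "real \<Rightarrow> real \<Rightarrow> real" where
  "prim2b h r = (sqrt (r\<^sup>2 + h\<^sup>2) / 2 + 3 / 2 * h\<^sup>2 * (logsum h r / r)
     - h\<^sup>2 / (sqrt (r\<^sup>2 + h\<^sup>2) + h)) / 3"

text \<open>Integration by parts: differentiating h^2 \<open>logsum h r\<close> / r yields the
  logarithmic term of 6 r \<open>lim2a h r\<close> together with h^2 / (r R), and R / r - h^2 / (r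
  R) = r / R is the derivative of R.\<close>

lemma has_real_derivative_prim2a:
  assumes h: "h > 0" and r: "r > 0"
  shows "(prim2a h has_real_derivative r * lim2a h r) (at r)"
proof -
  define R where "R = sqrt (r\<^sup>2 + h\<^sup>2)"
  have s: "r\<^sup>2 + h\<^sup>2 > 0" using h by (simp add: add_nonneg_pos)
  then have R: "R > 0" "R * R = r\<^sup>2 + h\<^sup>2" by (auto simp: R_def)
  note dR = has_real_derivative_sqrt_sum[OF s, folded R_def]
  note dL = has_real_derivative_logsum[OF h DERIV_ident, of r, folded R_def]
  have r0: "r \<noteq> 0" using r by simp
  have "(prim2a h has_real_derivative
      (r / R + h\<^sup>2 * ((1 / R * r - logsum h r) / r\<^sup>2)) / 6) (at r)"
    unfolding prim2a_def[abs_def]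
    by (rule DERIV_cong, (rule dR dL r0 DERIV_rules)+, fold R_def) (simp_all add: power2_eq_square mult.commute)
  also have "(r / R + h\<^sup>2 * ((1 / R * r - logsum h r) / r\<^sup>2)) / 6 = r * lim2a h r"
    unfolding lim2a_def R_def[symmetric] using r R
    by (simp add: divide_simps) algebra
  finally show ?thesis .
qed

lemma has_real_derivative_prim2b:
  assumes h: "h > 0" and r: "r > 0"
  shows "(prim2b h has_real_derivative r * lim2b h r) (at r)"
proof -
  define R where "R = sqrt (r\<^sup>2 + h\<^sup>2)"
  have s: "r\<^sup>2 + h\<^sup>2 > 0" using h by (simp add: add_nonneg_pos)
  then have R: "R > 0" "R * R = r\<^sup>2 + h\<^sup>2" by (auto simp: R_def)
  note dR = has_real_derivative_sqrt_sum[OF s, folded R_def]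
  note dL = has_real_derivative_logsum[OF h DERIV_ident, of r, folded R_def]
  have r0: "r \<noteq> 0" using r by simp
  have Rh: "sqrt (r\<^sup>2 + h\<^sup>2) + h \<noteq> 0" using R(1) h unfolding R_def by linarith
  have "(prim2b h has_real_derivative
      (r / R / 2 + 3 / 2 * h\<^sup>2 * ((1 / R * r - logsum h r) / r\<^sup>2) + h\<^sup>2 * (r / R) / (R + h)\<^sup>2) / 3) (at r)"
    unfolding prim2b_def[abs_def]
    by (rule DERIV_cong, (rule dR dL r0 Rh DERIV_rules)+, fold R_def) (simp add: power2_eq_square)
  also have "(r / R / 2 + 3 / 2 * h\<^sup>2 * ((1 / R * r - logsum h r) / r\<^sup>2) + h\<^sup>2 * (r / R) / (R + h)\<^sup>2) / 3
      = r * lim2b h r"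
  proof -
    have "R + h \<noteq> 0" using R h by simp
    then show ?thesis
      unfolding lim2b_def R_def[symmetric] using r R
      by (simp add: divide_simps) algebra
  qed
  finally show ?thesis .
qed

text \<open>At r = 0 the closed form would evaluate to h / 6, because division by zero yields 0. The
  actual limit comes from \<open>logsum h r / r\<close>, which tends to 1 / h.\<close>

lemma prim2a_tendsto:
  assumes h: "h > 0" and r: "r \<ge> 0"
  shows "(prim2a h \<longlongrightarrow> (if r = 0 then h / 3 else prim2a h r)) (at_right r)"
proof (cases "r = 0")
  case True
  have "(prim2a h \<longlongrightarrow> (sqrt (0\<^sup>2 + h\<^sup>2) + h\<^sup>2 * (1 / h)) / 6) (at_right 0)"
    unfolding prim2a_def[abs_def]
    by (intro tendsto_intros logsum_over_tendsto h) simp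
  then show ?thesis using True h by (simp add: power2_eq_square)
next
  case False
  then have "isCont (prim2a h) r" using has_real_derivative_prim2a[OF h, of r] r DERIV_isCont by auto
  then show ?thesis using False by (auto simp: isCont_def intro: tendsto_mono[OF at_le])
qed

lemma prim2b_tendsto:
  assumes h: "h > 0" and r: "r \<ge> 0"
  shows "(prim2b h \<longlongrightarrow> (if r = 0 then h / 2 else prim2b h r)) (at_right r)"
proof (cases "r = 0")
  case True
  have "(prim2b h \<longlongrightarrow> (sqrt (0\<^sup>2 + h\<^sup>2) / 2 + 3 / 2 * h\<^sup>2 * (1 / h)
     - h\<^sup>2 / (sqrt (0\<^sup>2 + h\<^sup>2) + h)) / 3) (at_right 0)"
    unfolding prim2b_def[abs_def]
    by (intro tendsto_intros logsum_over_tendsto h) (use h in auto)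
  then show ?thesis using True h by (simp add: power2_eq_square)
next
  case False
  then have "isCont (prim2b h) r" using has_real_derivative_prim2b[OF h, of r] r DERIV_isCont by auto
  then show ?thesis using False by (auto simp: isCont_def intro: tendsto_mono[OF at_le])
qed

text \<open>The limit after level 2 with h = h_2: \<open>N\<close> is an antiderivative of r times
  the limit after level 3, and \<open>c\<close> is its limit at the base point h from the
  right.\<close>

definition lim1 :: "(real \<Rightarrow> real) \<Rightarrow> real \<Rightarrow> real \<Rightarrow> real \<Rightarrow> real" where
  "lim1 N c h r = (N (sqrt (r\<^sup>2 + h\<^sup>2)) - c) / r\<^sup>2"

text \<open>The functions differentiated below are \<open>P F\<^sub>1(P)\<close> in the cases 1 to 7. In the cases 4 to 7,
  \<open>a\<close> is the nonzero one of \<open>h\<^sub>1, h\<^sub>2\<close> and \<open>b\<close> the nonzero one of \<open>h\<^sub>3, h\<^sub>4\<close>; in case 3,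
  \<open>a = h\<^sub>1\<close> and \<open>b = h\<^sub>2\<close>.\<close>

lemma DERIV_case1:
  assumes "h1 > 0"
  shows "((\<lambda>r. logsum h1 r / 6) has_real_derivative 1 / 6 / sqrt (r\<^sup>2 + h1\<^sup>2)) (at r)"
  using assms by (auto intro!: derivative_eq_intros)

text \<open>Because (R - h)(R + h) = r^2, the target is 1 / (6 (R + h)). Now 1 / (R + h) = 1 / R - h
  / (R (R + h)), and the second term is the derivative of r / (R + h).\<close>

lemma DERIV_case2:
  assumes h: "h > 0" and r: "r > 0"
  shows "((\<lambda>r. (logsum h r - r / (sqrt (r\<^sup>2 + h\<^sup>2) + h)) / 6) has_real_derivative
    lim1 (\<lambda>r. r / 6) (h / 6) h r) (at r)"
proof -
  define R where "R = sqrt (r\<^sup>2 + h\<^sup>2)"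
  have s: "r\<^sup>2 + h\<^sup>2 > 0" using h by (simp add: add_nonneg_pos)
  then have R: "R > 0" "R * R = r\<^sup>2 + h\<^sup>2" by (auto simp: R_def)
  note dR = has_real_derivative_sqrt_sum[OF s, folded R_def]
  note dL = has_real_derivative_logsum[OF h DERIV_ident, of r, folded R_def]
  have Rh: "sqrt (r\<^sup>2 + h\<^sup>2) + h \<noteq> 0" using R(1) h unfolding R_def by linarith
  have "((\<lambda>r. (logsum h r - r / (sqrt (r\<^sup>2 + h\<^sup>2) + h)) / 6) has_real_derivative
      (1 / R - (R + h - r * (r / R)) / (R + h)\<^sup>2) / 6) (at r)"
    by (rule DERIV_cong, (rule dR dL Rh DERIV_rules)+, fold R_def) (simp_all add: power2_eq_square mult.commute)
  also have "(1 / R - (R + h - r * (r / R)) / (R + h)\<^sup>2) / 6 = (R / 6 - h / 6) / r\<^sup>2"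
  proof -
    have "R + h \<noteq> 0" using R h by simp
    then show ?thesis using r R by (simp add: divide_simps) algebra
  qed
  finally show ?thesis by (simp add: lim1_def R_def)
qed

text \<open>Here R^2 - b^2 = r^2 + a^2, so the target is again 1 / (6 (R + b)) = (1 / R - b / (R (R
  + b))) / 6. With a > 0 the second term integrates to the angle instead of an algebraic
  function.\<close>

lemma DERIV_case3:
  assumes a: "a > 0" and b: "b > 0" and r: "r > 0"
  shows "((\<lambda>r. (logsum (sqrt (a\<^sup>2 + b\<^sup>2)) r
      - b / a * arctan (a * r / (a\<^sup>2 + b\<^sup>2 + sqrt (r\<^sup>2 + (a\<^sup>2 + b\<^sup>2)) * b))) / 6) has_real_derivative
    lim1 (\<lambda>r. r / 6) (b / 6) b (sqrt (r\<^sup>2 + a\<^sup>2))) (at r)"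
proof -
  define h where "h = sqrt (a\<^sup>2 + b\<^sup>2)"
  have ab: "a\<^sup>2 + b\<^sup>2 > 0" using a by (simp add: add_pos_nonneg)
  then have h: "h > 0" "h\<^sup>2 = a\<^sup>2 + b\<^sup>2" by (auto simp: h_def)
  define R where "R = sqrt (r\<^sup>2 + (a\<^sup>2 + b\<^sup>2))"
  have s: "r\<^sup>2 + (a\<^sup>2 + b\<^sup>2) > 0" using ab by (simp add: add_nonneg_pos)
  then have R: "R > 0" "R * R = r\<^sup>2 + (a\<^sup>2 + b\<^sup>2)" by (auto simp: R_def)
  have s1: "r\<^sup>2 + a\<^sup>2 > 0" using a by (simp add: add_nonneg_pos)
  note dL = has_real_derivative_logsum[OF h(1) DERIV_ident, of r, unfolded h(2), folded R_def]
  note dT = has_real_derivative_angle[OF a b, of r, folded R_def]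
  have "((\<lambda>r. (logsum h r
      - b / a * arctan (a * r / (a\<^sup>2 + b\<^sup>2 + sqrt (r\<^sup>2 + (a\<^sup>2 + b\<^sup>2)) * b))) / 6) has_real_derivative
      (1 / R - b / a * (a / (R * (R + b)))) / 6) (at r)"
    by (rule DERIV_cong, (rule dL dT DERIV_rules)+) (simp_all add: power2_eq_square)
  also have "(1 / R - b / a * (a / (R * (R + b)))) / 6 = (R / 6 - b / 6) / (r\<^sup>2 + a\<^sup>2)"
  proof -
    have "R + b \<noteq> 0" using R b by simp
    then show ?thesis using s1 a R by (simp add: divide_simps) algebra
  qed
  finally show ?thesis using s1 by (simp add: lim1_def R_def h_def add.assoc)
qed

text \<open>In the remaining cases, \<open>logsum b (sqrt (r\<^sup>2 + a\<^sup>2))\<close> is the logarithm of \<open>\<Phi>\<^sub>3\<close> and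
  \<open>\<Phi>\<^sub>4\<close>.\<close>

lemma DERIV_logsum_sqrt:
  assumes b: "b > 0" and a: "a > 0"
  shows "((\<lambda>r. logsum b (sqrt (r\<^sup>2 + a\<^sup>2))) has_real_derivative
    r / (sqrt (r\<^sup>2 + a\<^sup>2) * sqrt (r\<^sup>2 + (a\<^sup>2 + b\<^sup>2)))) (at r)"
proof -
  have s1: "r\<^sup>2 + a\<^sup>2 > 0" using a by (simp add: add_nonneg_pos)
  show ?thesis
    using has_real_derivative_logsum[OF b has_real_derivative_sqrt_sum[OF s1]] s1 by (simp add: add.assoc)
qed

text \<open>The target contains L / R1^3 with L = \<open>logsum b R1\<close>. As r / R1 has
  derivative a^2 / R1^3, this term is integrated by parts, which explains the coefficient b^2 / a^2;
  what is left contains no logarithm and is covered by \<open>logsum\<close> and the angle.\<close>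

lemma DERIV_case4:
  assumes a: "a > 0" and b: "b > 0" and r: "r > 0"
  shows "((\<lambda>r. ((1 - b\<^sup>2 / a\<^sup>2) * logsum (sqrt (a\<^sup>2 + b\<^sup>2)) r
      - 2 * b / a * arctan (a * r / (a\<^sup>2 + b\<^sup>2 + sqrt (r\<^sup>2 + (a\<^sup>2 + b\<^sup>2)) * b))
      + b\<^sup>2 / a\<^sup>2 * (r / sqrt (r\<^sup>2 + a\<^sup>2) * logsum b (sqrt (r\<^sup>2 + a\<^sup>2)))) / 6) has_real_derivative
    lim1 (prim2a b) (b / 3) 0 (sqrt (r\<^sup>2 + a\<^sup>2))) (at r)"
proof -
  define h where "h = sqrt (a\<^sup>2 + b\<^sup>2)"
  have ab: "a\<^sup>2 + b\<^sup>2 > 0" using a by (simp add: add_pos_nonneg)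
  then have h: "h > 0" "h\<^sup>2 = a\<^sup>2 + b\<^sup>2" by (auto simp: h_def)
  define R where "R = sqrt (r\<^sup>2 + (a\<^sup>2 + b\<^sup>2))"
  have s: "r\<^sup>2 + (a\<^sup>2 + b\<^sup>2) > 0" using ab by (simp add: add_nonneg_pos)
  then have R: "R > 0" "R * R = r\<^sup>2 + (a\<^sup>2 + b\<^sup>2)" by (auto simp: R_def)
  define R1 where "R1 = sqrt (r\<^sup>2 + a\<^sup>2)"
  have s1: "r\<^sup>2 + a\<^sup>2 > 0" using a by (simp add: add_nonneg_pos)
  then have R1: "R1 > 0" "R1 * R1 = r\<^sup>2 + a\<^sup>2" by (auto simp: R1_def)
  have R1nz: "sqrt (r\<^sup>2 + a\<^sup>2) \<noteq> 0" using R1(1) unfolding R1_def by linarith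
  define L where "L = logsum b (sqrt (r\<^sup>2 + a\<^sup>2))"
  have Rb: "R + b \<noteq> 0" using R b by simp
  note dL = has_real_derivative_logsum[OF h(1) DERIV_ident, of r, unfolded h(2), folded R_def]
  note dT = has_real_derivative_angle[OF a b, of r, folded R_def]
  note dR1 = has_real_derivative_sqrt_sum[OF s1, folded R1_def]
  note dL1 = DERIV_logsum_sqrt[OF b a, of r, folded R_def R1_def]
  have "((\<lambda>r. ((1 - b\<^sup>2 / a\<^sup>2) * logsum h r
      - 2 * b / a * arctan (a * r / (a\<^sup>2 + b\<^sup>2 + sqrt (r\<^sup>2 + (a\<^sup>2 + b\<^sup>2)) * b))
      + b\<^sup>2 / a\<^sup>2 * (r / sqrt (r\<^sup>2 + a\<^sup>2) * logsum b (sqrt (r\<^sup>2 + a\<^sup>2)))) / 6) has_real_derivative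
      ((1 - b\<^sup>2 / a\<^sup>2) * (1 / R) - 2 * b / a * (a / (R * (R + b)))
       + b\<^sup>2 / a\<^sup>2 * ((R1 - r * (r / R1)) / (R1 * R1) * L + r / (R1 * R) * (r / R1))) / 6) (at r)"
    by (rule DERIV_cong, (rule dL dT dR1 dL1 R1nz DERIV_rules)+, fold R1_def, fold L_def[folded R1_def])
      (simp_all add: power2_eq_square mult.commute)
  also have "((1 - b\<^sup>2 / a\<^sup>2) * (1 / R) - 2 * b / a * (a / (R * (R + b)))
       + b\<^sup>2 / a\<^sup>2 * ((R1 - r * (r / R1)) / (R1 * R1) * L + r / (R1 * R) * (r / R1))) / 6
     = ((R + b\<^sup>2 * (L / R1)) / 6 - b / 3) / R1\<^sup>2"
    using a R1 R Rb by (simp add: divide_simps) algebra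
  also have "\<dots> = lim1 (prim2a b) (b / 3) 0 (sqrt (r\<^sup>2 + a\<^sup>2))"
    using R1 unfolding lim1_def prim2a_def L_def
    by (simp add: R1_def R_def add.assoc power2_eq_square)
  finally show ?thesis by (simp only: h_def)
qed

text \<open>The logarithm is integrated by parts through r / R1 exactly as for h_3. The additional
  summand b^2 / ((R + b) R1^2), inherited from \<open>prim2b\<close>, is what brings in r / (R +
  b).\<close>

lemma DERIV_case6:
  assumes a: "a > 0" and b: "b > 0" and r: "r > 0"
  shows "((\<lambda>r. ((1 - 3 * b\<^sup>2 / a\<^sup>2) * logsum (sqrt (a\<^sup>2 + b\<^sup>2)) r
      - (3 - b\<^sup>2 / a\<^sup>2) * (b / a) * arctan (a * r / (a\<^sup>2 + b\<^sup>2 + sqrt (r\<^sup>2 + (a\<^sup>2 + b\<^sup>2)) * b))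
      + 3 * (b\<^sup>2 / a\<^sup>2) * (r / sqrt (r\<^sup>2 + a\<^sup>2) * logsum b (sqrt (r\<^sup>2 + a\<^sup>2)))
      - b\<^sup>2 / a\<^sup>2 * (r / (sqrt (r\<^sup>2 + (a\<^sup>2 + b\<^sup>2)) + b))) / 6) has_real_derivative
    lim1 (prim2b b) (b / 2) 0 (sqrt (r\<^sup>2 + a\<^sup>2))) (at r)"
proof -
  define h where "h = sqrt (a\<^sup>2 + b\<^sup>2)"
  have ab: "a\<^sup>2 + b\<^sup>2 > 0" using a by (simp add: add_pos_nonneg)
  then have h: "h > 0" "h\<^sup>2 = a\<^sup>2 + b\<^sup>2" by (auto simp: h_def)
  define R where "R = sqrt (r\<^sup>2 + (a\<^sup>2 + b\<^sup>2))"
  have s: "r\<^sup>2 + (a\<^sup>2 + b\<^sup>2) > 0" using ab by (simp add: add_nonneg_pos)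
  then have R: "R > 0" "R * R = r\<^sup>2 + (a\<^sup>2 + b\<^sup>2)" by (auto simp: R_def)
  define R1 where "R1 = sqrt (r\<^sup>2 + a\<^sup>2)"
  have s1: "r\<^sup>2 + a\<^sup>2 > 0" using a by (simp add: add_nonneg_pos)
  then have R1: "R1 > 0" "R1 * R1 = r\<^sup>2 + a\<^sup>2" by (auto simp: R1_def)
  have R1nz: "sqrt (r\<^sup>2 + a\<^sup>2) \<noteq> 0" using R1(1) unfolding R1_def by linarith
  define L where "L = logsum b (sqrt (r\<^sup>2 + a\<^sup>2))"
  have Rb: "R + b \<noteq> 0" using R b by simp
  note Rb' = Rb[unfolded R_def]
  note dR = has_real_derivative_sqrt_sum[OF s, folded R_def]
  note dL = has_real_derivative_logsum[OF h(1) DERIV_ident, of r, unfolded h(2), folded R_def]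
  note dT = has_real_derivative_angle[OF a b, of r, folded R_def]
  note dR1 = has_real_derivative_sqrt_sum[OF s1, folded R1_def]
  note dL1 = DERIV_logsum_sqrt[OF b a, of r, folded R_def R1_def]
  have "((\<lambda>r. ((1 - 3 * b\<^sup>2 / a\<^sup>2) * logsum h r
      - (3 - b\<^sup>2 / a\<^sup>2) * (b / a) * arctan (a * r / (a\<^sup>2 + b\<^sup>2 + sqrt (r\<^sup>2 + (a\<^sup>2 + b\<^sup>2)) * b))
      + 3 * (b\<^sup>2 / a\<^sup>2) * (r / sqrt (r\<^sup>2 + a\<^sup>2) * logsum b (sqrt (r\<^sup>2 + a\<^sup>2)))
      - b\<^sup>2 / a\<^sup>2 * (r / (sqrt (r\<^sup>2 + (a\<^sup>2 + b\<^sup>2)) + b))) / 6) has_real_derivative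
      ((1 - 3 * b\<^sup>2 / a\<^sup>2) * (1 / R) - (3 - b\<^sup>2 / a\<^sup>2) * (b / a) * (a / (R * (R + b)))
       + 3 * (b\<^sup>2 / a\<^sup>2) * ((R1 - r * (r / R1)) / (R1 * R1) * L + r / (R1 * R) * (r / R1))
       - b\<^sup>2 / a\<^sup>2 * ((R + b - r * (r / R)) / ((R + b) * (R + b)))) / 6) (at r)"
    by (rule DERIV_cong, (rule dR dL dT dR1 dL1 R1nz Rb' DERIV_rules)+, fold R1_def R_def,
        fold L_def[folded R1_def])
      (simp_all add: power2_eq_square mult.commute)
  also have "((1 - 3 * b\<^sup>2 / a\<^sup>2) * (1 / R) - (3 - b\<^sup>2 / a\<^sup>2) * (b / a) * (a / (R * (R + b)))
       + 3 * (b\<^sup>2 / a\<^sup>2) * ((R1 - r * (r / R1)) / (R1 * R1) * L + r / (R1 * R) * (r / R1))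
       - b\<^sup>2 / a\<^sup>2 * ((R + b - r * (r / R)) / ((R + b) * (R + b)))) / 6
     = ((R / 2 + 3 / 2 * b\<^sup>2 * (L / R1) - b\<^sup>2 / (R + b)) / 3 - b / 2) / R1\<^sup>2"
    using a R1 R Rb by (simp add: divide_simps) algebra
  also have "\<dots> = lim1 (prim2b b) (b / 2) 0 (sqrt (r\<^sup>2 + a\<^sup>2))"
    using R1 unfolding lim1_def prim2b_def L_def
    by (simp add: R1_def R_def add.assoc power2_eq_square)
  finally show ?thesis by (simp only: h_def)
qed

text \<open>The bracket of \<open>Phi4\<close> divided by r, so that r times \<open>Phi4\<close> is
  b^2 / a times this function. The difference is kept together because its two terms separately stay
  away from 0 as r tends to 0.\<close>

definition logdiff :: "real \<Rightarrow> real \<Rightarrow> real \<Rightarrow> real" where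
  "logdiff a b r = (sqrt (r\<^sup>2 + a\<^sup>2) / a * logsum b (sqrt (r\<^sup>2 + a\<^sup>2)) - logsum b a) / r"

text \<open>\<open>logdiff a b\<close> is a difference quotient at 0 of a function that depends on r
  only through r^2 and hence has derivative 0 there.\<close>

lemma logdiff_tendsto:
  assumes a: "a > 0" and b: "b > 0"
  shows "(logdiff a b \<longlongrightarrow> 0) (at_right 0)"
proof -
  let ?f = "\<lambda>r. sqrt (r\<^sup>2 + a\<^sup>2) / a * logsum b (sqrt (r\<^sup>2 + a\<^sup>2))"
  have s1: "0\<^sup>2 + a\<^sup>2 > 0" using a by simp
  note dR1 = has_real_derivative_sqrt_sum[OF s1]
  note dL1 = DERIV_logsum_sqrt[OF b a, of 0]
  have an: "a \<noteq> 0" using a by simp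
  have "(?f has_real_derivative 0) (at 0)"
    by (rule DERIV_cong, (rule dR1 dL1 an DERIV_rules)+) simp
  then have "((\<lambda>r. (?f r - logsum b a) / r) \<longlongrightarrow> 0) (at 0)"
    using a by (simp add: has_field_derivative_iff)
  then have "(logdiff a b \<longlongrightarrow> 0) (at 0)" by (simp add: logdiff_def[abs_def])
  then show ?thesis by (rule filterlim_mono) (auto simp: at_within_le_at)
qed

lemma DERIV_logdiff:
  assumes a: "a > 0" and b: "b > 0" and r: "r > 0"
  shows "(logdiff a b has_real_derivative
    (1 / (a * sqrt (r\<^sup>2 + (a\<^sup>2 + b\<^sup>2)))
      + (logsum b a - a / sqrt (r\<^sup>2 + a\<^sup>2) * logsum b (sqrt (r\<^sup>2 + a\<^sup>2))) / r\<^sup>2)) (at r)"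
proof -
  define R where "R = sqrt (r\<^sup>2 + (a\<^sup>2 + b\<^sup>2))"
  have s: "r\<^sup>2 + (a\<^sup>2 + b\<^sup>2) > 0" using a by (simp add: add_nonneg_pos add_pos_nonneg)
  then have R: "R > 0" "R * R = r\<^sup>2 + (a\<^sup>2 + b\<^sup>2)" by (auto simp: R_def)
  define R1 where "R1 = sqrt (r\<^sup>2 + a\<^sup>2)"
  have s1: "r\<^sup>2 + a\<^sup>2 > 0" using a by (simp add: add_nonneg_pos)
  then have R1: "R1 > 0" "R1 * R1 = r\<^sup>2 + a\<^sup>2" by (auto simp: R1_def)
  define L where "L = logsum b R1"
  define L0 where "L0 = logsum b a"
  note dR1 = has_real_derivative_sqrt_sum[OF s1, folded R1_def]
  note dL1 = DERIV_logsum_sqrt[OF b a, of r, folded R_def R1_def]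
  have rn: "r \<noteq> 0" using r by simp
  have "(logdiff a b has_real_derivative
      ((r / R1 / a * L + r / (R1 * R) * (R1 / a)) * r - (R1 / a * L - L0)) / (r * r)) (at r)"
    unfolding logdiff_def[abs_def]
    by (rule DERIV_cong, (rule dR1 dL1 rn DERIV_rules)+, fold R1_def, fold L_def L0_def)
      (simp_all add: power2_eq_square)
  also have "((r / R1 / a * L + r / (R1 * R) * (R1 / a)) * r - (R1 / a * L - L0)) / (r * r)
    = 1 / (a * R) + (L0 - a / R1 * L) / r\<^sup>2"
    using a R1 R r by (simp add: divide_simps) algebra
  finally show ?thesis by (simp only: L_def L0_def R_def R1_def)
qed

text \<open>The target splits into (R - h) / (6 r^2), treated as for h_2 alone, and b^2 (L / R1 - L0
  / a) / (6 r^2), the logarithmic part of the derivative of -b^2 / a times \<open>logdiff\<close>,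
  divided by 6. The other part of that derivative, -b^2 / (a^2 R), is offset by the coefficient (a^2
  + b^2) / a^2 of \<open>logsum\<close>, which exceeds 1 by b^2 / a^2.\<close>

lemma DERIV_case5:
  assumes a: "a > 0" and b: "b > 0" and r: "r > 0"
  shows "((\<lambda>r. ((a\<^sup>2 + b\<^sup>2) / a\<^sup>2 * logsum (sqrt (a\<^sup>2 + b\<^sup>2)) r
      - r / (sqrt (r\<^sup>2 + (a\<^sup>2 + b\<^sup>2)) + sqrt (a\<^sup>2 + b\<^sup>2)) - b\<^sup>2 / a * logdiff a b r) / 6) has_real_derivative
    lim1 (prim2a b) (prim2a b a) a r) (at r)"
proof -
  define h where "h = sqrt (a\<^sup>2 + b\<^sup>2)"
  have ab: "a\<^sup>2 + b\<^sup>2 > 0" using a by (simp add: add_pos_nonneg)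
  then have h: "h > 0" "h\<^sup>2 = a\<^sup>2 + b\<^sup>2" by (auto simp: h_def)
  define R where "R = sqrt (r\<^sup>2 + (a\<^sup>2 + b\<^sup>2))"
  have s: "r\<^sup>2 + (a\<^sup>2 + b\<^sup>2) > 0" using ab by (simp add: add_nonneg_pos)
  then have R: "R > 0" "R * R = r\<^sup>2 + (a\<^sup>2 + b\<^sup>2)" by (auto simp: R_def)
  define R1 where "R1 = sqrt (r\<^sup>2 + a\<^sup>2)"
  have s1: "r\<^sup>2 + a\<^sup>2 > 0" using a by (simp add: add_nonneg_pos)
  then have R1: "R1 > 0" "R1 * R1 = r\<^sup>2 + a\<^sup>2" by (auto simp: R1_def)
  define L where "L = logsum b R1"
  define L0 where "L0 = logsum b a"
  have Rh: "R + h \<noteq> 0" using R h by simp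
  note Rh' = Rh[unfolded R_def]
  note dR = has_real_derivative_sqrt_sum[OF s, folded R_def]
  note dL = has_real_derivative_logsum[OF h(1) DERIV_ident, of r, unfolded h(2), folded R_def]
  note dD = DERIV_logdiff[OF a b r, folded R_def R1_def, folded L_def L0_def]
  have "((\<lambda>r. ((a\<^sup>2 + b\<^sup>2) / a\<^sup>2 * logsum h r
      - r / (sqrt (r\<^sup>2 + (a\<^sup>2 + b\<^sup>2)) + h) - b\<^sup>2 / a * logdiff a b r) / 6) has_real_derivative
      ((a\<^sup>2 + b\<^sup>2) / a\<^sup>2 * (1 / R) - (R + h - r * (r / R)) / ((R + h) * (R + h))
        - b\<^sup>2 / a * (1 / (a * R) + (L0 - a / R1 * L) / r\<^sup>2)) / 6) (at r)"
    by (rule DERIV_cong, (rule dR dL dD Rh' DERIV_rules)+, fold R_def)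
      (simp_all add: power2_eq_square mult.commute)
  also have "((a\<^sup>2 + b\<^sup>2) / a\<^sup>2 * (1 / R) - (R + h - r * (r / R)) / ((R + h) * (R + h))
        - b\<^sup>2 / a * (1 / (a * R) + (L0 - a / R1 * L) / r\<^sup>2)) / 6
     = ((R + b\<^sup>2 * (L / R1)) / 6 - (h + b\<^sup>2 * (L0 / a)) / 6) / r\<^sup>2"
    using a R1 R Rh r h(2) by (simp add: divide_simps) algebra
  also have "\<dots> = lim1 (prim2a b) (prim2a b a) a r"
    using R1 unfolding lim1_def prim2a_def L_def L0_def
    by (simp add: R1_def R_def h_def add.assoc power2_eq_square)
  finally show ?thesis by (simp only: h_def)
qed

text \<open>The two parts met for h_3 reappear in another proportion. In addition
  \<open>prim2b\<close> contributes the difference of b^2 / (R + b) and b^2 / (h + b) over r^2, the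
  source of the angle.\<close>

lemma DERIV_case7:
  assumes a: "a > 0" and b: "b > 0" and r: "r > 0"
  shows "((\<lambda>r. ((1 + 3 * b\<^sup>2 / a\<^sup>2) * logsum (sqrt (a\<^sup>2 + b\<^sup>2)) r
      - 2 * b ^ 3 / a ^ 3 * arctan (a * r / (a\<^sup>2 + b\<^sup>2 + sqrt (r\<^sup>2 + (a\<^sup>2 + b\<^sup>2)) * b))
      - 3 * (b\<^sup>2 / a) * logdiff a b r
      + (2 * b\<^sup>2 - a\<^sup>2) / a\<^sup>2 * (r / (sqrt (r\<^sup>2 + (a\<^sup>2 + b\<^sup>2)) + sqrt (a\<^sup>2 + b\<^sup>2)))) / 6) has_real_derivative
    lim1 (prim2b b) (prim2b b a) a r) (at r)"
proof -
  define h where "h = sqrt (a\<^sup>2 + b\<^sup>2)"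
  have ab: "a\<^sup>2 + b\<^sup>2 > 0" using a by (simp add: add_pos_nonneg)
  then have h: "h > 0" "h\<^sup>2 = a\<^sup>2 + b\<^sup>2" by (auto simp: h_def)
  define R where "R = sqrt (r\<^sup>2 + (a\<^sup>2 + b\<^sup>2))"
  have s: "r\<^sup>2 + (a\<^sup>2 + b\<^sup>2) > 0" using ab by (simp add: add_nonneg_pos)
  then have R: "R > 0" "R * R = r\<^sup>2 + (a\<^sup>2 + b\<^sup>2)" by (auto simp: R_def)
  define R1 where "R1 = sqrt (r\<^sup>2 + a\<^sup>2)"
  have s1: "r\<^sup>2 + a\<^sup>2 > 0" using a by (simp add: add_nonneg_pos)
  then have R1: "R1 > 0" "R1 * R1 = r\<^sup>2 + a\<^sup>2" by (auto simp: R1_def)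
  define L where "L = logsum b R1"
  define L0 where "L0 = logsum b a"
  have Rh: "R + h \<noteq> 0" "R + b \<noteq> 0" "h + b \<noteq> 0" using R h b by auto
  note Rh' = Rh[unfolded R_def]
  note dR = has_real_derivative_sqrt_sum[OF s, folded R_def]
  note dL = has_real_derivative_logsum[OF h(1) DERIV_ident, of r, unfolded h(2), folded R_def]
  note dT = has_real_derivative_angle[OF a b, of r, folded R_def]
  note dD = DERIV_logdiff[OF a b r, folded R_def R1_def, folded L_def L0_def]
  have "((\<lambda>r. ((1 + 3 * b\<^sup>2 / a\<^sup>2) * logsum h r
      - 2 * b ^ 3 / a ^ 3 * arctan (a * r / (a\<^sup>2 + b\<^sup>2 + sqrt (r\<^sup>2 + (a\<^sup>2 + b\<^sup>2)) * b))
      - 3 * (b\<^sup>2 / a) * logdiff a b r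
      + (2 * b\<^sup>2 - a\<^sup>2) / a\<^sup>2 * (r / (sqrt (r\<^sup>2 + (a\<^sup>2 + b\<^sup>2)) + h))) / 6) has_real_derivative
      ((1 + 3 * b\<^sup>2 / a\<^sup>2) * (1 / R) - 2 * b ^ 3 / a ^ 3 * (a / (R * (R + b)))
        - 3 * (b\<^sup>2 / a) * (1 / (a * R) + (L0 - a / R1 * L) / r\<^sup>2)
        + (2 * b\<^sup>2 - a\<^sup>2) / a\<^sup>2 * ((R + h - r * (r / R)) / ((R + h) * (R + h)))) / 6) (at r)"
    by (rule DERIV_cong, (rule dR dL dT dD Rh' DERIV_rules)+, fold R_def)
      (simp_all add: power2_eq_square mult.commute)
  also have "((1 + 3 * b\<^sup>2 / a\<^sup>2) * (1 / R) - 2 * b ^ 3 / a ^ 3 * (a / (R * (R + b)))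
        - 3 * (b\<^sup>2 / a) * (1 / (a * R) + (L0 - a / R1 * L) / r\<^sup>2)
        + (2 * b\<^sup>2 - a\<^sup>2) / a\<^sup>2 * ((R + h - r * (r / R)) / ((R + h) * (R + h)))) / 6
     = ((R / 2 + 3 / 2 * b\<^sup>2 * (L / R1) - b\<^sup>2 / (R + b)) / 3
        - (h / 2 + 3 / 2 * b\<^sup>2 * (L0 / a) - b\<^sup>2 / (h + b)) / 3) / r\<^sup>2"
    using a R1 R Rh r h(2) by (simp add: divide_simps) algebra
  also have "\<dots> = lim1 (prim2b b) (prim2b b a) a r"
    using R1 unfolding lim1_def prim2b_def L_def L0_def
    by (simp add: R1_def R_def h_def add.assoc power2_eq_square)
  finally show ?thesis by (simp only: h_def)
qed

section \<open>The regularised kernel and its iterates\<close>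

definition base_kernel :: "nat \<Rightarrow> real \<Rightarrow> real" where
  "base_kernel n t = 1 / sqrt (t + (1 / real (Suc n))\<^sup>2)"

text \<open>\<open>k\<close> counts steps from the top: \<open>kern n h k\<close> has used the last
  k of the values h_1, ..., h_4 and is the kernel of the calls of level 4 - k.\<close>

primrec kern :: "nat \<Rightarrow> (nat \<Rightarrow> real) \<Rightarrow> nat \<Rightarrow> real \<Rightarrow> real" where
  "kern n h 0 = base_kernel n"
| "kern n h (Suc k) = next_kernel (4 - k) (h (4 - k)) (kern n h k)"

lemma c1_base_kernel: "\<exists>K'. c1_kernel (base_kernel n) K'"
proof -
  define e where "e = (1 / real (Suc n))\<^sup>2"
  have e: "e > 0" by (simp add: e_def)
  define K' where "K' t = - (1 / (2 * sqrt (t + e))) / (t + e)" for t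
  have "(base_kernel n has_real_derivative K' t) (at t within {0..})" if "t \<ge> 0" for t
  proof -
    have te: "t + e > 0" using that e by simp
    have "((\<lambda>t. sqrt (t + e)) has_real_derivative 1 / (2 * sqrt (t + e))) (at t within {0..})"
      using te by (auto intro!: derivative_eq_intros simp: field_simps)
    then have "((\<lambda>t. 1 / sqrt (t + e)) has_real_derivative
        (0 * sqrt (t + e) - 1 * (1 / (2 * sqrt (t + e)))) / (sqrt (t + e) * sqrt (t + e))) (at t within {0..})"
      by (intro DERIV_divide DERIV_const) (use te in auto)
    then show ?thesis unfolding base_kernel_def[abs_def] e_def[symmetric] K'_def using te by simp
  qed
  moreover have "continuous_on {0..} K'"
    unfolding K'_def[abs_def] by (intro continuous_intros) (use e in auto)
  ultimately have "c1_kernel (base_kernel n) K'" by (simp add: c1_kernel_def)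
  then show ?thesis by (rule exI[where x = K'])
qed

lemma c1_kern: "k \<le> 4 \<Longrightarrow> \<exists>K'. c1_kernel (kern n h k) K'"
proof (induction k)
  case 0
  then show ?case using c1_base_kernel by simp
next
  case (Suc k)
  then obtain K' where "c1_kernel (kern n h k) K'" by auto
  then have "c1_kernel (kern n h (Suc k))
      (\<lambda>t. integral {0..1} (\<lambda>l. l ^ (4 - k + 1) * K' (l\<^sup>2 * t + (h (4 - k))\<^sup>2)))"
    unfolding kern.simps using Suc.prems by (intro c1_kernel_next) auto
  then show ?case by blast
qed

lemma continuous_kern: "k \<le> 4 \<Longrightarrow> continuous_on {0..} (kern n h k)"
  by (drule c1_kern) (auto intro: c1_kernel_continuous)

lemma approximates_base_kernel: "approximates base_kernel (\<lambda>t. 1 / sqrt t)"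
  unfolding approximates_def
proof (intro allI impI conjI)
  fix t :: real and n assume t: "t > 0"
  show "0 \<le> base_kernel n t" using t by (simp add: base_kernel_def)
  show "base_kernel n t \<le> 1 / sqrt t"
    unfolding base_kernel_def using t by (intro divide_left_mono real_sqrt_le_mono) (auto simp: add_pos_nonneg)
next
  fix t :: real assume t: "t > 0"
  have "(\<lambda>n. 1 / sqrt (t + (1 / real (Suc n))\<^sup>2)) \<longlonglongrightarrow> 1 / sqrt (t + 0\<^sup>2)"
    by (intro tendsto_intros lim_1_over_n[THEN LIMSEQ_Suc]) (use t in auto)
  then show "(\<lambda>n. base_kernel n t) \<longlonglongrightarrow> 1 / sqrt t" by (simp add: base_kernel_def[abs_def])
qed

lemma approximates_h1:
  assumes "\<And>n. continuous_on {0..} (K n)" and "approximates K (\<lambda>t. f (sqrt t))"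
    and "(M \<longlongrightarrow> 0) (at_right 0)"
    and "\<And>r. r > 0 \<Longrightarrow> (M has_real_derivative f (sqrt (r\<^sup>2 + h\<^sup>2))) (at r)"
    and "\<And>r. r > 0 \<Longrightarrow> g r = M r / r"
  shows "approximates (\<lambda>n. next_kernel 1 h (K n)) (\<lambda>t. g (sqrt t))"
proof (rule approximates_step[OF assms(1,2,3)])
  fix r :: real assume r: "r > 0"
  show "(M has_real_derivative r ^ (1 - 1) * f (sqrt (r\<^sup>2 + h\<^sup>2))) (at r)"
    using assms(4)[OF r] by simp
  show "g r = M r / r ^ 1" using assms(5)[OF r] by simp
qed simp

lemma approximates_h2':
  assumes "\<And>n. continuous_on {0..} (K n)" and "approximates K (\<lambda>t. f (sqrt t))"
    and "h \<ge> 0" and "(N \<longlongrightarrow> c) (at_right h)"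
    and "\<And>r. r > 0 \<Longrightarrow> (N has_real_derivative r * f r) (at r)"
  shows "approximates (\<lambda>n. next_kernel 2 h (K n)) (\<lambda>t. lim1 N c h (sqrt t))"
  unfolding lim1_def by (rule approximates_h2[OF assms])

lemma DERIV_tendsto_at_right: "(f has_real_derivative D) (at x) \<Longrightarrow> (f \<longlongrightarrow> f x) (at_right x)"
  using DERIV_isCont[of f D x] unfolding isCont_def
  by (rule tendsto_mono[rotated]) (simp_all add: at_le)

lemma logsum_tendsto_0: "h > 0 \<Longrightarrow> (logsum h \<longlongrightarrow> 0) (at_right 0)"
  using DERIV_tendsto_at_right[OF has_real_derivative_logsum[OF _ DERIV_ident], of h 0] by simp

lemma logsum_sqrt_tendsto:
  "b > 0 \<Longrightarrow> a > 0 \<Longrightarrow> ((\<lambda>r. logsum b (sqrt (r\<^sup>2 + a\<^sup>2))) \<longlongrightarrow> logsum b a) (at_right 0)"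
  using DERIV_tendsto_at_right[OF DERIV_logsum_sqrt[of b a 0]] by simp

lemma angle_tendsto_0:
  "a > 0 \<Longrightarrow> b > 0 \<Longrightarrow>
   ((\<lambda>r. arctan (a * r / (a\<^sup>2 + b\<^sup>2 + sqrt (r\<^sup>2 + (a\<^sup>2 + b\<^sup>2)) * b))) \<longlongrightarrow> 0) (at_right 0)"
  using DERIV_tendsto_at_right[OF has_real_derivative_angle[of a b 0]] by simp

definition angle :: "real \<Rightarrow> real \<Rightarrow> real \<Rightarrow> real" where
  "angle a b r = arctan (a * r / (a\<^sup>2 + b\<^sup>2 + sqrt (r\<^sup>2 + (a\<^sup>2 + b\<^sup>2)) * b))"

lemma sqrt_sq_sum: "(sqrt (a\<^sup>2 + b\<^sup>2))\<^sup>2 = a\<^sup>2 + b\<^sup>2"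
  by simp

lemma Phi1_eq: "Phi1 (sqrt (a\<^sup>2 + b\<^sup>2)) r = logsum (sqrt (a\<^sup>2 + b\<^sup>2)) r / r"
  by (simp add: Phi1_def logsum_def)

lemma Phi2_eq: "b > 0 \<Longrightarrow> Phi2 (sqrt (a\<^sup>2 + b\<^sup>2)) r a = angle a b r / r"
  by (simp add: Phi2_def angle_def)

lemma Phi3_eq:
  "b > 0 \<Longrightarrow> Phi3 (sqrt (a\<^sup>2 + b\<^sup>2)) a r = logsum b (sqrt (r\<^sup>2 + a\<^sup>2)) / sqrt (r\<^sup>2 + a\<^sup>2)"
  by (simp add: Phi3_def Let_def logsum_def add.assoc)

lemma Phi4_eq:
  "a > 0 \<Longrightarrow> r > 0 \<Longrightarrow> Phi4 (sqrt (a\<^sup>2 + b\<^sup>2)) a r b = b\<^sup>2 / a * logdiff a b r / r"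
proof -
  have "b\<^sup>2 / (r\<^sup>2 * a) * (s / a * L - L0) = b\<^sup>2 / a * ((s / a * L - L0) / r) / r" for s L L0 :: real
    by (simp add: power2_eq_square)
  then show ?thesis
    unfolding Phi4_def Let_def logdiff_def logsum_def sqrt_sq_sum by (simp only: real_sqrt_pow2 sqrt_sq_sum add_nonneg_nonneg zero_le_power2 add.assoc)
qed

section \<open>Identification of the limits with the seven terminal functions\<close>

lemma approximates_case1:
  assumes "\<And>n. continuous_on {0..} (K n)" and a: "a > 0"
    and "approximates K (\<lambda>t. lim1 (\<lambda>r. r / 6) 0 0 (sqrt t))"
  shows "approximates (\<lambda>n. next_kernel 1 a (K n)) (\<lambda>t. F1_pos (sqrt t) a 0 0 0)"
proof (rule approximates_h1[OF assms(1,3)])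
  show "((\<lambda>r. logsum a r / 6) \<longlongrightarrow> 0) (at_right 0)"
    using tendsto_divide[OF logsum_tendsto_0[OF a] tendsto_const[of 6]] by simp
  fix r :: real assume r: "r > 0"
  have "lim1 (\<lambda>r. r / 6) 0 0 s = 1 / 6 / s" if "s > 0" for s
    using that by (simp add: lim1_def power2_eq_square)
  moreover have "sqrt (r\<^sup>2 + a\<^sup>2) > 0" using r by (simp add: add_pos_nonneg)
  ultimately have "lim1 (\<lambda>r. r / 6) 0 0 (sqrt (r\<^sup>2 + a\<^sup>2)) = 1 / 6 / sqrt (r\<^sup>2 + a\<^sup>2)"
    by blast
  then show "((\<lambda>r. logsum a r / 6) has_real_derivative lim1 (\<lambda>r. r / 6) 0 0 (sqrt (r\<^sup>2 + a\<^sup>2))) (at r)"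
    using DERIV_case1[OF a, of r] by simp
  show "F1_pos r a 0 0 0 = logsum a r / 6 / r"
    using a by (simp add: F1_pos_def Phi1_def logsum_def)
qed

lemma approximates_case2:
  assumes "\<And>n. continuous_on {0..} (K n)" and a: "a > 0"
    and "approximates K (\<lambda>t. lim1 (\<lambda>r. r / 6) (a / 6) a (sqrt t))"
  shows "approximates (\<lambda>n. next_kernel 1 0 (K n)) (\<lambda>t. F1_pos (sqrt t) 0 a 0 0)"
proof (rule approximates_h1[OF assms(1,3)])
  have "((\<lambda>r. (logsum a r - r / (sqrt (r\<^sup>2 + a\<^sup>2) + a)) / 6) \<longlongrightarrow>
      (0 - 0 / (sqrt (0\<^sup>2 + a\<^sup>2) + a)) / 6) (at_right 0)"
    by (intro tendsto_intros logsum_tendsto_0) (use a in auto)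
  then show "((\<lambda>r. (logsum a r - r / (sqrt (r\<^sup>2 + a\<^sup>2) + a)) / 6) \<longlongrightarrow> 0) (at_right 0)" by simp
  fix r :: real assume r: "r > 0"
  show "((\<lambda>r. (logsum a r - r / (sqrt (r\<^sup>2 + a\<^sup>2) + a)) / 6) has_real_derivative
      lim1 (\<lambda>r. r / 6) (a / 6) a (sqrt (r\<^sup>2 + 0\<^sup>2))) (at r)"
    using DERIV_case2[OF a r] r by simp
  show "F1_pos r 0 a 0 0 = (logsum a r - r / (sqrt (r\<^sup>2 + a\<^sup>2) + a)) / 6 / r"
    using a r by (simp add: F1_pos_def Phi1_def logsum_def diff_divide_distrib)
qed

lemma approximates_case3:
  assumes "\<And>n. continuous_on {0..} (K n)" and a: "a > 0" and b: "b > 0"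
    and "approximates K (\<lambda>t. lim1 (\<lambda>r. r / 6) (b / 6) b (sqrt t))"
  shows "approximates (\<lambda>n. next_kernel 1 a (K n)) (\<lambda>t. F1_pos (sqrt t) a b 0 0)"
proof (rule approximates_h1[OF assms(1,4) _ DERIV_case3[OF a b, folded angle_def]])
  have h: "a\<^sup>2 + b\<^sup>2 > 0" using a by (simp add: add_pos_nonneg)
  have "((\<lambda>r. (logsum (sqrt (a\<^sup>2 + b\<^sup>2)) r
      - b / a * angle a b r) / 6) \<longlongrightarrow>
      (0 - b / a * 0) / 6) (at_right 0)"
    by (intro tendsto_intros logsum_tendsto_0 angle_tendsto_0[folded angle_def]) (use a b h in auto)
  then show "((\<lambda>r. (logsum (sqrt (a\<^sup>2 + b\<^sup>2)) r
      - b / a * angle a b r) / 6) \<longlongrightarrow> 0) (at_right 0)"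
    by simp
  fix r :: real assume r: "r > 0"
  show "F1_pos r a b 0 0 = (logsum (sqrt (a\<^sup>2 + b\<^sup>2)) r
      - b / a * angle a b r) / 6 / r"
  proof -
    have "F1_pos r a b 0 0 = 1 / 6 * (Phi1 (sqrt (a\<^sup>2 + b\<^sup>2)) r - b / a * Phi2 (sqrt (a\<^sup>2 + b\<^sup>2)) r a)"
      using a b by (simp add: F1_pos_def Let_def)
    then show ?thesis
      unfolding Phi1_eq Phi2_eq[OF b] by (simp add: diff_divide_distrib)
  qed
qed

lemma approximates_case4:
  assumes "\<And>n. continuous_on {0..} (K n)" and a: "a > 0" and b: "b > 0"
    and "approximates K (\<lambda>t. lim1 (prim2a b) (b / 3) 0 (sqrt t))"
  shows "approximates (\<lambda>n. next_kernel 1 a (K n)) (\<lambda>t. F1_pos (sqrt t) a 0 b 0)"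
proof (rule approximates_h1[OF assms(1,4) _ DERIV_case4[OF a b, folded angle_def]])
  let ?M = "\<lambda>r. ((1 - b\<^sup>2 / a\<^sup>2) * logsum (sqrt (a\<^sup>2 + b\<^sup>2)) r
      - 2 * b / a * angle a b r
      + b\<^sup>2 / a\<^sup>2 * (r / sqrt (r\<^sup>2 + a\<^sup>2) * logsum b (sqrt (r\<^sup>2 + a\<^sup>2)))) / 6"
  have h: "a\<^sup>2 + b\<^sup>2 > 0" using a by (simp add: add_pos_nonneg)
  have "(?M \<longlongrightarrow> ((1 - b\<^sup>2 / a\<^sup>2) * 0 - 2 * b / a * 0
      + b\<^sup>2 / a\<^sup>2 * (0 / sqrt (0\<^sup>2 + a\<^sup>2) * logsum b a)) / 6) (at_right 0)"
    by (intro tendsto_intros logsum_tendsto_0 angle_tendsto_0[folded angle_def] logsum_sqrt_tendsto) (use a b h in auto)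
  then show "(?M \<longlongrightarrow> 0) (at_right 0)"
    by simp
  fix r :: real assume r: "r > 0"
  let ?h = "sqrt (a\<^sup>2 + b\<^sup>2)"
  have "F1_pos r a 0 b 0 = 1 / 6 * ((1 - b\<^sup>2/a\<^sup>2) * Phi1 ?h r - 2 * b / a * Phi2 ?h r a + b\<^sup>2 / a\<^sup>2 * Phi3 ?h a r)"
    using a b by (simp add: F1_pos_def Let_def add.assoc)
  also have "\<dots> = ?M r / r"
  proof -
    have "1 / 6 * (c1 * (l / r) - c2 * (t / r) + c3 * (L / s)) = (c1 * l - c2 * t + c3 * (r / s * L)) / 6 / r"
      for c1 c2 c3 l t L s :: real
      using r by (simp add: field_simps)
    then show ?thesis unfolding Phi1_eq Phi2_eq[OF b] Phi3_eq[OF b] .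
  qed
  finally show "F1_pos r a 0 b 0 = ?M r / r" .
qed

lemma approximates_case6:
  assumes "\<And>n. continuous_on {0..} (K n)" and a: "a > 0" and b: "b > 0"
    and "approximates K (\<lambda>t. lim1 (prim2b b) (b / 2) 0 (sqrt t))"
  shows "approximates (\<lambda>n. next_kernel 1 a (K n)) (\<lambda>t. F1_pos (sqrt t) a 0 0 b)"
proof (rule approximates_h1[OF assms(1,4) _ DERIV_case6[OF a b, folded angle_def]])
  let ?M = "\<lambda>r. ((1 - 3 * b\<^sup>2 / a\<^sup>2) * logsum (sqrt (a\<^sup>2 + b\<^sup>2)) r
      - (3 - b\<^sup>2 / a\<^sup>2) * (b / a) * angle a b r
      + 3 * (b\<^sup>2 / a\<^sup>2) * (r / sqrt (r\<^sup>2 + a\<^sup>2) * logsum b (sqrt (r\<^sup>2 + a\<^sup>2)))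
      - b\<^sup>2 / a\<^sup>2 * (r / (sqrt (r\<^sup>2 + (a\<^sup>2 + b\<^sup>2)) + b))) / 6"
  have h: "a\<^sup>2 + b\<^sup>2 > 0" using a by (simp add: add_pos_nonneg)
  have nz: "sqrt (0\<^sup>2 + (a\<^sup>2 + b\<^sup>2)) + b \<noteq> 0" using b h by (simp add: add_nonneg_pos less_imp_neq[THEN not_sym])
  have "(?M \<longlongrightarrow> ((1 - 3 * b\<^sup>2 / a\<^sup>2) * 0 - (3 - b\<^sup>2 / a\<^sup>2) * (b / a) * 0
      + 3 * (b\<^sup>2 / a\<^sup>2) * (0 / sqrt (0\<^sup>2 + a\<^sup>2) * logsum b a)
      - b\<^sup>2 / a\<^sup>2 * (0 / (sqrt (0\<^sup>2 + (a\<^sup>2 + b\<^sup>2)) + b))) / 6) (at_right 0)"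
    by (intro tendsto_intros logsum_tendsto_0 angle_tendsto_0[folded angle_def] logsum_sqrt_tendsto nz) (use a b h in auto)
  then show "(?M \<longlongrightarrow> 0) (at_right 0)"
    by simp
  fix r :: real assume r: "r > 0"
  let ?h = "sqrt (a\<^sup>2 + b\<^sup>2)"
  have "F1_pos r a 0 0 b = 1 / 6 * ((1 - 3 * b\<^sup>2 / a\<^sup>2) * Phi1 ?h r - (3 - b\<^sup>2 / a\<^sup>2) * (b / a) * Phi2 ?h r a + 3 * (b\<^sup>2 / a\<^sup>2) * Phi3 ?h a r - b\<^sup>2 / (a\<^sup>2 * (sqrt (r\<^sup>2 + (a\<^sup>2 + b\<^sup>2)) + b)))"
    using a b by (simp add: F1_pos_def Let_def add.assoc)
  also have "\<dots> = ?M r / r"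
  proof -
    have "1 / 6 * (c1 * (l / r) - c2 * (t / r) + c3 * (L / s) - u / (v * w)) =
        (c1 * l - c2 * t + c3 * (r / s * L) - u / v * (r / w)) / 6 / r"
      for c1 c2 c3 l t L s u v w :: real
      using r by (simp add: field_simps)
    then show ?thesis unfolding Phi1_eq Phi2_eq[OF b] Phi3_eq[OF b] .
  qed
  finally show "F1_pos r a 0 0 b = ?M r / r" .
qed

lemma approximates_case5:
  assumes "\<And>n. continuous_on {0..} (K n)" and a: "a > 0" and b: "b > 0"
    and "approximates K (\<lambda>t. lim1 (prim2a b) (prim2a b a) a (sqrt t))"
  shows "approximates (\<lambda>n. next_kernel 1 0 (K n)) (\<lambda>t. F1_pos (sqrt t) 0 a b 0)"
proof (rule approximates_h1[OF assms(1,4)])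
  let ?M = "\<lambda>r. ((a\<^sup>2 + b\<^sup>2) / a\<^sup>2 * logsum (sqrt (a\<^sup>2 + b\<^sup>2)) r
      - r / (sqrt (r\<^sup>2 + (a\<^sup>2 + b\<^sup>2)) + sqrt (a\<^sup>2 + b\<^sup>2)) - b\<^sup>2 / a * logdiff a b r) / 6"
  have h: "a\<^sup>2 + b\<^sup>2 > 0" using a by (simp add: add_pos_nonneg)
  have "(?M \<longlongrightarrow> ((a\<^sup>2 + b\<^sup>2) / a\<^sup>2 * 0
      - 0 / (sqrt (0\<^sup>2 + (a\<^sup>2 + b\<^sup>2)) + sqrt (a\<^sup>2 + b\<^sup>2)) - b\<^sup>2 / a * 0) / 6) (at_right 0)"
    by (intro tendsto_intros logsum_tendsto_0 logdiff_tendsto) (use a b h in auto)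
  then show "(?M \<longlongrightarrow> 0) (at_right 0)"
    by simp
  fix r :: real assume r: "r > 0"
  show "(?M has_real_derivative lim1 (prim2a b) (prim2a b a) a (sqrt (r\<^sup>2 + 0\<^sup>2))) (at r)"
    using DERIV_case5[OF a b r] r by simp
  let ?h = "sqrt (a\<^sup>2 + b\<^sup>2)"
  have "F1_pos r 0 a b 0 = 1 / 6 * (?h\<^sup>2 / a\<^sup>2 * Phi1 ?h r - 1 / (sqrt (r\<^sup>2 + (a\<^sup>2 + b\<^sup>2)) + ?h) - Phi4 ?h a r b)"
    using a b by (simp add: F1_pos_def Let_def add.assoc)
  also have "\<dots> = ?M r / r"
  proof -
    have "1 / 6 * (c1 * (l / r) - 1 / w - c2 * t / r) = (c1 * l - r / w - c2 * t) / 6 / r"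
      for c1 c2 l t w :: real
      using r by (simp add: field_simps)
    then show ?thesis unfolding Phi1_eq Phi4_eq[OF a r] sqrt_sq_sum .
  qed
  finally show "F1_pos r 0 a b 0 = ?M r / r" .
qed

lemma approximates_case7:
  assumes "\<And>n. continuous_on {0..} (K n)" and a: "a > 0" and b: "b > 0"
    and "approximates K (\<lambda>t. lim1 (prim2b b) (prim2b b a) a (sqrt t))"
  shows "approximates (\<lambda>n. next_kernel 1 0 (K n)) (\<lambda>t. F1_pos (sqrt t) 0 a 0 b)"
proof (rule approximates_h1[OF assms(1,4)])
  let ?M = "\<lambda>r. ((1 + 3 * b\<^sup>2 / a\<^sup>2) * logsum (sqrt (a\<^sup>2 + b\<^sup>2)) r
      - 2 * b ^ 3 / a ^ 3 * angle a b r
      - 3 * (b\<^sup>2 / a) * logdiff a b r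
      + (2 * b\<^sup>2 - a\<^sup>2) / a\<^sup>2 * (r / (sqrt (r\<^sup>2 + (a\<^sup>2 + b\<^sup>2)) + sqrt (a\<^sup>2 + b\<^sup>2)))) / 6"
  have h: "a\<^sup>2 + b\<^sup>2 > 0" using a by (simp add: add_pos_nonneg)
  have "(?M \<longlongrightarrow> ((1 + 3 * b\<^sup>2 / a\<^sup>2) * 0 - 2 * b ^ 3 / a ^ 3 * 0 - 3 * (b\<^sup>2 / a) * 0
      + (2 * b\<^sup>2 - a\<^sup>2) / a\<^sup>2 * (0 / (sqrt (0\<^sup>2 + (a\<^sup>2 + b\<^sup>2)) + sqrt (a\<^sup>2 + b\<^sup>2)))) / 6) (at_right 0)"
    by (intro tendsto_intros logsum_tendsto_0 logdiff_tendsto angle_tendsto_0[folded angle_def]) (use a b h in auto)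
  then show "(?M \<longlongrightarrow> 0) (at_right 0)"
    by simp
  fix r :: real assume r: "r > 0"
  show "(?M has_real_derivative lim1 (prim2b b) (prim2b b a) a (sqrt (r\<^sup>2 + 0\<^sup>2))) (at r)"
    using DERIV_case7[OF a b r, folded angle_def] r by simp
  let ?h = "sqrt (a\<^sup>2 + b\<^sup>2)"
  have "F1_pos r 0 a 0 b = 1 / 6 * ((1 + 3 * b\<^sup>2 / a\<^sup>2) * Phi1 ?h r - 2 * b ^ 3 / a ^ 3 * Phi2 ?h r a - 3 * Phi4 ?h a r b + (2 * b\<^sup>2 - a\<^sup>2) / (a\<^sup>2 * (sqrt (r\<^sup>2 + (a\<^sup>2 + b\<^sup>2)) + ?h)))"
    using a b by (simp add: F1_pos_def Let_def add.assoc)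
  also have "\<dots> = ?M r / r"
  proof -
    have "1 / 6 * (c1 * (l / r) - c2 * (t / r) - 3 * (c3 * L / r) + u / (v * w)) =
        (c1 * l - c2 * t - 3 * c3 * L + u / v * (r / w)) / 6 / r"
      for c1 c2 c3 l t L u v w :: real
      using r by (simp add: field_simps)
    then show ?thesis unfolding Phi1_eq Phi2_eq[OF b] Phi4_eq[OF a r] .
  qed
  finally show "F1_pos r 0 a 0 b = ?M r / r" .
qed

text \<open>At most one of h_3 and h_4 is nonzero, so only three chains of limits lead through the
  levels 4 and 3. Then h_2 enters through the base point of the level 2 antiderivative, and h_1
  through the last integration.\<close>

lemma kern_tendsto_F1:
  assumes nonneg: "h 1 \<ge> 0" "h 2 \<ge> 0" "h 3 \<ge> 0" "h 4 \<ge> 0" and P: "P > 0"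
    and seven: "((h 4 = 0 \<and> h 3 = 0 \<and> h 2 = 0 \<and> h 1 \<noteq> 0) \<or>
             (h 4 = 0 \<and> h 3 = 0 \<and> h 1 = 0 \<and> h 2 \<noteq> 0) \<or>
             (h 4 = 0 \<and> h 3 = 0 \<and> h 2 \<noteq> 0 \<and> h 1 \<noteq> 0) \<or>
             (h 4 = 0 \<and> h 2 = 0 \<and> h 3 \<noteq> 0 \<and> h 1 \<noteq> 0) \<or>
             (h 4 = 0 \<and> h 1 = 0 \<and> h 3 \<noteq> 0 \<and> h 2 \<noteq> 0) \<or>
             (h 3 = 0 \<and> h 2 = 0 \<and> h 4 \<noteq> 0 \<and> h 1 \<noteq> 0) \<or>
             (h 3 = 0 \<and> h 1 = 0 \<and> h 4 \<noteq> 0 \<and> h 2 \<noteq> 0))"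
  shows "(\<lambda>n. kern n h 4 (P\<^sup>2)) \<longlonglongrightarrow> F1 P (h 1) (h 2) (h 3) (h 4)"
proof -
  note nk = kern.simps(2)[of _ h]
  have k1: "kern n h 1 = next_kernel 4 (h 4) (base_kernel n)" for n using nk[of n 0] by simp
  have k2: "kern n h 2 = next_kernel 3 (h 3) (kern n h 1)" for n using nk[of n 1] by (simp add: numeral_2_eq_2)
  have k3: "kern n h 3 = next_kernel 2 (h 2) (kern n h 2)" for n using nk[of n 2] by (simp add: numeral_3_eq_3 numeral_2_eq_2)
  have k4: "kern n h 4 = next_kernel 1 (h 1) (kern n h 3)" for n using nk[of n 3] by (simp add: eval_nat_numeral)
  have c0: "continuous_on {0..} (base_kernel n)" for n using continuous_kern[of 0 n h] by simp
  have cont: "continuous_on {0..} (kern n h 1)" "continuous_on {0..} (kern n h 2)"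
    "continuous_on {0..} (kern n h 3)" for n
    by (rule continuous_kern, simp)+
  have A1: "approximates (\<lambda>n. kern n h 1) (\<lambda>t. 1 / 3 / sqrt t)" if "h 4 = 0"
    using approximates_next_zero[OF c0 approximates_base_kernel, of 4] that by (simp add: k1)
  have A1': "approximates (\<lambda>n. kern n h 1) (\<lambda>t. lim3 (h 4) (sqrt t))" if "h 4 > 0"
    using approximates_h4[OF c0 approximates_base_kernel that] by (simp add: k1)
  have A2: "approximates (\<lambda>n. kern n h 2) (\<lambda>t. 1 / 6 / sqrt t)" if "h 4 = 0" "h 3 = 0"
    using approximates_next_zero[OF cont(1) A1[OF that(1)], of 3] that by (simp add: k2)
  have A2a: "approximates (\<lambda>n. kern n h 2) (\<lambda>t. lim2a (h 3) (sqrt t))" if "h 4 = 0" "h 3 > 0"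
    using approximates_h3[OF cont(1) A1[OF that(1)] that(2)] by (simp add: k2)
  have A2b: "approximates (\<lambda>n. kern n h 2) (\<lambda>t. lim2b (h 4) (sqrt t))" if "h 4 > 0" "h 3 = 0"
    using approximates_h4_h3_zero[OF cont(1) A1'[OF that(1)] that(1)] that by (simp add: k2)
  have A3: "approximates (\<lambda>n. kern n h 3) (\<lambda>t. lim1 (\<lambda>r. r / 6) (h 2 / 6) (h 2) (sqrt t))"
    if "h 4 = 0" "h 3 = 0"
    unfolding k3
  proof (rule approximates_h2'[OF cont(2), where f = "\<lambda>r. 1 / 6 / r"])
    show "((\<lambda>r. r / 6) \<longlongrightarrow> h 2 / 6) (at_right (h 2))" by (intro tendsto_intros) auto
  qed (use A2[OF that] nonneg in \<open>auto intro!: derivative_eq_intros\<close>)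
  have A3a: "approximates (\<lambda>n. kern n h 3)
      (\<lambda>t. lim1 (prim2a (h 3)) (if h 2 = 0 then h 3 / 3 else prim2a (h 3) (h 2)) (h 2) (sqrt t))"
    if "h 4 = 0" "h 3 > 0"
    unfolding k3
    by (rule approximates_h2'[OF cont(2) A2a[OF that] nonneg(2) prim2a_tendsto[OF _ nonneg(2)]])
      (use that in \<open>auto intro!: has_real_derivative_prim2a\<close>)
  have A3b: "approximates (\<lambda>n. kern n h 3)
      (\<lambda>t. lim1 (prim2b (h 4)) (if h 2 = 0 then h 4 / 2 else prim2b (h 4) (h 2)) (h 2) (sqrt t))"
    if "h 4 > 0" "h 3 = 0"
    unfolding k3
    by (rule approximates_h2'[OF cont(2) A2b[OF that] nonneg(2) prim2b_tendsto[OF _ nonneg(2)]])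
      (use that in \<open>auto intro!: has_real_derivative_prim2b\<close>)
  let ?F = "\<lambda>r. F1_pos r (h 1) (h 2) (h 3) (h 4)"
  have "approximates (\<lambda>n. kern n h 4) (\<lambda>t. ?F (sqrt t))"
    using seven
  proof (elim disjE conjE)
    assume h: "h 4 = 0" "h 3 = 0" "h 2 = 0" "h 1 \<noteq> 0"
    then have pos: "h 1 > 0" using nonneg by auto
    have "approximates (\<lambda>n. kern n h 3) (\<lambda>t. lim1 (\<lambda>r. r / 6) 0 0 (sqrt t))"
      using A3[OF h(1,2)] h by simp
    from approximates_case1[OF cont(3) pos this] show ?thesis unfolding k4 h .
  next
    assume h: "h 4 = 0" "h 3 = 0" "h 1 = 0" "h 2 \<noteq> 0"
    then have pos: "h 2 > 0" using nonneg by auto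
    have "approximates (\<lambda>n. kern n h 3) (\<lambda>t. lim1 (\<lambda>r. r / 6) (h 2 / 6) (h 2) (sqrt t))"
      using A3[OF h(1,2)] h by simp
    from approximates_case2[OF cont(3) pos this] show ?thesis unfolding k4 h .
  next
    assume h: "h 4 = 0" "h 3 = 0" "h 2 \<noteq> 0" "h 1 \<noteq> 0"
    then have pos: "h 1 > 0" "h 2 > 0" using nonneg by auto
    have "approximates (\<lambda>n. kern n h 3) (\<lambda>t. lim1 (\<lambda>r. r / 6) (h 2 / 6) (h 2) (sqrt t))"
      using A3[OF h(1,2)] h by simp
    from approximates_case3[OF cont(3) pos this] show ?thesis unfolding k4 h .
  next
    assume h: "h 4 = 0" "h 2 = 0" "h 3 \<noteq> 0" "h 1 \<noteq> 0"
    then have pos: "h 1 > 0" "h 3 > 0" using nonneg by auto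
    have "approximates (\<lambda>n. kern n h 3) (\<lambda>t. lim1 (prim2a (h 3)) (h 3 / 3) 0 (sqrt t))"
      using A3a[OF h(1) pos(2)] h by simp
    from approximates_case4[OF cont(3) pos this] show ?thesis unfolding k4 h .
  next
    assume h: "h 4 = 0" "h 1 = 0" "h 3 \<noteq> 0" "h 2 \<noteq> 0"
    then have pos: "h 2 > 0" "h 3 > 0" using nonneg by auto
    have "approximates (\<lambda>n. kern n h 3) (\<lambda>t. lim1 (prim2a (h 3)) (prim2a (h 3) (h 2)) (h 2) (sqrt t))"
      using A3a[OF h(1) pos(2)] h by simp
    from approximates_case5[OF cont(3) pos this] show ?thesis unfolding k4 h .
  next
    assume h: "h 3 = 0" "h 2 = 0" "h 4 \<noteq> 0" "h 1 \<noteq> 0"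
    then have pos: "h 1 > 0" "h 4 > 0" using nonneg by auto
    have "approximates (\<lambda>n. kern n h 3) (\<lambda>t. lim1 (prim2b (h 4)) (h 4 / 2) 0 (sqrt t))"
      using A3b[OF pos(2) h(1)] h by simp
    from approximates_case6[OF cont(3) pos this] show ?thesis unfolding k4 h .
  next
    assume h: "h 3 = 0" "h 1 = 0" "h 4 \<noteq> 0" "h 2 \<noteq> 0"
    then have pos: "h 2 > 0" "h 4 > 0" using nonneg by auto
    have "approximates (\<lambda>n. kern n h 3) (\<lambda>t. lim1 (prim2b (h 4)) (prim2b (h 4) (h 2)) (h 2) (sqrt t))"
      using A3b[OF pos(2) h(1)] h by simp
    from approximates_case7[OF cont(3) pos this] show ?thesis unfolding k4 h .
  qed
  then have "(\<lambda>n. kern n h 4 (P\<^sup>2)) \<longlonglongrightarrow> ?F (sqrt (P\<^sup>2))"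
    unfolding approximates_def using zero_less_power[OF P, of 2] by blast
  then show ?thesis using P by (simp add: F1_def)
qed

section \<open>Gram--Schmidt projections\<close>

text \<open>For \<open>u = 0\<close> both sides vanish. This is why the substitute 1 in the
  denominator is harmless and dependent families are tolerated.\<close>

lemma sq_or_one_dot: "u \<bullet> x / sq_or_one u * (norm u)\<^sup>2 = u \<bullet> x"
  by (simp add: sq_or_one_def)

lemma gs_u_orthogonal: "1 \<le> k \<Longrightarrow> k < i \<Longrightarrow> gs_u a k \<bullet> gs_u a i = 0"
proof (induction i arbitrary: k rule: less_induct)
  case (less i)
  have "gs_u a k \<bullet> gs_u a i = gs_u a k \<bullet> vec_at a i -
      (\<Sum>l\<in>{1..<i}. gs_u a l \<bullet> vec_at a i / sq_or_one (gs_u a l) * (gs_u a k \<bullet> gs_u a l))"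
    by (subst (2) gs_u.simps) (simp add: inner_diff_right inner_sum_right)
  also have "(\<Sum>l\<in>{1..<i}. gs_u a l \<bullet> vec_at a i / sq_or_one (gs_u a l) * (gs_u a k \<bullet> gs_u a l)) =
      (\<Sum>l\<in>{1..<i}. if l = k then gs_u a k \<bullet> vec_at a i else 0)"
  proof (rule sum.cong)
    fix l assume l: "l \<in> {1..<i}"
    have "gs_u a k \<bullet> gs_u a l = 0" if "l \<noteq> k"
    proof (cases "l < k")
      case True
      then show ?thesis using less.IH[of k l] less.prems l by (auto simp: inner_commute)
    next
      case False
      then show ?thesis using less.IH[of l k] less.prems l that by auto
    qed
    then show "gs_u a l \<bullet> vec_at a i / sq_or_one (gs_u a l) * (gs_u a k \<bullet> gs_u a l) =
        (if l = k then gs_u a k \<bullet> vec_at a i else 0)"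
      using sq_or_one_dot[of "gs_u a k" "vec_at a i"] by (auto simp: power2_norm_eq_inner)
  qed simp
  finally show ?case using less.prems by simp
qed

lemma vec_at_eq_gs: "vec_at a i = gs_u a i + (\<Sum>l\<in>{1..<i}. gs_c a l i *\<^sub>R gs_u a l)"
  by (subst gs_u.simps) (simp add: gs_c_def)

lemma gs_u_dot_vec_at:
  assumes "1 \<le> i" "i < j"
  shows "gs_u a j \<bullet> vec_at a i = 0"
proof -
  have "gs_u a l \<bullet> gs_u a j = 0" if "l \<in> {1..<i}" for l
    using that assms by (intro gs_u_orthogonal) auto
  then show ?thesis
    using gs_u_orthogonal[OF assms, of a]
    by (subst vec_at_eq_gs) (auto simp: inner_add_right inner_sum_right inner_commute intro!: sum.neutral)
qed

lemma gs_u_dot_vec_at_same: "gs_u a j \<bullet> vec_at a j = (norm (gs_u a j))\<^sup>2"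
proof -
  have "gs_u a j \<bullet> gs_u a l = 0" if "l \<in> {1..<j}" for l
    using that gs_u_orthogonal[of l j a] by (auto simp: inner_commute)
  then show ?thesis
    by (subst vec_at_eq_gs)
      (auto simp: inner_add_right inner_sum_right power2_norm_eq_inner intro!: sum.neutral)
qed

lemma gs_A_eq: "gs_A a j i = gs_u a j \<bullet> vec_at a i"
  unfolding gs_A_def gs_c_def by (rule sq_or_one_dot)

text \<open>The matrix \<open>gs_A\<close> is upper triangular, and back substitution solves row j
  for the j-th coefficient. A vanishing diagonal entry means \<open>gs_u a j = 0\<close>; that row
  then reads 0 = 0, so the default coefficient 0 violates nothing.\<close>

lemma gs_u_dot_e_par:
  assumes j: "1 \<le> j" "j \<le> length a"
  shows "gs_u a j \<bullet> e_par a e = gs_u a j \<bullet> e"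
proof -
  have "gs_u a j \<bullet> e_par a e = (\<Sum>i\<in>{1..length a}. s_coeff a e i * gs_A a j i)"
    by (simp add: e_par_def inner_sum_right gs_A_eq)
  also have "\<dots> = (\<Sum>i\<in>insert j {j+1..length a}. s_coeff a e i * gs_A a j i)"
    using j by (intro sum.mono_neutral_right) (auto simp: gs_A_eq gs_u_dot_vec_at)
  also have "\<dots> = s_coeff a e j * gs_A a j j + (\<Sum>i\<in>{j+1..length a}. gs_A a j i * s_coeff a e i)"
    by (subst sum.insert) (auto simp: mult.commute)
  also have "\<dots> = gs_u a j \<bullet> e"
  proof (cases "gs_A a j j = 0")
    case True
    then have "gs_u a j = 0" by (simp add: gs_A_eq gs_u_dot_vec_at_same)
    then show ?thesis by (simp add: gs_A_eq)
  next
    case False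
    then show ?thesis by (subst s_coeff.simps) (simp add: gs_b_def)
  qed
  finally show ?thesis .
qed

theorem e_par_orthogonal:
  assumes i: "1 \<le> i" "i \<le> length a"
  shows "(e - e_par a e) \<bullet> vec_at a i = 0"
proof -
  \<comment> \<open>The i-th vector is a combination of \<open>gs_u a 1\<close> to
    \<open>gs_u a i\<close>, so orthogonality to these is enough.\<close>
  have "(e - e_par a e) \<bullet> gs_u a l = 0" if "1 \<le> l" "l \<le> i" for l
    using gs_u_dot_e_par[of l a e] that i by (subst inner_commute) (simp add: inner_diff_right)
  then show ?thesis
    using i by (subst vec_at_eq_gs) (auto simp: inner_add_right inner_sum_right intro!: sum.neutral)
qed

lemma interval_1_numeral: "{1..2::nat} = {1, 2}" "{1..3::nat} = {1, 2, 3}" "{1..4::nat} = {1, 2, 3, 4}"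
  by auto

lemma e_par_1: "e_par [a1] e = s_coeff [a1] e 1 *\<^sub>R a1"
  by (simp add: e_par_def vec_at_def)

lemma e_par_2: "e_par [a1, a2] e = s_coeff [a1, a2] e 1 *\<^sub>R a1 + s_coeff [a1, a2] e 2 *\<^sub>R a2"
proof -
  have "length [a1, a2] = 2" by simp
  then show ?thesis unfolding e_par_def by (simp only: interval_1_numeral) (simp add: vec_at_def)
qed

lemma e_par_3: "e_par [a1, a2, a3] e = s_coeff [a1, a2, a3] e 1 *\<^sub>R a1 +
  s_coeff [a1, a2, a3] e 2 *\<^sub>R a2 + s_coeff [a1, a2, a3] e 3 *\<^sub>R a3"
proof -
  have "length [a1, a2, a3] = 3" by simp
  then show ?thesis unfolding e_par_def by (simp only: interval_1_numeral) (simp add: vec_at_def)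
qed

lemma e_par_4: "e_par [a1, a2, a3, a4] e = s_coeff [a1, a2, a3, a4] e 1 *\<^sub>R a1 +
  s_coeff [a1, a2, a3, a4] e 2 *\<^sub>R a2 + s_coeff [a1, a2, a3, a4] e 3 *\<^sub>R a3 +
  s_coeff [a1, a2, a3, a4] e 4 *\<^sub>R a4"
proof -
  have "length [a1, a2, a3, a4] = 4" by simp
  then show ?thesis unfolding e_par_def by (simp only: interval_1_numeral) (simp add: vec_at_def)
qed

lemma e_par_orthogonal_span:
  assumes "v \<in> span (set a)"
  shows "(e - e_par a e) \<bullet> v = 0"
  using assms
proof (induction rule: span_induct_alt)
  case (step c x y)
  obtain i where "i < length a" "x = a ! i" using step.hyps by (auto simp: in_set_conv_nth)
  then have "(e - e_par a e) \<bullet> x = 0"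
    using e_par_orthogonal[of "Suc i" a e] by (simp add: vec_at_def)
  then show ?case using step by (simp add: inner_add_right)
qed simp

lemma e_par_in_span: "e_par a e \<in> span (set a)"
  unfolding e_par_def
  by (intro span_sum span_scale span_base) (auto simp: vec_at_def intro!: nth_mem)

lemma h_dist_nonneg: "h_dist a e \<ge> 0"
  by (simp add: h_dist_def)

lemma h_dist_eq_0_iff: "h_dist a e = 0 \<longleftrightarrow> e \<in> span (set a)"
proof
  assume "h_dist a e = 0"
  then have "e = e_par a e" by (simp add: h_dist_def)
  then show "e \<in> span (set a)" by (metis e_par_in_span)
next
  assume "e \<in> span (set a)"
  then have "e - e_par a e \<in> span (set a)" by (intro span_diff e_par_in_span)
  then have "(e - e_par a e) \<bullet> (e - e_par a e) = 0" by (rule e_par_orthogonal_span)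
  then show "h_dist a e = 0" by (simp add: h_dist_def)
qed

lemma pythagoras_e_par:
  assumes "v \<in> span (set a)"
  shows "(e + v) \<bullet> (e + v) = (e_par a e + v) \<bullet> (e_par a e + v) + (h_dist a e)\<^sup>2"
proof -
  define p z where "p = e - e_par a e" and "z = e_par a e + v"
  have "p \<bullet> z = 0" unfolding p_def z_def
    by (intro e_par_orthogonal_span span_add e_par_in_span assms)
  moreover have "e + v = p + z" by (simp add: p_def z_def)
  ultimately have "(e + v) \<bullet> (e + v) = z \<bullet> z + p \<bullet> p"
    by (simp add: inner_add_left inner_add_right inner_commute[of z p])
  then show ?thesis by (simp add: h_dist_def p_def z_def power2_norm_eq_inner)
qed

section \<open>Integration over simplices\<close>

definition std_tri :: "(real \<times> real) set" where
  "std_tri = {(u, v). 0 \<le> u \<and> 0 \<le> v \<and> u + v \<le> 1}"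

lemma std_tri_eq_convex_hull: "std_tri = convex hull (insert 0 Basis)"
  unfolding std_simplex std_tri_def by (auto simp: Basis_prod_def)

lemma compact_std_tri: "compact std_tri"
  unfolding std_tri_eq_convex_hull by (intro finite_imp_compact_convex_hull) simp

lemma emeasure_std_tri: "emeasure lborel std_tri = ennreal (1 / 2)"
  unfolding std_tri_eq_convex_hull by (simp add: emeasure_std_simplex)

abbreviation lint :: "'a::euclidean_space set \<Rightarrow> ('a \<Rightarrow> real) \<Rightarrow> real" where
  "lint A f \<equiv> set_lebesgue_integral lborel A f"

lemma set_integrable_compact:
  fixes f :: "'a::euclidean_space \<Rightarrow> real"
  shows "compact A \<Longrightarrow> continuous_on A f \<Longrightarrow> set_integrable lborel A f"
  unfolding set_integrable_def by (rule borel_integrable_compact)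

lemma lint_add:
  fixes f g :: "'a::euclidean_space \<Rightarrow> real"
  assumes "compact A" "continuous_on A f" "continuous_on A g"
  shows "lint A (\<lambda>x. f x + g x) = lint A f + lint A g"
  using assms by (intro set_integral_add set_integrable_compact)

lemma lint_cong: "(\<And>x. x \<in> A \<Longrightarrow> f x = g x) \<Longrightarrow> lint A f = lint A g"
  unfolding set_lebesgue_integral_def by (intro Bochner_Integration.integral_cong) (auto simp: indicator_def)

lemma lint_Times:
  fixes f :: "'a::euclidean_space \<times> 'b::euclidean_space \<Rightarrow> real"
  assumes "compact A" "compact B" "continuous_on (A \<times> B) f"
  shows "lint (A \<times> B) f = lint A (\<lambda>x. lint B (\<lambda>y. f (x, y)))" (is ?fst)
    and "lint (A \<times> B) f = lint B (\<lambda>y. lint A (\<lambda>x. f (x, y)))" (is ?snd)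
proof -
  let ?f = "\<lambda>p. indicator (A \<times> B) p *\<^sub>R f p"
  have "integrable lborel ?f"
    using assms by (intro borel_integrable_compact compact_Times)
  then have int: "integrable (lborel \<Otimes>\<^sub>M lborel) ?f" by (simp add: lborel_prod)
  have "(\<integral>x. (\<integral>y. ?f (x, y) \<partial>lborel) \<partial>lborel) = integral\<^sup>L lborel ?f"
    using lborel_pair.integral_fst'[OF int] by (simp add: lborel_prod)
  moreover have "(\<integral>y. ?f (x, y) \<partial>lborel) = indicator A x *\<^sub>R lint B (\<lambda>y. f (x, y))" for x
    by (auto simp: set_lebesgue_integral_def indicator_def of_bool_def)
  ultimately show ?fst by (simp add: set_lebesgue_integral_def)
  have "(\<integral>y. (\<integral>x. ?f (x, y) \<partial>lborel) \<partial>lborel) = integral\<^sup>L lborel ?f"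
  proof -
    have "(\<integral>y. (\<integral>x. g (x, y) \<partial>lborel) \<partial>lborel) = integral\<^sup>L lborel g"
      if "integrable (lborel \<Otimes>\<^sub>M lborel) g" for g :: "'a \<times> 'b \<Rightarrow> real"
      using lborel_pair.integral_snd[of "\<lambda>x y. g (x, y)"] that by (simp add: lborel_prod)
    from this[OF int] show ?thesis .
  qed
  moreover have "(\<integral>x. ?f (x, y) \<partial>lborel) = indicator B y *\<^sub>R lint A (\<lambda>x. f (x, y))" for y
    by (auto simp: set_lebesgue_integral_def indicator_def of_bool_def)
  ultimately show ?snd by (simp add: set_lebesgue_integral_def)
qed

lemma lint_std_tri:
  fixes f :: "real \<times> real \<Rightarrow> real"
  assumes "continuous_on std_tri f"
  shows "lint std_tri f = lint {0..1} (\<lambda>x. lint {0..1 - x} (\<lambda>y. f (x, y)))" (is ?fst)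
    and "lint std_tri f = lint {0..1} (\<lambda>y. lint {0..1 - y} (\<lambda>x. f (x, y)))" (is ?snd)
proof -
  let ?f = "\<lambda>p. indicator std_tri p *\<^sub>R f p"
  have "integrable lborel ?f"
    using assms by (intro borel_integrable_compact compact_std_tri)
  then have int: "integrable (lborel \<Otimes>\<^sub>M lborel) ?f" by (simp add: lborel_prod)
  have "(\<integral>x. (\<integral>y. ?f (x, y) \<partial>lborel) \<partial>lborel) = integral\<^sup>L lborel ?f"
    using lborel_pair.integral_fst'[OF int] by (simp add: lborel_prod)
  moreover have "indicator std_tri (x, y) = (indicator {0..1} x * indicator {0..1 - x} y :: real)" for x y
    by (auto simp: std_tri_def indicator_def)
  then have "(\<integral>y. ?f (x, y) \<partial>lborel) = indicator {0..1} x *\<^sub>R lint {0..1 - x} (\<lambda>y. f (x, y))" for x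
    by (simp add: set_lebesgue_integral_def mult.assoc)
  ultimately show ?fst by (simp add: set_lebesgue_integral_def)
  have "(\<integral>y. (\<integral>x. ?f (x, y) \<partial>lborel) \<partial>lborel) = integral\<^sup>L lborel ?f"
  proof -
    have "(\<integral>y. (\<integral>x. g (x, y) \<partial>lborel) \<partial>lborel) = integral\<^sup>L lborel g"
      if "integrable (lborel \<Otimes>\<^sub>M lborel) g" for g :: "real \<times> real \<Rightarrow> real"
      using lborel_pair.integral_snd[of "\<lambda>x y. g (x, y)"] that by (simp add: lborel_prod)
    from this[OF int] show ?thesis .
  qed
  moreover have "indicator std_tri (x, y) = (indicator {0..1} y * indicator {0..1 - y} x :: real)" for x y
    by (auto simp: std_tri_def indicator_def)
  then have "(\<integral>x. ?f (x, y) \<partial>lborel) = indicator {0..1} y *\<^sub>R lint {0..1 - y} (\<lambda>x. f (x, y))" for y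
    by (simp add: set_lebesgue_integral_def mult.assoc)
  ultimately show ?snd by (simp add: set_lebesgue_integral_def)
qed

lemma lint_deriv:
  assumes "a \<le> b" and "\<And>x. (U has_real_derivative f x) (at x)" and "continuous_on UNIV f"
  shows "lint {a..b} f = U b - U a"
  unfolding set_lebesgue_integral_def
  using assms
  by (intro integral_FTC_atLeastAtMost)
    (auto simp flip: has_real_derivative_iff_has_vector_derivative
      intro: has_field_derivative_at_within continuous_on_subset)

lemma lint_reflect: "lint {0..1} (\<lambda>t. f (1 - t)) = lint {0..1::real} f"
proof -
  have "lint {0..1} f = (\<integral>t. indicator {0..1} (1 - t) *\<^sub>R f (1 - t) \<partial>lborel)"
    unfolding set_lebesgue_integral_def
    using lborel_integral_real_affine[of "-1" "\<lambda>t. indicator {0..1} t *\<^sub>R f t" 1] by simp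
  also have "\<dots> = lint {0..1} (\<lambda>t. f (1 - t))"
    unfolding set_lebesgue_integral_def
    by (intro Bochner_Integration.integral_cong) (auto simp: indicator_def)
  finally show ?thesis by simp
qed

text \<open>Each component is integrated first along its own coordinate, by the fundamental theorem
  of calculus. Both then live on the hypotenuse, the first one traversed in the opposite sense,
  which \<open>lint_reflect\<close> corrects.\<close>

lemma lint_std_tri_divergence:
  fixes U V :: "real \<times> real \<Rightarrow> real"
  assumes U: "\<And>x y. ((\<lambda>x. U (x, y)) has_real_derivative U' (x, y)) (at x)"
    and V: "\<And>x y. ((\<lambda>y. V (x, y)) has_real_derivative V' (x, y)) (at y)"
    and cont: "continuous_on UNIV U" "continuous_on UNIV V" "continuous_on UNIV U'" "continuous_on UNIV V'"
  shows "lint std_tri (\<lambda>p. U' p + V' p) =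
    lint {0..1} (\<lambda>t. U (t, 1 - t) + V (t, 1 - t)) - lint {0..1} (\<lambda>t. U (0, t)) - lint {0..1} (\<lambda>t. V (t, 0))"
proof -
  have c: "continuous_on A (\<lambda>t. H (f t, g t))"
    if "continuous_on UNIV H" "continuous_on A f" "continuous_on A g"
    for H :: "real \<times> real \<Rightarrow> real" and f g :: "real \<Rightarrow> real" and A
    using that by (intro continuous_on_compose2[OF that(1)] continuous_on_Pair) auto
  note ci = set_integrable_compact[OF compact_Icc] c cont continuous_intros
  have "lint std_tri U' = lint {0..1} (\<lambda>y. U (1 - y, y) - U (0, y))"
    unfolding lint_std_tri(2)[OF continuous_on_subset[OF cont(3) subset_UNIV]]
    by (rule lint_cong, rule lint_deriv) (auto intro!: U ci)
  also have "\<dots> = lint {0..1} (\<lambda>y. U (1 - y, y)) - lint {0..1} (\<lambda>y. U (0, y))"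
    by (intro set_integral_diff ci)
  also have "lint {0..1} (\<lambda>y. U (1 - y, y)) = lint {0..1} (\<lambda>t. U (t, 1 - t))"
    using lint_reflect[of "\<lambda>t. U (t, 1 - t)"] by simp
  finally have 1: "lint std_tri U' = lint {0..1} (\<lambda>t. U (t, 1 - t)) - lint {0..1} (\<lambda>t. U (0, t))" .
  have "lint std_tri V' = lint {0..1} (\<lambda>x. V (x, 1 - x) - V (x, 0))"
    unfolding lint_std_tri(1)[OF continuous_on_subset[OF cont(4) subset_UNIV]]
    by (rule lint_cong, rule lint_deriv) (auto intro!: V ci)
  also have "\<dots> = lint {0..1} (\<lambda>x. V (x, 1 - x)) - lint {0..1} (\<lambda>x. V (x, 0))"
    by (intro set_integral_diff ci)
  finally have 2: "lint std_tri V' = lint {0..1} (\<lambda>t. V (t, 1 - t)) - lint {0..1} (\<lambda>t. V (t, 0))" .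
  have "lint std_tri (\<lambda>p. U' p + V' p) = lint std_tri U' + lint std_tri V'"
    using cont by (intro lint_add compact_std_tri) (auto intro: continuous_on_subset)
  also have "\<dots> = (lint {0..1} (\<lambda>t. U (t, 1 - t)) + lint {0..1} (\<lambda>t. V (t, 1 - t)))
      - lint {0..1} (\<lambda>t. U (0, t)) - lint {0..1} (\<lambda>t. V (t, 0))"
    unfolding 1 2 by simp
  also have "lint {0..1} (\<lambda>t. U (t, 1 - t)) + lint {0..1} (\<lambda>t. V (t, 1 - t)) =
      lint {0..1} (\<lambda>t. U (t, 1 - t) + V (t, 1 - t))"
    by (intro lint_add[symmetric] ci) auto
  finally show ?thesis .
qed

section \<open>The divergence theorem for radial kernels on segments, triangles and prisms\<close>

lemma c1_kernel_radial:
  fixes a q :: "real^3"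
  assumes "c1_kernel K K'"
  shows "((\<lambda>t. (t + s) * K ((q + t *\<^sub>R a) \<bullet> (q + t *\<^sub>R a))) has_real_derivative
    K ((q + t *\<^sub>R a) \<bullet> (q + t *\<^sub>R a)) +
      2 * K' ((q + t *\<^sub>R a) \<bullet> (q + t *\<^sub>R a)) * ((q + t *\<^sub>R a) \<bullet> ((t + s) *\<^sub>R a))) (at t)"
proof -
  have "((\<lambda>t. (q + t *\<^sub>R a) \<bullet> (q + t *\<^sub>R a)) has_real_derivative 2 * ((q + t *\<^sub>R a) \<bullet> a)) (at t)"
    by (auto intro!: derivative_eq_intros simp: has_field_derivative_def inner_commute algebra_simps
        inner_add_left inner_add_right)
  then have "((\<lambda>t. K ((q + t *\<^sub>R a) \<bullet> (q + t *\<^sub>R a))) has_real_derivative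
      K' ((q + t *\<^sub>R a) \<bullet> (q + t *\<^sub>R a)) * (2 * ((q + t *\<^sub>R a) \<bullet> a))) (at t)"
    by (rule c1_kernel_compose[OF assms]) auto
  then show ?thesis
    by (auto intro!: derivative_eq_intros simp: algebra_simps)
qed

lemma continuous_on_kernel_radial:
  "continuous_on {0..} K \<Longrightarrow> continuous_on A g \<Longrightarrow> continuous_on A (\<lambda>x. K (g x \<bullet> g x) :: real)"
  by (rule continuous_on_compose2[where g = K]) (auto intro: continuous_intros)

lemma lint_segment:
  fixes a q :: "real^3"
  assumes K: "c1_kernel K K'"
  shows "lint {0..1} (\<lambda>t. K ((q + t *\<^sub>R a) \<bullet> (q + t *\<^sub>R a)) +
      2 * K' ((q + t *\<^sub>R a) \<bullet> (q + t *\<^sub>R a)) * ((q + t *\<^sub>R a) \<bullet> ((t + s) *\<^sub>R a))) =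
    (1 + s) * K ((q + a) \<bullet> (q + a)) - s * K (q \<bullet> q)"
proof -
  have "continuous_on {0..} K" "continuous_on {0..} K'"
    using K c1_kernel_continuous by (auto simp: c1_kernel_def)
  then show ?thesis
    by (subst lint_deriv[OF _ c1_kernel_radial[OF K]])
      (auto intro!: continuous_intros continuous_on_kernel_radial)
qed

text \<open>On the hypotenuse the factors t + s1 and 1 - t + s2 add up to the constant 1 + s1 + s2,
  and on the legs the relevant factor is s1 or s2. So the boundary terms carry exactly the
  coefficients of the recursion.\<close>

lemma lint_triangle:
  fixes a b q :: "real^3" and s1 s2 :: real
  assumes K: "c1_kernel K K'"
  defines "w \<equiv> \<lambda>p. q + fst p *\<^sub>R a + snd p *\<^sub>R b"
  shows "lint std_tri (\<lambda>p. 2 * K (w p \<bullet> w p) +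
      2 * K' (w p \<bullet> w p) * (w p \<bullet> ((fst p + s1) *\<^sub>R a + (snd p + s2) *\<^sub>R b))) =
    - s1 * lint {0..1} (\<lambda>t. K ((q + t *\<^sub>R b) \<bullet> (q + t *\<^sub>R b)))
    - s2 * lint {0..1} (\<lambda>t. K ((q + t *\<^sub>R a) \<bullet> (q + t *\<^sub>R a)))
    + (1 + s1 + s2) * lint {0..1} (\<lambda>t. K ((q + b + t *\<^sub>R (a - b)) \<bullet> (q + b + t *\<^sub>R (a - b))))"
proof -
  have contK: "continuous_on {0..} K" "continuous_on {0..} K'"
    using K c1_kernel_continuous by (auto simp: c1_kernel_def)
  let ?F = "\<lambda>p. (fst p + s1) * K (w p \<bullet> w p)" and ?G = "\<lambda>p. (snd p + s2) * K (w p \<bullet> w p)"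
  let ?F' = "\<lambda>p. K (w p \<bullet> w p) + 2 * K' (w p \<bullet> w p) * (w p \<bullet> ((fst p + s1) *\<^sub>R a))"
    and ?G' = "\<lambda>p. K (w p \<bullet> w p) + 2 * K' (w p \<bullet> w p) * (w p \<bullet> ((snd p + s2) *\<^sub>R b))"
  have cw: "continuous_on UNIV w" unfolding w_def by (intro continuous_intros)
  have "lint std_tri (\<lambda>p. 2 * K (w p \<bullet> w p) +
      2 * K' (w p \<bullet> w p) * (w p \<bullet> ((fst p + s1) *\<^sub>R a + (snd p + s2) *\<^sub>R b)))
    = lint std_tri (\<lambda>p. ?F' p + ?G' p)"
    by (simp add: inner_add_right algebra_simps)
  also have "\<dots> = lint {0..1} (\<lambda>t. ?F (t, 1 - t) + ?G (t, 1 - t))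
      - lint {0..1} (\<lambda>t. ?F (0, t)) - lint {0..1} (\<lambda>t. ?G (t, 0))"
  proof (rule lint_std_tri_divergence)
    fix x y :: real
    show "((\<lambda>x. ?F (x, y)) has_real_derivative ?F' (x, y)) (at x)"
      using c1_kernel_radial[OF K, of s1 "q + y *\<^sub>R b" a x] by (simp add: w_def add_ac)
    show "((\<lambda>y. ?G (x, y)) has_real_derivative ?G' (x, y)) (at y)"
      using c1_kernel_radial[OF K, of s2 "q + x *\<^sub>R a" b y] by (simp add: w_def add_ac)
  qed (intro continuous_intros continuous_on_kernel_radial contK cw)+
  also have "(\<lambda>t. ?F (t, 1 - t) + ?G (t, 1 - t)) =
      (\<lambda>t. (1 + s1 + s2) * K ((q + b + t *\<^sub>R (a - b)) \<bullet> (q + b + t *\<^sub>R (a - b))))"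
    by (simp add: w_def algebra_simps)
  also have "(\<lambda>t. ?F (0, t)) = (\<lambda>t. s1 * K ((q + t *\<^sub>R b) \<bullet> (q + t *\<^sub>R b)))"
    by (simp add: w_def)
  also have "(\<lambda>t. ?G (t, 0)) = (\<lambda>t. s2 * K ((q + t *\<^sub>R a) \<bullet> (q + t *\<^sub>R a)))"
    by (simp add: w_def)
  finally show ?thesis unfolding set_integral_mult_right by simp
qed

lemma lint_Times_swap:
  fixes f :: "'a::euclidean_space \<times> 'b::euclidean_space \<Rightarrow> real"
  assumes "compact A" "compact B" "continuous_on UNIV f"
  shows "lint (A \<times> B) f = lint (B \<times> A) (\<lambda>p. f (snd p, fst p))"
proof -
  have f: "continuous_on (A \<times> B) f" using assms(3) by (rule continuous_on_subset) simp
  have "continuous_on UNIV (\<lambda>p. f (snd p, fst p))"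
    by (rule continuous_on_compose2[OF assms(3)]) (auto intro!: continuous_intros)
  then have "continuous_on (B \<times> A) (\<lambda>p. f (snd p, fst p))" by (rule continuous_on_subset) simp
  then show ?thesis
    using lint_Times(2)[OF assms(1,2) f] lint_Times(1)[OF assms(2,1), of "\<lambda>p. f (snd p, fst p)"] by simp
qed

lemma set_integrable_lint:
  fixes f :: "'a::euclidean_space \<Rightarrow> 'b::euclidean_space \<Rightarrow> real"
  assumes "compact A" "compact B" "continuous_on UNIV (\<lambda>p. f (fst p) (snd p))"
  shows "set_integrable lborel A (\<lambda>x. lint B (f x))"
proof -
  let ?f = "\<lambda>p. indicator (A \<times> B) p *\<^sub>R f (fst p) (snd p)"
  have "integrable lborel ?f"
    using assms by (intro borel_integrable_compact compact_Times) (auto intro: continuous_on_subset)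
  then have int: "integrable (lborel \<Otimes>\<^sub>M lborel) ?f" by (simp add: lborel_prod)
  have "integrable lborel (\<lambda>x. \<integral>y. ?f (x, y) \<partial>lborel)"
    using lborel_pair.integrable_fst'[OF int] by simp
  moreover have "(\<integral>y. ?f (x, y) \<partial>lborel) = indicator A x *\<^sub>R lint B (f x)" for x
    by (auto simp: set_lebesgue_integral_def indicator_def of_bool_def)
  ultimately show ?thesis by (simp add: set_integrable_def)
qed

text \<open>The rule for \<open>I4\<close> runs along the hypotenuse from the first vertex to the
  second, those for \<open>I3\<close> and \<open>T\<close> from the second to the first. Reflecting
  the parameter reconciles the two.\<close>

lemma lint_triangle_flipped:
  fixes a b q :: "real^3"
  shows "lint {0..1} (\<lambda>t. K ((q + b + t *\<^sub>R (a - b)) \<bullet> (q + b + t *\<^sub>R (a - b)))) =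
    lint {0..1} (\<lambda>t. K ((q + a + t *\<^sub>R (b - a)) \<bullet> (q + a + t *\<^sub>R (b - a))))"
proof -
  have "q + b + (1 - t) *\<^sub>R (a - b) = q + a + t *\<^sub>R (b - a)" for t
    by (simp add: algebra_simps)
  then show ?thesis
    using lint_reflect[of "\<lambda>t. K ((q + b + t *\<^sub>R (a - b)) \<bullet> (q + b + t *\<^sub>R (a - b)))"]
    by (simp only:)
qed

text \<open>\<open>B\<close> carries the parameters that are not differentiated and \<open>q\<close>
  their contribution to the vector, so a product domain can be treated one factor at a time.\<close>

context
  fixes K K' :: "real \<Rightarrow> real" and B :: "'b::euclidean_space set" and q :: "'b \<Rightarrow> real^3"
  assumes K: "c1_kernel K K'" and B: "compact B" and q: "continuous_on UNIV q"
begin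

lemma contK: "continuous_on {0..} K" "continuous_on {0..} K'"
  using K c1_kernel_continuous by (auto simp: c1_kernel_def)

lemma continuous_on_q: "continuous_on A f \<Longrightarrow> continuous_on A (\<lambda>x. q (f x))"
  by (rule continuous_on_compose2[OF q]) auto

lemma lint_prism_segment:
  fixes a :: "real^3"
  defines "w \<equiv> \<lambda>p. q (fst p) + snd p *\<^sub>R a"
  shows "lint (B \<times> {0..1}) (\<lambda>p. K (w p \<bullet> w p) + 2 * K' (w p \<bullet> w p) * (w p \<bullet> ((snd p + s) *\<^sub>R a))) =
    (1 + s) * lint B (\<lambda>y. K ((q y + a) \<bullet> (q y + a))) - s * lint B (\<lambda>y. K (q y \<bullet> q y))"
proof -
  have cw: "continuous_on UNIV w" unfolding w_def by (intro continuous_intros continuous_on_q)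
  have "lint (B \<times> {0..1}) (\<lambda>p. K (w p \<bullet> w p) + 2 * K' (w p \<bullet> w p) * (w p \<bullet> ((snd p + s) *\<^sub>R a)))
    = lint B (\<lambda>y. (1 + s) * K ((q y + a) \<bullet> (q y + a)) - s * K (q y \<bullet> q y))"
    unfolding lint_Times(1)[OF B compact_Icc continuous_on_subset[OF _ subset_UNIV],
        OF continuous_on_add[OF continuous_on_kernel_radial[OF contK(1) cw]
          continuous_on_mult[OF continuous_on_mult[OF continuous_on_const continuous_on_kernel_radial[OF contK(2) cw]]
            continuous_on_inner[OF cw continuous_on_scaleR[OF continuous_on_add[OF continuous_on_snd[OF continuous_on_id] continuous_on_const] continuous_on_const]]]]]
    by (simp only: w_def fst_conv snd_conv lint_segment[OF K])
  also have "\<dots> = lint B (\<lambda>y. (1 + s) * K ((q y + a) \<bullet> (q y + a))) - lint B (\<lambda>y. s * K (q y \<bullet> q y))"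
    by (intro set_integral_diff set_integrable_compact B continuous_intros continuous_on_kernel_radial contK continuous_on_q)
  finally show ?thesis by simp
qed

lemma lint_prism_triangle:
  fixes a b :: "real^3"
  defines "w \<equiv> \<lambda>p. q (fst p) + fst (snd p) *\<^sub>R a + snd (snd p) *\<^sub>R b"
    and "L \<equiv> \<lambda>q b. lint (B \<times> {0..1}) (\<lambda>p. K ((q (fst p) + snd p *\<^sub>R b) \<bullet> (q (fst p) + snd p *\<^sub>R b)))"
  shows "lint (B \<times> std_tri) (\<lambda>p. 2 * K (w p \<bullet> w p) +
      2 * K' (w p \<bullet> w p) * (w p \<bullet> ((fst (snd p) + s1) *\<^sub>R a + (snd (snd p) + s2) *\<^sub>R b))) =
    - s1 * L q b - s2 * L q a + (1 + s1 + s2) * L (\<lambda>y. q y + b) (a - b)"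
proof -
  have cw: "continuous_on UNIV w" unfolding w_def by (intro continuous_intros continuous_on_q)
  define l where "l c d y = lint {0..1} (\<lambda>t. K ((q y + c + t *\<^sub>R d) \<bullet> (q y + c + t *\<^sub>R d)))" for c d y
  have cl: "continuous_on UNIV (\<lambda>p. K ((q (fst p) + c + snd p *\<^sub>R d) \<bullet> (q (fst p) + c + snd p *\<^sub>R d)))" for c d
    by (intro continuous_intros continuous_on_kernel_radial contK continuous_on_q)
  have li: "set_integrable lborel B (l c d)" for c d
    unfolding l_def using set_integrable_lint[OF B compact_Icc cl] by simp
  have lL: "lint B (l c d) = L (\<lambda>y. q y + c) d" for c d
    unfolding l_def L_def using lint_Times(1)[OF B compact_Icc continuous_on_subset[OF cl subset_UNIV]] by simp
  have "continuous_on UNIV (\<lambda>p. 2 * K (w p \<bullet> w p) +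
      2 * K' (w p \<bullet> w p) * (w p \<bullet> ((fst (snd p) + s1) *\<^sub>R a + (snd (snd p) + s2) *\<^sub>R b)))"
    by (intro continuous_intros continuous_on_kernel_radial contK cw)
  from lint_Times(1)[OF B compact_std_tri continuous_on_subset[OF this subset_UNIV]]
  have "lint (B \<times> std_tri) (\<lambda>p. 2 * K (w p \<bullet> w p) +
      2 * K' (w p \<bullet> w p) * (w p \<bullet> ((fst (snd p) + s1) *\<^sub>R a + (snd (snd p) + s2) *\<^sub>R b))) =
    lint B (\<lambda>y. - s1 * l 0 b y - s2 * l 0 a y + (1 + s1 + s2) * l b (a - b) y)"
    using lint_triangle[OF K, where a = a and b = b] by (simp add: w_def l_def)
  also have "\<dots> = lint B (\<lambda>y. - s1 * l 0 b y) - lint B (\<lambda>y. s2 * l 0 a y)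
      + lint B (\<lambda>y. (1 + s1 + s2) * l b (a - b) y)"
  proof -
    have i: "set_integrable lborel B (\<lambda>y. r * l c d y)" for r c d
      by (intro set_integrable_mult_right li)
    show ?thesis
      using set_integral_add(2)[OF set_integral_diff(1)[OF i i] i] set_integral_diff(2)[OF i i]
      by (simp only:)
  qed
  finally show ?thesis unfolding set_integral_mult_right lL by simp
qed

lemma lint_prism_flipped:
  fixes a b :: "real^3"
  shows "lint (B \<times> {0..1}) (\<lambda>p. K ((q (fst p) + b + snd p *\<^sub>R (a - b)) \<bullet> (q (fst p) + b + snd p *\<^sub>R (a - b)))) =
    lint (B \<times> {0..1}) (\<lambda>p. K ((q (fst p) + a + snd p *\<^sub>R (b - a)) \<bullet> (q (fst p) + a + snd p *\<^sub>R (b - a))))"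
proof -
  have c: "continuous_on A (\<lambda>p. K ((q (fst p) + c + snd p *\<^sub>R d) \<bullet> (q (fst p) + c + snd p *\<^sub>R d)))" for A c d
    by (intro continuous_intros continuous_on_kernel_radial contK continuous_on_q)
  show ?thesis
    unfolding lint_Times(1)[OF B compact_Icc c] fst_conv snd_conv
    by (rule lint_cong) (rule lint_triangle_flipped)
qed

end

text \<open>The integral a call stands for, over a product of two triangles, a prism, a square, a
  triangle or a segment. \<open>K\<close> takes squared distances, hence \<open>P\<^sup>2\<close>
  for a terminal call.\<close>

fun expr_int :: "(real \<Rightarrow> real) \<Rightarrow> expr \<Rightarrow> real" where
  "expr_int K (I4 a1 a2 a3 a4 e) = lint (std_tri \<times> std_tri) (\<lambda>p.
     let w = e + fst (fst p) *\<^sub>R a1 + snd (fst p) *\<^sub>R a2 + fst (snd p) *\<^sub>R a3 + snd (snd p) *\<^sub>R a4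
     in K (w \<bullet> w))"
| "expr_int K (I3 a1 a2 a3 e) = lint (std_tri \<times> {0..1}) (\<lambda>p.
     let w = e + fst (fst p) *\<^sub>R a1 + snd (fst p) *\<^sub>R a2 + snd p *\<^sub>R a3 in K (w \<bullet> w))"
| "expr_int K (Q a1 a2 e) = lint ({0..1} \<times> {0..1}) (\<lambda>p.
     let w = e + fst p *\<^sub>R a1 + snd p *\<^sub>R a2 in K (w \<bullet> w))"
| "expr_int K (T a1 a2 e) = lint std_tri (\<lambda>p.
     let w = e + fst p *\<^sub>R a1 + snd p *\<^sub>R a2 in K (w \<bullet> w))"
| "expr_int K (I1 a1 e) = lint {0..1} (\<lambda>t. let w = e + t *\<^sub>R a1 in K (w \<bullet> w))"
| "expr_int K (F P) = K (P\<^sup>2)"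

section \<open>One step of the recursion as an exact identity for smooth kernels\<close>

lemma kernel_step:
  fixes e :: "real^3"
  assumes K: "c1_kernel K K'" and d: "d \<ge> 1" and v: "v \<in> span (set a)"
  defines "N' \<equiv> \<lambda>t. integral {0..1} (\<lambda>l. l ^ (d + 1) * K' (l\<^sup>2 * t + (h_dist a e)\<^sup>2))"
    and "N \<equiv> next_kernel d (h_dist a e) K" and "w \<equiv> e_par a e + v"
  shows "K ((e + v) \<bullet> (e + v)) = real d * N (w \<bullet> w) + 2 * N' (w \<bullet> w) * (w \<bullet> w)"
  using next_kernel_Euler[OF K d, of "w \<bullet> w" "h_dist a e"] pythagoras_e_par[OF v, of e]
  by (simp add: w_def N_def N'_def mult_ac)

text \<open>For a product domain both the factor d and the vector w in the Euler identity are split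
  between the two factors, a triangle receiving 2 and an interval 1. Each part is then a divergence
  in its own factor and yields the children belonging to the boundary of that factor.\<close>

theorem expr_int_step:
  assumes K: "c1_kernel K K'" and x: "level x \<noteq> 0"
  shows "expr_int K x = (\<Sum>(c, y) \<leftarrow> children x. c * expr_int (next_kernel (level x) (own_h x) K) y)"
proof (cases x)
  case (I1 a e)
  define N where "N = next_kernel 1 (h_dist [a] e) K"
  define N' where "N' t = integral {0..1} (\<lambda>l. l ^ (1 + 1) * K' (l\<^sup>2 * t + (h_dist [a] e)\<^sup>2))" for t
  have N: "c1_kernel N N'" unfolding N_def N'_def by (rule c1_kernel_next[OF K]) simp
  define s where "s = s_coeff [a] e 1"
  have p: "e_par [a] e = s *\<^sub>R a" by (simp add: e_par_1 s_def)
  have "expr_int K x = lint {0..1} (\<lambda>t. N ((s *\<^sub>R a + t *\<^sub>R a) \<bullet> (s *\<^sub>R a + t *\<^sub>R a)) +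
      2 * N' ((s *\<^sub>R a + t *\<^sub>R a) \<bullet> (s *\<^sub>R a + t *\<^sub>R a)) * ((s *\<^sub>R a + t *\<^sub>R a) \<bullet> ((t + s) *\<^sub>R a)))"
    unfolding I1 expr_int.simps Let_def
  proof (rule lint_cong)
    fix t :: real
    have "t *\<^sub>R a \<in> span (set [a])" by (intro span_scale span_base) simp
    from kernel_step[OF K _ this, of 1 e, folded N_def N'_def, unfolded p]
    show "K ((e + t *\<^sub>R a) \<bullet> (e + t *\<^sub>R a)) = N ((s *\<^sub>R a + t *\<^sub>R a) \<bullet> (s *\<^sub>R a + t *\<^sub>R a)) +
      2 * N' ((s *\<^sub>R a + t *\<^sub>R a) \<bullet> (s *\<^sub>R a + t *\<^sub>R a)) * ((s *\<^sub>R a + t *\<^sub>R a) \<bullet> ((t + s) *\<^sub>R a))"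
      by (simp add: scaleR_add_left add.commute)
  qed
  also have "\<dots> = (1 + s) * N ((s *\<^sub>R a + a) \<bullet> (s *\<^sub>R a + a)) - s * N (s *\<^sub>R a \<bullet> s *\<^sub>R a)"
    by (rule lint_segment[OF N])
  also have "s *\<^sub>R a \<bullet> s *\<^sub>R a = (\<bar>s\<bar> * norm a)\<^sup>2"
    by (simp add: power_mult_distrib power2_norm_eq_inner power2_eq_square[of s])
  also have "s *\<^sub>R a + a = (1 + s) *\<^sub>R a" by (simp add: algebra_simps)
  also have "(1 + s) *\<^sub>R a \<bullet> (1 + s) *\<^sub>R a = (\<bar>1 + s\<bar> * norm a)\<^sup>2"
    by (simp add: power_mult_distrib power2_norm_eq_inner power2_eq_square[of "1 + s"])
  finally show ?thesis
    by (simp add: I1 Let_def N_def s_def)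
next
  case (T a1 a2 e)
  define N where "N = next_kernel 2 (h_dist [a1, a2] e) K"
  define N' where "N' t = integral {0..1} (\<lambda>l. l ^ (2 + 1) * K' (l\<^sup>2 * t + (h_dist [a1, a2] e)\<^sup>2))" for t
  have N: "c1_kernel N N'" unfolding N_def N'_def by (rule c1_kernel_next[OF K]) simp
  define s where "s = s_coeff [a1, a2] e"
  define p where "p = e_par [a1, a2] e"
  have p: "p = s 1 *\<^sub>R a1 + s 2 *\<^sub>R a2" by (simp add: p_def e_par_2 s_def)
  define w where "w z = p + fst z *\<^sub>R a1 + snd z *\<^sub>R a2" for z :: "real \<times> real"
  have "expr_int K x = lint std_tri (\<lambda>z. 2 * N (w z \<bullet> w z) +
      2 * N' (w z \<bullet> w z) * (w z \<bullet> ((fst z + s 1) *\<^sub>R a1 + (snd z + s 2) *\<^sub>R a2)))"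
    unfolding T expr_int.simps Let_def
  proof (rule lint_cong)
    fix z :: "real \<times> real"
    have "fst z *\<^sub>R a1 + snd z *\<^sub>R a2 \<in> span (set [a1, a2])"
      by (intro span_add span_scale span_base) simp_all
    from kernel_step[OF K _ this, of 2 e, folded N_def N'_def p_def]
    show "K ((e + fst z *\<^sub>R a1 + snd z *\<^sub>R a2) \<bullet> (e + fst z *\<^sub>R a1 + snd z *\<^sub>R a2)) = 2 * N (w z \<bullet> w z) +
      2 * N' (w z \<bullet> w z) * (w z \<bullet> ((fst z + s 1) *\<^sub>R a1 + (snd z + s 2) *\<^sub>R a2))"
      by (simp add: w_def p scaleR_add_left add_ac)
  qed
  also have "\<dots> = - s 1 * lint {0..1} (\<lambda>t. N ((p + t *\<^sub>R a2) \<bullet> (p + t *\<^sub>R a2)))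
    - s 2 * lint {0..1} (\<lambda>t. N ((p + t *\<^sub>R a1) \<bullet> (p + t *\<^sub>R a1)))
    + (1 + s 1 + s 2) * lint {0..1} (\<lambda>t. N ((p + a2 + t *\<^sub>R (a1 - a2)) \<bullet> (p + a2 + t *\<^sub>R (a1 - a2))))"
    unfolding w_def by (rule lint_triangle[OF N])
  finally show ?thesis
    by (simp add: T Let_def N_def s_def p_def)
next
  case (Q a1 a2 e)
  define N where "N = next_kernel 2 (h_dist [a1, a2] e) K"
  define N' where "N' t = integral {0..1} (\<lambda>l. l ^ (2 + 1) * K' (l\<^sup>2 * t + (h_dist [a1, a2] e)\<^sup>2))" for t
  have N: "c1_kernel N N'" unfolding N_def N'_def by (rule c1_kernel_next[OF K]) simp
  then have cont: "continuous_on {0..} N" "continuous_on {0..} N'"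
    using c1_kernel_continuous by (auto simp: c1_kernel_def)
  define s where "s = s_coeff [a1, a2] e"
  define p where "p = e_par [a1, a2] e"
  have p: "p = s 1 *\<^sub>R a1 + s 2 *\<^sub>R a2" by (simp add: p_def e_par_2 s_def)
  define w where "w z = p + fst z *\<^sub>R a1 + snd z *\<^sub>R a2" for z :: "real \<times> real"
  have cw: "continuous_on A w" for A unfolding w_def by (intro continuous_intros)
  define f where "f z = N (w z \<bullet> w z) + 2 * N' (w z \<bullet> w z) * (w z \<bullet> ((fst z + s 1) *\<^sub>R a1))" for z
  define g where "g z = N (w z \<bullet> w z) + 2 * N' (w z \<bullet> w z) * (w z \<bullet> ((snd z + s 2) *\<^sub>R a2))" for z
  have cf: "continuous_on A f" and cg: "continuous_on A g" for A
    unfolding f_def g_def by (intro continuous_intros continuous_on_kernel_radial cont cw)+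
  have "expr_int K x = lint ({0..1} \<times> {0..1}) (\<lambda>z. f z + g z)"
    unfolding Q expr_int.simps Let_def
  proof (rule lint_cong)
    fix z :: "real \<times> real"
    have "fst z *\<^sub>R a1 + snd z *\<^sub>R a2 \<in> span (set [a1, a2])"
      by (intro span_add span_scale span_base) simp_all
    from kernel_step[OF K _ this, of 2 e, folded N_def N'_def p_def]
    have "K ((e + fst z *\<^sub>R a1 + snd z *\<^sub>R a2) \<bullet> (e + fst z *\<^sub>R a1 + snd z *\<^sub>R a2)) =
        2 * N (w z \<bullet> w z) + 2 * N' (w z \<bullet> w z) * (w z \<bullet> w z)"
      by (simp add: w_def add_ac)
    also have "w z = (fst z + s 1) *\<^sub>R a1 + (snd z + s 2) *\<^sub>R a2"
      by (simp add: w_def p scaleR_add_left add_ac)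
    then have "w z \<bullet> w z = w z \<bullet> ((fst z + s 1) *\<^sub>R a1) + w z \<bullet> ((snd z + s 2) *\<^sub>R a2)"
      by (metis inner_add_right)
    then have "2 * N (w z \<bullet> w z) + 2 * N' (w z \<bullet> w z) * (w z \<bullet> w z) = f z + g z"
      unfolding f_def g_def by (simp add: distrib_left)
    finally show "K ((e + fst z *\<^sub>R a1 + snd z *\<^sub>R a2) \<bullet> (e + fst z *\<^sub>R a1 + snd z *\<^sub>R a2)) = f z + g z" .
  qed
  also have "\<dots> = lint ({0..1} \<times> {0..1}) f + lint ({0..1} \<times> {0..1}) g"
    by (intro lint_add compact_Times compact_Icc cf cg)
  also have "lint ({0..1} \<times> {0..1}) g = (1 + s 2) * expr_int N (I1 a1 (p + a2)) - s 2 * expr_int N (I1 a1 p)"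
    using lint_prism_segment[OF N compact_Icc, of "\<lambda>y. p + y *\<^sub>R a1" 0 1 a2 "s 2"]
    by (simp add: g_def[abs_def] w_def Let_def continuous_intros add_ac)
  \<comment> \<open>The prism lemma differentiates in the second factor of the domain, so the two
    intervals are exchanged first.\<close>
  also have "lint ({0..1} \<times> {0..1}) f = (1 + s 1) * expr_int N (I1 a2 (p + a1)) - s 1 * expr_int N (I1 a2 p)"
    using lint_prism_segment[OF N compact_Icc, of "\<lambda>y. p + y *\<^sub>R a2" 0 1 a1 "s 1"]
      lint_Times_swap[OF compact_Icc compact_Icc cf, of 0 1 0 1]
    by (simp add: f_def[abs_def] w_def Let_def continuous_intros add_ac)
  finally show ?thesis
    by (simp add: Q Let_def N_def s_def p_def)
next
  case (I3 a1 a2 a3 e)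
  define N where "N = next_kernel 3 (h_dist [a1, a2, a3] e) K"
  define N' where "N' t = integral {0..1} (\<lambda>l. l ^ (3 + 1) * K' (l\<^sup>2 * t + (h_dist [a1, a2, a3] e)\<^sup>2))" for t
  have N: "c1_kernel N N'" unfolding N_def N'_def by (rule c1_kernel_next[OF K]) simp
  then have cont: "continuous_on {0..} N" "continuous_on {0..} N'"
    using c1_kernel_continuous by (auto simp: c1_kernel_def)
  define s where "s = s_coeff [a1, a2, a3] e"
  define p where "p = e_par [a1, a2, a3] e"
  have p: "p = s 1 *\<^sub>R a1 + s 2 *\<^sub>R a2 + s 3 *\<^sub>R a3" by (simp add: p_def e_par_3 s_def)
  define w where "w z = p + fst (fst z) *\<^sub>R a1 + snd (fst z) *\<^sub>R a2 + snd z *\<^sub>R a3"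
    for z :: "(real \<times> real) \<times> real"
  have cw: "continuous_on A w" for A unfolding w_def by (intro continuous_intros)
  define f where "f z = 2 * N (w z \<bullet> w z) + 2 * N' (w z \<bullet> w z) *
    (w z \<bullet> ((fst (fst z) + s 1) *\<^sub>R a1 + (snd (fst z) + s 2) *\<^sub>R a2))" for z
  define g where "g z = N (w z \<bullet> w z) + 2 * N' (w z \<bullet> w z) * (w z \<bullet> ((snd z + s 3) *\<^sub>R a3))" for z
  have cf: "continuous_on A f" and cg: "continuous_on A g" for A
    unfolding f_def g_def by (intro continuous_intros continuous_on_kernel_radial cont cw)+
  have "expr_int K x = lint (std_tri \<times> {0..1}) (\<lambda>z. f z + g z)"
    unfolding I3 expr_int.simps Let_def
  proof (rule lint_cong)
    fix z :: "(real \<times> real) \<times> real"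
    let ?e = "e + fst (fst z) *\<^sub>R a1 + snd (fst z) *\<^sub>R a2 + snd z *\<^sub>R a3"
    have "fst (fst z) *\<^sub>R a1 + snd (fst z) *\<^sub>R a2 + snd z *\<^sub>R a3 \<in> span (set [a1, a2, a3])"
      by (intro span_add span_scale span_base) simp_all
    from kernel_step[OF K _ this, of 3 e, folded N_def N'_def p_def]
    have "K (?e \<bullet> ?e) = 3 * N (w z \<bullet> w z) + 2 * N' (w z \<bullet> w z) * (w z \<bullet> w z)"
      by (simp add: w_def add_ac)
    also have "w z = ((fst (fst z) + s 1) *\<^sub>R a1 + (snd (fst z) + s 2) *\<^sub>R a2) + (snd z + s 3) *\<^sub>R a3"
      by (simp add: w_def p scaleR_add_left add_ac)
    then have "w z \<bullet> w z = w z \<bullet> ((fst (fst z) + s 1) *\<^sub>R a1 + (snd (fst z) + s 2) *\<^sub>R a2)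
        + w z \<bullet> ((snd z + s 3) *\<^sub>R a3)"
      by (metis inner_add_right)
    then have "3 * N (w z \<bullet> w z) + 2 * N' (w z \<bullet> w z) * (w z \<bullet> w z) = f z + g z"
      unfolding f_def g_def by (simp add: distrib_left)
    finally show "K (?e \<bullet> ?e) = f z + g z" .
  qed
  also have "\<dots> = lint (std_tri \<times> {0..1}) f + lint (std_tri \<times> {0..1}) g"
    by (intro lint_add compact_Times compact_Icc compact_std_tri cf cg)
  also have "lint (std_tri \<times> {0..1}) g =
      (1 + s 3) * expr_int N (T a1 a2 (p + a3)) - s 3 * expr_int N (T a1 a2 p)"
    using lint_prism_segment[OF N compact_std_tri, of "\<lambda>y. p + fst y *\<^sub>R a1 + snd y *\<^sub>R a2" a3 "s 3"]
    by (simp add: g_def[abs_def] w_def Let_def continuous_intros add_ac)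
  also have "lint (std_tri \<times> {0..1}) f =
      - s 1 * expr_int N (Q a2 a3 p) - s 2 * expr_int N (Q a1 a3 p)
      + (1 + s 1 + s 2) * expr_int N (Q (a1 - a2) a3 (p + a2))"
  proof -
    \<comment> \<open>After the exchange of factors the interval of \<open>a3\<close> comes first,
      whereas \<open>Q\<close> lists the edge of the triangle first.\<close>
    have sw: "lint ({0..1} \<times> {0..1}) (\<lambda>z. N ((p + c + snd z *\<^sub>R b + fst z *\<^sub>R a3) \<bullet> (p + c + snd z *\<^sub>R b + fst z *\<^sub>R a3)))
       = expr_int N (Q b a3 (p + c))" for b c
      unfolding expr_int.simps Let_def
      by (subst lint_Times_swap) (auto intro!: continuous_intros continuous_on_kernel_radial cont)
    show ?thesis
      using lint_prism_triangle[OF N compact_Icc, of "\<lambda>y. p + y *\<^sub>R a3" 0 1 a1 a2 "s 1" "s 2"]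
        lint_Times_swap[OF compact_std_tri compact_Icc cf, of 0 1] sw[of 0 a1] sw[of 0 a2] sw[of a2 "a1 - a2"]
      by (simp add: f_def[abs_def] w_def Let_def continuous_intros add_ac)
  qed
  finally show ?thesis
    by (simp add: I3 Let_def N_def s_def p_def)
next
  case (I4 a1 a2 a3 a4 e)
  define N where "N = next_kernel 4 (h_dist [a1, a2, a3, a4] e) K"
  define N' where "N' t = integral {0..1} (\<lambda>l. l ^ (4 + 1) * K' (l\<^sup>2 * t + (h_dist [a1, a2, a3, a4] e)\<^sup>2))" for t
  have N: "c1_kernel N N'" unfolding N_def N'_def by (rule c1_kernel_next[OF K]) simp
  then have cont: "continuous_on {0..} N" "continuous_on {0..} N'"
    using c1_kernel_continuous by (auto simp: c1_kernel_def)
  define s where "s = s_coeff [a1, a2, a3, a4] e"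
  define p where "p = e_par [a1, a2, a3, a4] e"
  have p: "p = s 1 *\<^sub>R a1 + s 2 *\<^sub>R a2 + s 3 *\<^sub>R a3 + s 4 *\<^sub>R a4" by (simp add: p_def e_par_4 s_def)
  define w where "w z = p + fst (fst z) *\<^sub>R a1 + snd (fst z) *\<^sub>R a2 + fst (snd z) *\<^sub>R a3 + snd (snd z) *\<^sub>R a4"
    for z :: "(real \<times> real) \<times> (real \<times> real)"
  have cw: "continuous_on A w" for A unfolding w_def by (intro continuous_intros)
  define f where "f z = 2 * N (w z \<bullet> w z) + 2 * N' (w z \<bullet> w z) *
    (w z \<bullet> ((fst (fst z) + s 1) *\<^sub>R a1 + (snd (fst z) + s 2) *\<^sub>R a2))" for z
  define g where "g z = 2 * N (w z \<bullet> w z) + 2 * N' (w z \<bullet> w z) *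
    (w z \<bullet> ((fst (snd z) + s 3) *\<^sub>R a3 + (snd (snd z) + s 4) *\<^sub>R a4))" for z
  have cf: "continuous_on A f" and cg: "continuous_on A g" for A
    unfolding f_def g_def by (intro continuous_intros continuous_on_kernel_radial cont cw)+
  have "expr_int K x = lint (std_tri \<times> std_tri) (\<lambda>z. f z + g z)"
    unfolding I4 expr_int.simps Let_def
  proof (rule lint_cong)
    fix z :: "(real \<times> real) \<times> (real \<times> real)"
    let ?e = "e + fst (fst z) *\<^sub>R a1 + snd (fst z) *\<^sub>R a2 + fst (snd z) *\<^sub>R a3 + snd (snd z) *\<^sub>R a4"
    have "fst (fst z) *\<^sub>R a1 + snd (fst z) *\<^sub>R a2 + fst (snd z) *\<^sub>R a3 + snd (snd z) *\<^sub>R a4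
        \<in> span (set [a1, a2, a3, a4])"
      by (intro span_add span_scale span_base) simp_all
    from kernel_step[OF K _ this, of 4 e, folded N_def N'_def p_def]
    have "K (?e \<bullet> ?e) = 4 * N (w z \<bullet> w z) + 2 * N' (w z \<bullet> w z) * (w z \<bullet> w z)"
      by (simp add: w_def add_ac)
    also have "w z = ((fst (fst z) + s 1) *\<^sub>R a1 + (snd (fst z) + s 2) *\<^sub>R a2)
        + ((fst (snd z) + s 3) *\<^sub>R a3 + (snd (snd z) + s 4) *\<^sub>R a4)"
      by (simp add: w_def p scaleR_add_left add_ac)
    then have "w z \<bullet> w z = w z \<bullet> ((fst (fst z) + s 1) *\<^sub>R a1 + (snd (fst z) + s 2) *\<^sub>R a2)
        + w z \<bullet> ((fst (snd z) + s 3) *\<^sub>R a3 + (snd (snd z) + s 4) *\<^sub>R a4)"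
      by (metis inner_add_right)
    then have "4 * N (w z \<bullet> w z) + 2 * N' (w z \<bullet> w z) * (w z \<bullet> w z) = f z + g z"
      unfolding f_def g_def by (simp add: distrib_left)
    finally show "K (?e \<bullet> ?e) = f z + g z" .
  qed
  also have "\<dots> = lint (std_tri \<times> std_tri) f + lint (std_tri \<times> std_tri) g"
    by (intro lint_add compact_Times compact_std_tri cf cg)
  also have "lint (std_tri \<times> std_tri) g =
      - s 3 * expr_int N (I3 a1 a2 a4 p) - s 4 * expr_int N (I3 a1 a2 a3 p)
      + (1 + s 3 + s 4) * expr_int N (I3 a1 a2 (a4 - a3) (p + a3))"
    using lint_prism_triangle[OF N compact_std_tri, of "\<lambda>y. p + fst y *\<^sub>R a1 + snd y *\<^sub>R a2" a3 a4 "s 3" "s 4"]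
      lint_prism_flipped[OF N compact_std_tri, of "\<lambda>y. p + fst y *\<^sub>R a1 + snd y *\<^sub>R a2" a4 a3]
    by (simp add: g_def[abs_def] w_def Let_def continuous_intros add_ac)
  also have "lint (std_tri \<times> std_tri) f =
      - s 1 * expr_int N (I3 a3 a4 a2 p) - s 2 * expr_int N (I3 a3 a4 a1 p)
      + (1 + s 1 + s 2) * expr_int N (I3 a3 a4 (a2 - a1) (p + a1))"
    using lint_prism_triangle[OF N compact_std_tri, of "\<lambda>y. p + fst y *\<^sub>R a3 + snd y *\<^sub>R a4" a1 a2 "s 1" "s 2"]
      lint_prism_flipped[OF N compact_std_tri, of "\<lambda>y. p + fst y *\<^sub>R a3 + snd y *\<^sub>R a4" a2 a1]
      lint_Times_swap[OF compact_std_tri compact_std_tri cf]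
    by (simp add: f_def[abs_def] w_def Let_def continuous_intros add_ac)
  finally show ?thesis
    by (simp add: I4 Let_def N_def s_def p_def)
qed (use x in auto)

section \<open>Degeneration along the recursion\<close>

fun vecs :: "expr \<Rightarrow> (real^3) set" where
  "vecs (I4 a1 a2 a3 a4 e) = {a1, a2, a3, a4}"
| "vecs (I3 a1 a2 a3 e) = {a1, a2, a3}"
| "vecs (Q a1 a2 e) = {a1, a2}"
| "vecs (T a1 a2 e) = {a1, a2}"
| "vecs (I1 a1 e) = {a1}"
| "vecs (F P) = {}"

fun offset :: "expr \<Rightarrow> real^3" where
  "offset (I4 a1 a2 a3 a4 e) = e"
| "offset (I3 a1 a2 a3 e) = e"
| "offset (Q a1 a2 e) = e"
| "offset (T a1 a2 e) = e"
| "offset (I1 a1 e) = e"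
| "offset (F P) = 0"

fun nondegenerate :: "expr \<Rightarrow> bool" where
  "nondegenerate (I4 a1 a2 a3 a4 e) \<longleftrightarrow> a1 \<noteq> 0 \<and> a2 \<notin> span {a1} \<and> a3 \<noteq> 0 \<and> a4 \<notin> span {a3}"
| "nondegenerate (I3 a1 a2 a3 e) \<longleftrightarrow> a1 \<noteq> 0 \<and> a2 \<notin> span {a1} \<and> a3 \<noteq> 0"
| "nondegenerate (Q a1 a2 e) \<longleftrightarrow> a1 \<noteq> 0 \<and> a2 \<noteq> 0"
| "nondegenerate (T a1 a2 e) \<longleftrightarrow> a1 \<noteq> 0 \<and> a2 \<notin> span {a1}"
| "nondegenerate (I1 a1 e) \<longleftrightarrow> a1 \<noteq> 0"
| "nondegenerate (F P) \<longleftrightarrow> True"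

lemma not_in_span_singletonD:
  assumes "b \<notin> span {a :: real^3}"
  shows "b \<noteq> 0" "b - a \<noteq> 0" "a - b \<noteq> 0" "a \<noteq> b"
  using assms span_zero span_base[of a "{a}"] by auto

lemma nondegenerate_child:
  assumes "nondegenerate x" "(c, y) \<in> set (children x)"
  shows "nondegenerate y"
  using assms by (cases x) (auto simp: Let_def dest: not_in_span_singletonD)

lemma own_h_eq_0_iff: "level x \<noteq> 0 \<Longrightarrow> own_h x = 0 \<longleftrightarrow> offset x \<in> span (vecs x)"
  by (cases x) (simp_all add: h_dist_eq_0_iff)

lemma own_h_nonneg: "own_h x \<ge> 0"
  by (cases x) (simp_all add: h_dist_nonneg)

lemma in_span_diffD: "a - b \<in> span S \<Longrightarrow> b \<in> span S \<Longrightarrow> a \<in> span S"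
  using span_add[of "a - b" S b] by simp

text \<open>Passing to a child drops one direction \<open>b\<close>, and the component of the new offset along \<open>b\<close>
  is, up to sign, the coefficient of the child.\<close>

definition drops_direction :: "(real^3) set \<Rightarrow> real \<Rightarrow> (real^3) set \<Rightarrow> real^3 \<Rightarrow> bool" where
  "drops_direction V c W e \<longleftrightarrow> W \<subseteq> span V \<and> e \<in> span V \<and>
     (\<exists>b. V \<subseteq> span (insert b W) \<and> (e - c *\<^sub>R b \<in> span W \<or> e + c *\<^sub>R b \<in> span W))"

lemma drops_directionI:
  assumes "W \<subseteq> span V" "e \<in> span V" "V \<subseteq> span (insert b W)" "e - c *\<^sub>R b \<in> span W \<or> e + c *\<^sub>R b \<in> span W"
  shows "drops_direction V c W e"
  using assms by (auto simp: drops_direction_def)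

text \<open>For a child with unshifted offset, b is the vector missing from it and the coefficient
  is minus that of b in \<open>e_par\<close>. For a shifted child b is the vector added to the
  offset; on a hypotenuse the other vector is rewritten as b plus the edge, so that b collects the
  full coefficient, such as 1 + s 3 + s 4.\<close>

lemma child_drops_direction:
  assumes "(c, y) \<in> set (children x)" "level y \<noteq> 0"
  shows "drops_direction (vecs x) c (vecs y) (offset y)"
proof (cases x)
  case (I4 a1 a2 a3 a4 e)
  define s where "s = s_coeff [a1, a2, a3, a4] e"
  define p where "p = e_par [a1, a2, a3, a4] e"
  have p: "p = s 1 *\<^sub>R a1 + s 2 *\<^sub>R a2 + s 3 *\<^sub>R a3 + s 4 *\<^sub>R a4" by (simp add: p_def e_par_4 s_def)
  from assms(1) consider
    "c = - s 4" "y = I3 a1 a2 a3 p" | "c = 1 + s 3 + s 4" "y = I3 a1 a2 (a4 - a3) (p + a3)"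
    | "c = - s 3" "y = I3 a1 a2 a4 p" | "c = - s 2" "y = I3 a3 a4 a1 p"
    | "c = 1 + s 1 + s 2" "y = I3 a3 a4 (a2 - a1) (p + a1)" | "c = - s 1" "y = I3 a3 a4 a2 p"
    by (auto simp: I4 Let_def s_def p_def)
  then show ?thesis
  proof cases
    case 1
    have "s 1 *\<^sub>R a1 + s 2 *\<^sub>R a2 + s 3 *\<^sub>R a3 \<in> span (vecs y)"
      using 1 by (auto intro!: span_add span_scale intro: span_base)
    moreover have "offset y + c *\<^sub>R a4 = s 1 *\<^sub>R a1 + s 2 *\<^sub>R a2 + s 3 *\<^sub>R a3"
      using 1 by (simp add: p algebra_simps)
    ultimately have m: "offset y + c *\<^sub>R a4 \<in> span (vecs y)" by (simp only:)
    show ?thesis unfolding I4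
      by (rule drops_directionI[OF _ _ _ disjI2[OF m]])
        (use 1 in \<open>auto simp: p intro!: span_add span_scale intro: span_base span_diff\<close>)
  next
    case 2
    have "s 1 *\<^sub>R a1 + s 2 *\<^sub>R a2 + s 4 *\<^sub>R (a4 - a3) \<in> span (vecs y)"
      using 2 by (auto intro!: span_add span_scale intro: span_base)
    moreover have "offset y - c *\<^sub>R a3 = s 1 *\<^sub>R a1 + s 2 *\<^sub>R a2 + s 4 *\<^sub>R (a4 - a3)"
      using 2 by (simp add: p algebra_simps)
    ultimately have m: "offset y - c *\<^sub>R a3 \<in> span (vecs y)" by (simp only:)
    have m': "a4 \<in> span {a3, a1, a2, a4 - a3}"
      by (rule in_span_diffD[where b = a3]) (auto intro!: span_base)
    show ?thesis unfolding I4
      by (rule drops_directionI[OF _ _ _ disjI1[OF m]])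
        (use 2 m' in \<open>auto simp: p intro!: span_add span_scale intro: span_base span_diff\<close>)
  next
    case 3
    have "s 1 *\<^sub>R a1 + s 2 *\<^sub>R a2 + s 4 *\<^sub>R a4 \<in> span (vecs y)"
      using 3 by (auto intro!: span_add span_scale intro: span_base)
    moreover have "offset y + c *\<^sub>R a3 = s 1 *\<^sub>R a1 + s 2 *\<^sub>R a2 + s 4 *\<^sub>R a4"
      using 3 by (simp add: p algebra_simps)
    ultimately have m: "offset y + c *\<^sub>R a3 \<in> span (vecs y)" by (simp only:)
    show ?thesis unfolding I4
      by (rule drops_directionI[OF _ _ _ disjI2[OF m]])
        (use 3 in \<open>auto simp: p intro!: span_add span_scale intro: span_base span_diff\<close>)
  next
    case 4
    have "s 1 *\<^sub>R a1 + s 3 *\<^sub>R a3 + s 4 *\<^sub>R a4 \<in> span (vecs y)"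
      using 4 by (auto intro!: span_add span_scale intro: span_base)
    moreover have "offset y + c *\<^sub>R a2 = s 1 *\<^sub>R a1 + s 3 *\<^sub>R a3 + s 4 *\<^sub>R a4"
      using 4 by (simp add: p algebra_simps)
    ultimately have m: "offset y + c *\<^sub>R a2 \<in> span (vecs y)" by (simp only:)
    show ?thesis unfolding I4
      by (rule drops_directionI[OF _ _ _ disjI2[OF m]])
        (use 4 in \<open>auto simp: p intro!: span_add span_scale intro: span_base span_diff\<close>)
  next
    case 5
    have "s 2 *\<^sub>R (a2 - a1) + s 3 *\<^sub>R a3 + s 4 *\<^sub>R a4 \<in> span (vecs y)"
      using 5 by (auto intro!: span_add span_scale intro: span_base)
    moreover have "offset y - c *\<^sub>R a1 = s 2 *\<^sub>R (a2 - a1) + s 3 *\<^sub>R a3 + s 4 *\<^sub>R a4"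
      using 5 by (simp add: p algebra_simps)
    ultimately have m: "offset y - c *\<^sub>R a1 \<in> span (vecs y)" by (simp only:)
    have m': "a2 \<in> span {a1, a3, a4, a2 - a1}"
      by (rule in_span_diffD[where b = a1]) (auto intro!: span_base)
    show ?thesis unfolding I4
      by (rule drops_directionI[OF _ _ _ disjI1[OF m]])
        (use 5 m' in \<open>auto simp: p intro!: span_add span_scale intro: span_base span_diff\<close>)
  next
    case 6
    have "s 2 *\<^sub>R a2 + s 3 *\<^sub>R a3 + s 4 *\<^sub>R a4 \<in> span (vecs y)"
      using 6 by (auto intro!: span_add span_scale intro: span_base)
    moreover have "offset y + c *\<^sub>R a1 = s 2 *\<^sub>R a2 + s 3 *\<^sub>R a3 + s 4 *\<^sub>R a4"
      using 6 by (simp add: p algebra_simps)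
    ultimately have m: "offset y + c *\<^sub>R a1 \<in> span (vecs y)" by (simp only:)
    show ?thesis unfolding I4
      by (rule drops_directionI[OF _ _ _ disjI2[OF m]])
        (use 6 in \<open>auto simp: p intro!: span_add span_scale intro: span_base span_diff\<close>)
  qed
next
  case (I3 a1 a2 a3 e)
  define s where "s = s_coeff [a1, a2, a3] e"
  define p where "p = e_par [a1, a2, a3] e"
  have p: "p = s 1 *\<^sub>R a1 + s 2 *\<^sub>R a2 + s 3 *\<^sub>R a3" by (simp add: p_def e_par_3 s_def)
  from assms(1) consider
    "c = 1 + s 1 + s 2" "y = Q (a1 - a2) a3 (p + a2)" | "c = - s 1" "y = Q a2 a3 p"
    | "c = - s 2" "y = Q a1 a3 p" | "c = 1 + s 3" "y = T a1 a2 (p + a3)" | "c = - s 3" "y = T a1 a2 p"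
    by (auto simp: I3 Let_def s_def p_def)
  then show ?thesis
  proof cases
    case 1
    have "s 1 *\<^sub>R (a1 - a2) + s 3 *\<^sub>R a3 \<in> span (vecs y)"
      using 1 by (auto intro!: span_add span_scale intro: span_base)
    moreover have "offset y - c *\<^sub>R a2 = s 1 *\<^sub>R (a1 - a2) + s 3 *\<^sub>R a3"
      using 1 by (simp add: p algebra_simps)
    ultimately have m: "offset y - c *\<^sub>R a2 \<in> span (vecs y)" by (simp only:)
    have m': "a1 \<in> span {a2, a1 - a2, a3}"
      by (rule in_span_diffD[where b = a2]) (auto intro!: span_base)
    show ?thesis unfolding I3
      by (rule drops_directionI[OF _ _ _ disjI1[OF m]])
        (use 1 m' in \<open>auto simp: p intro!: span_add span_scale intro: span_base span_diff\<close>)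
  next
    case 2
    have "s 2 *\<^sub>R a2 + s 3 *\<^sub>R a3 \<in> span (vecs y)"
      using 2 by (auto intro!: span_add span_scale intro: span_base)
    moreover have "offset y + c *\<^sub>R a1 = s 2 *\<^sub>R a2 + s 3 *\<^sub>R a3"
      using 2 by (simp add: p algebra_simps)
    ultimately have m: "offset y + c *\<^sub>R a1 \<in> span (vecs y)" by (simp only:)
    show ?thesis unfolding I3
      by (rule drops_directionI[OF _ _ _ disjI2[OF m]])
        (use 2 in \<open>auto simp: p intro!: span_add span_scale intro: span_base span_diff\<close>)
  next
    case 3
    have "s 1 *\<^sub>R a1 + s 3 *\<^sub>R a3 \<in> span (vecs y)"
      using 3 by (auto intro!: span_add span_scale intro: span_base)
    moreover have "offset y + c *\<^sub>R a2 = s 1 *\<^sub>R a1 + s 3 *\<^sub>R a3"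
      using 3 by (simp add: p algebra_simps)
    ultimately have m: "offset y + c *\<^sub>R a2 \<in> span (vecs y)" by (simp only:)
    show ?thesis unfolding I3
      by (rule drops_directionI[OF _ _ _ disjI2[OF m]])
        (use 3 in \<open>auto simp: p intro!: span_add span_scale intro: span_base span_diff\<close>)
  next
    case 4
    have "s 1 *\<^sub>R a1 + s 2 *\<^sub>R a2 \<in> span (vecs y)"
      using 4 by (auto intro!: span_add span_scale intro: span_base)
    moreover have "offset y - c *\<^sub>R a3 = s 1 *\<^sub>R a1 + s 2 *\<^sub>R a2"
      using 4 by (simp add: p algebra_simps)
    ultimately have m: "offset y - c *\<^sub>R a3 \<in> span (vecs y)" by (simp only:)
    show ?thesis unfolding I3
      by (rule drops_directionI[OF _ _ _ disjI1[OF m]])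
        (use 4 in \<open>auto simp: p intro!: span_add span_scale intro: span_base span_diff\<close>)
  next
    case 5
    have "s 1 *\<^sub>R a1 + s 2 *\<^sub>R a2 \<in> span (vecs y)"
      using 5 by (auto intro!: span_add span_scale intro: span_base)
    moreover have "offset y + c *\<^sub>R a3 = s 1 *\<^sub>R a1 + s 2 *\<^sub>R a2"
      using 5 by (simp add: p algebra_simps)
    ultimately have m: "offset y + c *\<^sub>R a3 \<in> span (vecs y)" by (simp only:)
    show ?thesis unfolding I3
      by (rule drops_directionI[OF _ _ _ disjI2[OF m]])
        (use 5 in \<open>auto simp: p intro!: span_add span_scale intro: span_base span_diff\<close>)
  qed
next
  case (Q a1 a2 e)
  define s where "s = s_coeff [a1, a2] e"
  define p where "p = e_par [a1, a2] e"
  have p: "p = s 1 *\<^sub>R a1 + s 2 *\<^sub>R a2" by (simp add: p_def e_par_2 s_def)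
  from assms(1) consider
    "c = 1 + s 1" "y = I1 a2 (p + a1)" | "c = - s 1" "y = I1 a2 p"
    | "c = 1 + s 2" "y = I1 a1 (p + a2)" | "c = - s 2" "y = I1 a1 p"
    by (auto simp: Q Let_def s_def p_def)
  then show ?thesis
  proof cases
    case 1
    have "s 2 *\<^sub>R a2 \<in> span (vecs y)"
      using 1 by (auto intro!: span_add span_scale intro: span_base)
    moreover have "offset y - c *\<^sub>R a1 = s 2 *\<^sub>R a2"
      using 1 by (simp add: p algebra_simps)
    ultimately have m: "offset y - c *\<^sub>R a1 \<in> span (vecs y)" by (simp only:)
    show ?thesis unfolding Q
      by (rule drops_directionI[OF _ _ _ disjI1[OF m]])
        (use 1 in \<open>auto simp: p intro!: span_add span_scale intro: span_base span_diff\<close>)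
  next
    case 2
    have "s 2 *\<^sub>R a2 \<in> span (vecs y)"
      using 2 by (auto intro!: span_add span_scale intro: span_base)
    moreover have "offset y + c *\<^sub>R a1 = s 2 *\<^sub>R a2"
      using 2 by (simp add: p algebra_simps)
    ultimately have m: "offset y + c *\<^sub>R a1 \<in> span (vecs y)" by (simp only:)
    show ?thesis unfolding Q
      by (rule drops_directionI[OF _ _ _ disjI2[OF m]])
        (use 2 in \<open>auto simp: p intro!: span_add span_scale intro: span_base span_diff\<close>)
  next
    case 3
    have "s 1 *\<^sub>R a1 \<in> span (vecs y)"
      using 3 by (auto intro!: span_add span_scale intro: span_base)
    moreover have "offset y - c *\<^sub>R a2 = s 1 *\<^sub>R a1"
      using 3 by (simp add: p algebra_simps)
    ultimately have m: "offset y - c *\<^sub>R a2 \<in> span (vecs y)" by (simp only:)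
    show ?thesis unfolding Q
      by (rule drops_directionI[OF _ _ _ disjI1[OF m]])
        (use 3 in \<open>auto simp: p intro!: span_add span_scale intro: span_base span_diff\<close>)
  next
    case 4
    have "s 1 *\<^sub>R a1 \<in> span (vecs y)"
      using 4 by (auto intro!: span_add span_scale intro: span_base)
    moreover have "offset y + c *\<^sub>R a2 = s 1 *\<^sub>R a1"
      using 4 by (simp add: p algebra_simps)
    ultimately have m: "offset y + c *\<^sub>R a2 \<in> span (vecs y)" by (simp only:)
    show ?thesis unfolding Q
      by (rule drops_directionI[OF _ _ _ disjI2[OF m]])
        (use 4 in \<open>auto simp: p intro!: span_add span_scale intro: span_base span_diff\<close>)
  qed
next
  case (T a1 a2 e)
  define s where "s = s_coeff [a1, a2] e"
  define p where "p = e_par [a1, a2] e"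
  have p: "p = s 1 *\<^sub>R a1 + s 2 *\<^sub>R a2" by (simp add: p_def e_par_2 s_def)
  from assms(1) consider
    "c = - s 1" "y = I1 a2 p" | "c = - s 2" "y = I1 a1 p"
    | "c = 1 + s 1 + s 2" "y = I1 (a1 - a2) (p + a2)"
    by (auto simp: T Let_def s_def p_def)
  then show ?thesis
  proof cases
    case 1
    have "s 2 *\<^sub>R a2 \<in> span (vecs y)"
      using 1 by (auto intro!: span_add span_scale intro: span_base)
    moreover have "offset y + c *\<^sub>R a1 = s 2 *\<^sub>R a2"
      using 1 by (simp add: p algebra_simps)
    ultimately have m: "offset y + c *\<^sub>R a1 \<in> span (vecs y)" by (simp only:)
    show ?thesis unfolding T
      by (rule drops_directionI[OF _ _ _ disjI2[OF m]])
        (use 1 in \<open>auto simp: p intro!: span_add span_scale intro: span_base span_diff\<close>)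
  next
    case 2
    have "s 1 *\<^sub>R a1 \<in> span (vecs y)"
      using 2 by (auto intro!: span_add span_scale intro: span_base)
    moreover have "offset y + c *\<^sub>R a2 = s 1 *\<^sub>R a1"
      using 2 by (simp add: p algebra_simps)
    ultimately have m: "offset y + c *\<^sub>R a2 \<in> span (vecs y)" by (simp only:)
    show ?thesis unfolding T
      by (rule drops_directionI[OF _ _ _ disjI2[OF m]])
        (use 2 in \<open>auto simp: p intro!: span_add span_scale intro: span_base span_diff\<close>)
  next
    case 3
    have "s 1 *\<^sub>R (a1 - a2) \<in> span (vecs y)"
      using 3 by (auto intro!: span_add span_scale intro: span_base)
    moreover have "offset y - c *\<^sub>R a2 = s 1 *\<^sub>R (a1 - a2)"
      using 3 by (simp add: p algebra_simps)
    ultimately have m: "offset y - c *\<^sub>R a2 \<in> span (vecs y)" by (simp only:)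
    have m': "a1 \<in> span {a2, a1 - a2}"
      by (rule in_span_diffD[where b = a2]) (auto intro!: span_base)
    show ?thesis unfolding T
      by (rule drops_directionI[OF _ _ _ disjI1[OF m]])
        (use 3 m' in \<open>auto simp: p intro!: span_add span_scale intro: span_base span_diff\<close>)
  qed
qed (use assms in \<open>auto simp: Let_def\<close>)

text \<open>An offset outside \<open>span W\<close> but inside \<open>span V\<close> makes the
  inclusion strict. Conversely, if the offset lies in \<open>span W\<close> and its component c
  along b is nonzero, then b itself lies there and dropping it loses nothing. For c = 0 the offset
  carries no information about b.\<close>

lemma drops_direction_dim:
  assumes "drops_direction V c W e"
  shows "dim W \<le> dim V" and "e \<notin> span W \<Longrightarrow> dim W < dim V"
    and "c \<noteq> 0 \<Longrightarrow> e \<in> span W \<Longrightarrow> dim W = dim V"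
proof -
  have sub: "span W \<subseteq> span V"
    using assms by (metis drops_direction_def span_minimal subspace_span)
  show le: "dim W \<le> dim V" using dim_subset[OF sub] by simp
  show "dim W < dim V" if "e \<notin> span W"
    using that sub assms by (intro dim_psubset) (auto simp: drops_direction_def)
  show "dim W = dim V" if c: "c \<noteq> 0" and e: "e \<in> span W"
  proof -
    obtain b where b: "V \<subseteq> span (insert b W)" "e - c *\<^sub>R b \<in> span W \<or> e + c *\<^sub>R b \<in> span W"
      using assms by (auto simp: drops_direction_def)
    have "c *\<^sub>R b \<in> span W"
      using b(2) span_diff[OF e, of "e - c *\<^sub>R b"] span_diff[OF _ e, of "e + c *\<^sub>R b"] by auto
    then have "b \<in> span W" using c span_scale[of "c *\<^sub>R b" W "1 / c"] by simp
    then have "V \<subseteq> span W" using b(1) by (simp add: span_redundant)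
    then have "dim V \<le> dim W" by (metis dim_span dim_subset)
    then show ?thesis using le by simp
  qed
qed

text \<open>\<open>D i\<close> is the dimension spanned by the vectors of the level \<open>i\<close> ancestor of \<open>x\<close>, and
  \<open>D 5 = 3\<close>: for \<open>i \<le> 3\<close> the value \<open>h\<^sub>i\<close> vanishes iff no dimension is lost at that step,
  provided that the weight \<open>w\<close> is nonzero.\<close>

definition dims_consistent :: "(nat \<Rightarrow> nat) \<Rightarrow> (nat \<Rightarrow> real) \<Rightarrow> real \<Rightarrow> nat \<Rightarrow> bool" where
  "dims_consistent D h w l \<longleftrightarrow> D 5 = 3 \<and> (l \<le> 3 \<longrightarrow> D 3 \<ge> 2) \<and>
     (\<forall>i\<in>{max 1 l..4}. h i \<ge> 0 \<and> D i \<le> D (Suc i) \<and> (h i \<noteq> 0 \<longrightarrow> D i < D (Suc i)) \<and>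
        (i \<le> 3 \<longrightarrow> w \<noteq> 0 \<longrightarrow> h i = 0 \<longrightarrow> D i = D (Suc i)))"

lemma dim_pair_ge_2:
  fixes a b :: "real^3"
  assumes "a \<noteq> 0" "b \<notin> span {a}"
  shows "dim (insert a (insert b S)) \<ge> 2"
proof -
  have "independent {b, a}" using assms by (simp add: independent_insert)
  moreover have "a \<noteq> b" using assms(2) by (auto intro: span_base)
  ultimately have "dim {b, a} = 2" by (simp add: dim_eq_card_independent)
  moreover have "dim {b, a} \<le> dim (insert a (insert b S))" by (rule dim_subset) auto
  ultimately show ?thesis by simp
qed

lemma arises_level: "arises x0 w x h \<Longrightarrow> level x \<le> level x0"
proof (induction rule: arises.induct)
  case (child w x h c y)
  then show ?case using level_children[OF child(2)] by simp
qed simp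

text \<open>The invariant speaks of \<open>pass_h x h\<close> so that the distance of
  \<open>x\<close> itself is already included, and each level adds one value to \<open>D\<close>. At
  level 4 the comparison is with the whole space: h_4 nonzero forces a proper subspace, but h_4 = 0
  only says that the offset lies in the span, which may still be a plane.\<close>

lemma arises_dims:
  assumes "arises x0 w x h" "level x0 = 4" "nondegenerate x0"
  shows "nondegenerate x \<and> (\<forall>P. x = F P \<longrightarrow> w \<noteq> 0 \<longrightarrow> P > 0) \<and>
    (\<exists>D. dims_consistent D (pass_h x h) w (level x) \<and> (level x \<noteq> 0 \<longrightarrow> D (level x) = dim (vecs x)) \<and>
      (level x = 0 \<longrightarrow> D 1 = 1))"
  using assms
proof (induction rule: arises.induct)
  case root
  obtain a1 a2 a3 a4 e where x0: "x0 = I4 a1 a2 a3 a4 e" using root by (cases x0) auto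
  define D where "D i = (if i = 5 then 3 else dim (vecs x0))" for i :: nat
  have "dim (vecs x0) \<le> 3" using dim_subset_UNIV[of "vecs x0"] by simp
  moreover have "dim (vecs x0) < 3" if "own_h x0 \<noteq> 0"
  proof -
    have "span (vecs x0) \<noteq> UNIV" using that root(1) by (auto simp: own_h_eq_0_iff)
    then show ?thesis using dim_eq_full[of "vecs x0"] \<open>dim (vecs x0) \<le> 3\<close> by auto
  qed
  ultimately have "dims_consistent D (pass_h x0 (\<lambda>_. 0)) 1 4"
    using own_h_nonneg[of x0] root(1) by (auto simp: dims_consistent_def D_def pass_h_def)
  moreover have "D 4 = dim (vecs x0)" by (simp add: D_def)
  ultimately show ?case using root by (auto simp: x0 intro!: exI[of _ D])
next
  case (child w x h c y)
  have lx: "level x = Suc (level y)" using child(2) by (rule level_children)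
  have l4: "level x \<le> 4" using arises_level[OF child(1)] child(4) by simp
  have nd: "nondegenerate x" and ndy: "nondegenerate y"
    using child nondegenerate_child by blast+
  obtain D where D: "dims_consistent D (pass_h x h) w (level x)" "D (level x) = dim (vecs x)"
    using child lx by auto
  show ?case
  proof (cases "level y = 0")
    case True
    then have "level x = 1" using lx by simp
    then obtain a e where x: "x = I1 a e" by (cases x) auto
    obtain P where y: "y = F P" using True by (cases y) auto
    have a: "a \<noteq> 0" using nd x by simp
    \<comment> \<open>In both children P is the absolute value of the coefficient c times the
      nonzero length of \<open>a\<close>.\<close>
    have "P > 0" if "w * c \<noteq> 0"
      using child(2) that a by (auto simp: x y Let_def)
    moreover have "D 1 = 1"
      using D(2) a by (simp add: x dim_eq_card_independent)
    \<comment> \<open>A terminal call has level 0, so \<open>pass_h\<close> overwrites only index 0,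
      outside the range 1 to 4 inspected by \<open>dims_consistent\<close>.\<close>
    moreover have "dims_consistent D (pass_h y (pass_h x h)) (w * c) 0"
      using D(1) by (auto simp: dims_consistent_def x y pass_h_def)
    ultimately show ?thesis by (auto simp: y)
  next
    case False
    note dd = child_drops_direction[OF child(2) False]
    define D' where "D' = D(level y := dim (vecs y))"
    have "dims_consistent D' (pass_h y (pass_h x h)) (w * c) (level y)"
      unfolding dims_consistent_def
    proof (intro conjI impI ballI)
      show "D' 5 = 3" using D(1) lx l4 by (auto simp: dims_consistent_def D'_def)
      assume "level y \<le> 3"
      show "D' 3 \<ge> 2"
      proof (cases "level y = 3")
        case True
        then obtain a b d e where "y = I3 a b d e" by (cases y) auto
        then show ?thesis using ndy dim_pair_ge_2[of a b "{d}"] by (simp add: D'_def)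
      next
        case False
        then show ?thesis using D(1) lx l4 by (auto simp: dims_consistent_def D'_def)
      qed
    next
      fix i assume i: "i \<in> {max 1 (level y)..4}"
      have *: "pass_h y (pass_h x h) i \<ge> 0 \<and> D' i \<le> D' (Suc i) \<and>
        (pass_h y (pass_h x h) i \<noteq> 0 \<longrightarrow> D' i < D' (Suc i)) \<and>
        (i \<le> 3 \<longrightarrow> w * c \<noteq> 0 \<longrightarrow> pass_h y (pass_h x h) i = 0 \<longrightarrow> D' i = D' (Suc i))"
      proof (cases "i = level y")
        case True
        have "D' (Suc i) = dim (vecs x)" using True lx D(2) by (simp add: D'_def)
        moreover have "pass_h y (pass_h x h) i = own_h y" using True by (simp add: pass_h_def)
        moreover have "D' i = dim (vecs y)" using True by (simp add: D'_def)
        ultimately show ?thesis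
          using drops_direction_dim[OF dd] own_h_eq_0_iff[OF False] own_h_nonneg[of y] by auto
      next
        case False
        then have "i \<in> {max 1 (level x)..4}" "D' i = D i" "D' (Suc i) = D (Suc i)"
          "pass_h y (pass_h x h) i = pass_h x h i"
          using i lx by (auto simp: D'_def pass_h_def)
        then show ?thesis using D(1) unfolding dims_consistent_def by auto
      qed
      then show "pass_h y (pass_h x h) i \<ge> 0" "D' i \<le> D' (Suc i)" by auto
      show "D' i < D' (Suc i)" if "pass_h y (pass_h x h) i \<noteq> 0" using * that by auto
      show "D' i = D' (Suc i)" if "i \<le> 3" "w * c \<noteq> 0" "pass_h y (pass_h x h) i = 0" using * that by auto
    qed
    moreover have "D' (level y) = dim (vecs y)" by (simp add: D'_def)
    ultimately show ?thesis using False ndy by (auto intro!: exI[of _ D'])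
  qed
qed

lemma card_zeros:
  fixes h :: "nat \<Rightarrow> real"
  shows "card {i \<in> {1..4}. h i = 0} = (if h 1 = 0 then 1 else 0) + (if h 2 = 0 then 1 else 0)
      + (if h 3 = 0 then 1 else 0) + (if h 4 = 0 then 1 else 0)"
proof -
  have "card {i \<in> {1..4}. h i = 0} = (\<Sum>i\<in>{1..4::nat}. if h i = 0 then 1 else 0)"
    by (simp only: card_eq_sum sum.inter_filter finite_atLeastAtMost)
  then show ?thesis unfolding interval_1_numeral by simp
qed

text \<open>From D 5 = 3 down to D 1 = 1 at most two steps can lose a dimension, hence at most two
  distances are nonzero. As D 3 \<ge> 2, the steps 4 and 3 cannot both lose one. For w nonzero, the
  drop from D 3 \<ge> 2 to D 1 = 1 must be visible in h_1 or h_2.\<close>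

lemma arises_F_cases:
  assumes "arises x0 w (F P) h" "level x0 = 4" "nondegenerate x0"
  shows "card {i \<in> {1..4}. h i = 0} \<ge> 2" "h 3 * h 4 = 0" "\<forall>i\<in>{1..4}. h i \<ge> 0"
    and "w \<noteq> 0 \<Longrightarrow> P > 0" "w \<noteq> 0 \<Longrightarrow> h 1 + h 2 \<noteq> 0"
proof -
  from arises_dims[OF assms] obtain D where D: "dims_consistent D h w 0" "D 1 = 1"
    and P: "w \<noteq> 0 \<longrightarrow> P > 0"
    by (auto simp: dims_consistent_def pass_h_def)
  have nn: "h 1 \<ge> 0" "h 2 \<ge> 0" "h 3 \<ge> 0" "h 4 \<ge> 0"
    and le: "D 1 \<le> D 2" "D 2 \<le> D 3" "D 3 \<le> D 4" "D 4 \<le> 3" "D 3 \<ge> 2"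
    and lt: "h 1 \<noteq> 0 \<longrightarrow> D 1 < D 2" "h 2 \<noteq> 0 \<longrightarrow> D 2 < D 3" "h 3 \<noteq> 0 \<longrightarrow> D 3 < D 4" "h 4 \<noteq> 0 \<longrightarrow> D 4 < 3"
    and eq: "w \<noteq> 0 \<longrightarrow> h 1 = 0 \<longrightarrow> D 1 = D 2" "w \<noteq> 0 \<longrightarrow> h 2 = 0 \<longrightarrow> D 2 = D 3"
  proof -
    have i: "h i \<ge> 0 \<and> D i \<le> D (Suc i) \<and> (h i \<noteq> 0 \<longrightarrow> D i < D (Suc i)) \<and>
        (i \<le> 3 \<longrightarrow> w \<noteq> 0 \<longrightarrow> h i = 0 \<longrightarrow> D i = D (Suc i))" if "i \<in> {1..4}" for i
      using D(1) that by (auto simp: dims_consistent_def)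
    have D5: "D 5 = 3" "D 3 \<ge> 2" using D(1) by (auto simp: dims_consistent_def)
    have "h 1 \<ge> 0 \<and> D 1 \<le> D 2 \<and> (h 1 \<noteq> 0 \<longrightarrow> D 1 < D 2) \<and> (w \<noteq> 0 \<longrightarrow> h 1 = 0 \<longrightarrow> D 1 = D 2)"
      using i[of 1] by (simp add: numeral_2_eq_2)
    with i[of 2] i[of 3] i[of 4] D5
    show "h 1 \<ge> 0" "h 2 \<ge> 0" "h 3 \<ge> 0" "h 4 \<ge> 0"
      "D 1 \<le> D 2" "D 2 \<le> D 3" "D 3 \<le> D 4" "D 4 \<le> 3" "D 3 \<ge> 2"
      "h 1 \<noteq> 0 \<longrightarrow> D 1 < D 2" "h 2 \<noteq> 0 \<longrightarrow> D 2 < D 3" "h 3 \<noteq> 0 \<longrightarrow> D 3 < D 4" "h 4 \<noteq> 0 \<longrightarrow> D 4 < 3"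
      "w \<noteq> 0 \<longrightarrow> h 1 = 0 \<longrightarrow> D 1 = D 2" "w \<noteq> 0 \<longrightarrow> h 2 = 0 \<longrightarrow> D 2 = D 3"
      by simp_all
  qed
  show "\<forall>i\<in>{1..4}. h i \<ge> 0" using nn unfolding interval_1_numeral by simp
  show "h 3 * h 4 = 0" using lt(3,4) le(5) by auto
  show "w \<noteq> 0 \<Longrightarrow> P > 0" using P by simp
  show "h 1 + h 2 \<noteq> 0" if "w \<noteq> 0"
  proof
    assume "h 1 + h 2 = 0"
    then have "h 1 = 0" "h 2 = 0" using nn(1,2) by linarith+
    then show False using eq that le(5) D(2) by simp
  qed
  have "2 \<le> (if h 1 = 0 then 1 else 0) + (if h 2 = 0 then 1 else 0)
      + (if h 3 = 0 then 1 else 0) + (if h 4 = 0 then 1 else 0 :: nat)"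
    using lt le D(2) by (cases "h 1 = 0"; cases "h 2 = 0"; cases "h 3 = 0"; cases "h 4 = 0"; simp)
  then show "card {i \<in> {1..4}. h i = 0} \<ge> 2" by (simp only: card_zeros)
qed

lemma seven_cases:
  fixes h :: "nat \<Rightarrow> real"
  assumes "card {i \<in> {1..4}. h i = 0} \<ge> 2" "h 3 * h 4 = 0" "h 1 + h 2 \<noteq> 0"
  shows "(h 4 = 0 \<and> h 3 = 0 \<and> h 2 = 0 \<and> h 1 \<noteq> 0) \<or>
         (h 4 = 0 \<and> h 3 = 0 \<and> h 1 = 0 \<and> h 2 \<noteq> 0) \<or>
         (h 4 = 0 \<and> h 3 = 0 \<and> h 2 \<noteq> 0 \<and> h 1 \<noteq> 0) \<or>
         (h 4 = 0 \<and> h 2 = 0 \<and> h 3 \<noteq> 0 \<and> h 1 \<noteq> 0) \<or>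
         (h 4 = 0 \<and> h 1 = 0 \<and> h 3 \<noteq> 0 \<and> h 2 \<noteq> 0) \<or>
         (h 3 = 0 \<and> h 2 = 0 \<and> h 4 \<noteq> 0 \<and> h 1 \<noteq> 0) \<or>
         (h 3 = 0 \<and> h 1 = 0 \<and> h 4 \<noteq> 0 \<and> h 2 \<noteq> 0)"
  using assms unfolding card_zeros
  by (cases "h 1 = 0"; cases "h 2 = 0"; cases "h 3 = 0"; cases "h 4 = 0"; simp)

section \<open>Passing to the limit along the recursion\<close>

lemma kern_cong: "k \<le> 4 \<Longrightarrow> (\<And>i. i > 4 - k \<Longrightarrow> h i = h' i) \<Longrightarrow> kern n h k = kern n h' k"
proof (induction k)
  case (Suc k)
  then have "kern n h k = kern n h' k" "h (4 - k) = h' (4 - k)" by (auto intro: Suc)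
  then show ?case by simp
qed simp

lemma tendsto_sum_list_map:
  fixes f :: "nat \<Rightarrow> 'a \<Rightarrow> real"
  assumes "\<And>x. x \<in> set xs \<Longrightarrow> (\<lambda>n. f n x) \<longlonglongrightarrow> g x"
  shows "(\<lambda>n. \<Sum>x\<leftarrow>xs. f n x) \<longlonglongrightarrow> (\<Sum>x\<leftarrow>xs. g x)"
  using assms by (induction xs) (auto intro: tendsto_add)

text \<open>A call is a finite combination of its children, for the regularised integrals by
  \<open>expr_int_step\<close> and for \<open>val\<close> by definition, so limits pass upwards from
  the terminal calls. The weight is carried along because the seven cases and P > 0 are guaranteed
  only where it is nonzero.\<close>

lemma expr_int_tendsto_val:
  assumes "arises x0 w x h" "level x0 = 4" "nondegenerate x0" "w \<noteq> 0"
  shows "(\<lambda>n. expr_int (kern n h (4 - level x)) x) \<longlonglongrightarrow> val x h"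
  using assms(1,4)
proof (induction "level x" arbitrary: x w h)
  case 0
  then obtain P where x: "x = F P" by (cases x) auto
  note c = arises_F_cases[OF 0(2)[unfolded x] assms(2,3)]
  have "(\<lambda>n. kern n h 4 (P\<^sup>2)) \<longlonglongrightarrow> F1 P (h 1) (h 2) (h 3) (h 4)"
    by (rule kern_tendsto_F1[OF _ _ _ _ c(4)[OF 0(3)] seven_cases[OF c(1,2) c(5)[OF 0(3)]]])
      (use c(3) in auto)
  then show ?case by (simp add: x val.simps[of "F P"])
next
  case (Suc l)
  have l4: "level x \<le> 4" using arises_level[OF Suc(3)] assms(2) by simp
  have k: "4 - l = Suc (4 - level x)" "4 - (4 - level x) = level x" using Suc(2) l4 by auto
  have step: "expr_int (kern n h (4 - level x)) x =
      (\<Sum>(c, y)\<leftarrow>children x. c * expr_int (kern n (pass_h x h) (4 - l)) y)" for n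
  proof -
    obtain K' where "c1_kernel (kern n h (4 - level x)) K'"
      using c1_kern[of "4 - level x" n h] by auto
    from expr_int_step[OF this] Suc(2)
    have "expr_int (kern n h (4 - level x)) x = (\<Sum>(c, y)\<leftarrow>children x.
        c * expr_int (next_kernel (level x) (own_h x) (kern n h (4 - level x))) y)"
      by simp
    moreover have "kern n (pass_h x h) (4 - level x) = kern n h (4 - level x)"
      by (rule kern_cong) (use l4 in \<open>auto simp: pass_h_def\<close>)
    then have "kern n (pass_h x h) (4 - l) = next_kernel (level x) (own_h x) (kern n h (4 - level x))"
      unfolding k kern.simps by (simp add: k pass_h_def)
    ultimately show ?thesis by simp
  qed
  have "val x h = (\<Sum>(c, y)\<leftarrow>children x. c * val y (pass_h x h))"
    using Suc(2) by (cases x; subst val.simps) simp_all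
  moreover have "(\<lambda>n. \<Sum>(c, y)\<leftarrow>children x. c * expr_int (kern n (pass_h x h) (4 - l)) y)
      \<longlonglongrightarrow> (\<Sum>(c, y)\<leftarrow>children x. c * val y (pass_h x h))"
  proof (rule tendsto_sum_list_map)
    fix z assume "z \<in> set (children x)"
    moreover obtain c y where "z = (c, y)" by (cases z)
    ultimately have z: "z = (c, y)" "(c, y) \<in> set (children x)" by simp_all
    have ly: "l = level y" using level_children[OF z(2)] Suc(2) by simp
    have "(\<lambda>n. c * expr_int (kern n (pass_h x h) (4 - l)) y) \<longlonglongrightarrow> c * val y (pass_h x h)"
    \<comment> \<open>For c = 0 the child may lie on a branch without a usable limit, but both sides
      are 0 whatever \<open>val\<close> returns there.\<close>
    proof (cases "c = 0")
      case False
      have "(\<lambda>n. expr_int (kern n (pass_h x h) (4 - level y)) y) \<longlonglongrightarrow> val y (pass_h x h)"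
        by (rule Suc(1)[OF ly arises.child[OF Suc(3) z(2)]]) (use False Suc(4) in auto)
      then show ?thesis unfolding ly by (rule tendsto_mult_left)
    qed simp
    then show "(\<lambda>n. case z of (c, y) \<Rightarrow> c * expr_int (kern n (pass_h x h) (4 - l)) y)
        \<longlonglongrightarrow> (case z of (c, y) \<Rightarrow> c * val y (pass_h x h))"
      by (simp add: z)
  qed
  ultimately show ?case unfolding step by simp
qed

section \<open>The surface integrals\<close>

lemma not_collinear_imp_indep:
  assumes "\<not> collinear {p1, p2, p3 :: real^3}"
  shows "p2 - p1 \<noteq> 0" "p3 - p1 \<notin> span {p2 - p1}"
proof -
  have "\<not> collinear {0, p2 - p1, p3 - p1}"
    using assms collinear_3[of p2 p1 p3] by (simp add: insert_commute)
  then show "p2 - p1 \<noteq> 0" "p3 - p1 \<notin> span {p2 - p1}"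
    by (auto simp: collinear_lemma span_singleton)
qed

section \<open>The area measure of a plane in affine coordinates\<close>

lemma plane_param_eq: "plane_param p1 p2 p3 p = p1 + fst p *\<^sub>R (p2 - p1) + snd p *\<^sub>R (p3 - p1)"
  by (simp add: plane_param_def case_prod_beta)

lemma continuous_plane_param: "continuous_on A (plane_param p1 p2 p3)"
  unfolding plane_param_eq[abs_def] by (intro continuous_intros)

lemma measurable_plane_param [measurable]: "plane_param p1 p2 p3 \<in> borel_measurable borel"
  by (intro borel_measurable_continuous_onI continuous_plane_param)

text \<open>The parametrisation is affine, so its area element is constant.\<close>

lemma plane_measure_eq:
  "plane_measure p1 p2 p3 =
    distr (density lborel (\<lambda>_. ennreal (norm (cross3 (p2 - p1) (p3 - p1))))) borel (plane_param p1 p2 p3)"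
proof -
  have "(plane_param p1 p2 p3 has_derivative (\<lambda>q. fst q *\<^sub>R (p2 - p1) + snd q *\<^sub>R (p3 - p1))) (at p)" for p
    unfolding plane_param_eq[abs_def] by (auto intro!: derivative_eq_intros)
  then have "frechet_derivative (plane_param p1 p2 p3) (at p) = (\<lambda>q. fst q *\<^sub>R (p2 - p1) + snd q *\<^sub>R (p3 - p1))" for p
    by (rule frechet_derivative_at[symmetric])
  then show ?thesis by (simp add: plane_measure_def surface_measure_def)
qed

lemma sets_plane_measure [simp, measurable_cong]: "sets (plane_measure p1 p2 p3) = sets borel"
  by (simp add: plane_measure_eq)

lemma space_plane_measure [simp]: "space (plane_measure p1 p2 p3) = UNIV"
  by (simp add: plane_measure_eq)

lemma nn_integral_plane_measure:
  assumes [measurable]: "f \<in> borel_measurable borel"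
  shows "(\<integral>\<^sup>+x. f x \<partial>plane_measure p1 p2 p3) =
    ennreal (norm (cross3 (p2 - p1) (p3 - p1))) * (\<integral>\<^sup>+p. f (plane_param p1 p2 p3 p) \<partial>lborel)"
  unfolding plane_measure_eq
  by (simp add: nn_integral_distr nn_integral_density nn_integral_cmult)

lemma inj_plane_param:
  assumes "\<not> collinear {p1, p2, p3}"
  shows "inj (plane_param p1 p2 p3)"
proof (rule injI)
  fix p q assume eq: "plane_param p1 p2 p3 p = plane_param p1 p2 p3 q"
  define a b where "a = p2 - p1" and "b = p3 - p1"
  have ab: "a \<noteq> 0" "b \<notin> span {a}"
    using not_collinear_imp_indep[OF assms] by (auto simp: a_def b_def)
  have *: "(snd p - snd q) *\<^sub>R b = (fst q - fst p) *\<^sub>R a"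
    using eq by (simp add: plane_param_eq a_def[symmetric] b_def[symmetric] algebra_simps)
  have "snd p = snd q"
  proof (rule ccontr)
    assume n: "snd p \<noteq> snd q"
    have "(snd p - snd q) *\<^sub>R b \<in> span {a}" unfolding * by (intro span_scale span_base) simp
    then have "(1 / (snd p - snd q)) *\<^sub>R (snd p - snd q) *\<^sub>R b \<in> span {a}" by (rule span_scale)
    then show False using n ab by simp
  qed
  moreover from this have "fst p = fst q" using * ab by simp
  ultimately show "p = q" by (simp add: prod_eq_iff)
qed

lemma flat_triangle_eq: "flat_triangle p1 p2 p3 = plane_param p1 p2 p3 ` std_tri"
  unfolding flat_triangle_def convex_hull_3_alt std_tri_def plane_param_eq[abs_def] by force

lemma compact_flat_triangle: "compact (flat_triangle p1 p2 p3)"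
  unfolding flat_triangle_eq by (intro compact_continuous_image compact_std_tri continuous_plane_param)

lemma borel_flat_triangle [measurable]: "flat_triangle p1 p2 p3 \<in> sets borel"
  using compact_flat_triangle by (intro borel_closed compact_imp_closed)

lemma plane_param_in_flat_triangle:
  assumes "\<not> collinear {p1, p2, p3}"
  shows "plane_param p1 p2 p3 p \<in> flat_triangle p1 p2 p3 \<longleftrightarrow> p \<in> std_tri"
  unfolding flat_triangle_eq using inj_plane_param[OF assms] by (simp add: inj_image_mem_iff)

lemma triangle_area_eq:
  assumes "\<not> collinear {p1, p2, p3}"
  shows "triangle_area p1 p2 p3 = norm (cross3 (p2 - p1) (p3 - p1)) / 2"
proof -
  have [measurable]: "std_tri \<in> sets borel"
    using compact_std_tri by (intro borel_closed compact_imp_closed)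
  let ?X = "plane_measure p1 p2 p3" and ?c = "norm (cross3 (p2 - p1) (p3 - p1))"
  have "emeasure ?X (flat_triangle p1 p2 p3) = (\<integral>\<^sup>+x. indicator (flat_triangle p1 p2 p3) x \<partial>?X)"
    by simp
  also have "\<dots> = ennreal ?c * (\<integral>\<^sup>+p. indicator (flat_triangle p1 p2 p3) (plane_param p1 p2 p3 p) \<partial>lborel)"
    by (rule nn_integral_plane_measure) measurable
  also have "(\<lambda>p. indicator (flat_triangle p1 p2 p3) (plane_param p1 p2 p3 p)) = (indicator std_tri :: _ \<Rightarrow> ennreal)"
    using plane_param_in_flat_triangle[OF assms] by (auto simp: indicator_def)
  also have "(\<integral>\<^sup>+p. indicator std_tri p \<partial>lborel) = ennreal (1 / 2)"
    unfolding nn_integral_indicator[OF \<open>std_tri \<in> sets borel\<close>[folded sets_lborel]] by (rule emeasure_std_tri)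
  also have "ennreal ?c * ennreal (1 / 2) = ennreal (?c * (1 / 2))"
    by (rule ennreal_mult[symmetric]) auto
  finally show ?thesis
    unfolding triangle_area_def measure_def by (simp only:) simp
qed

text \<open>Needed for Fubini on the product of the two planes. The images of balls have finite
  measure because injectivity makes the preimage of such an image the ball itself, and the
  complement of the plane has measure 0.\<close>

lemma sigma_finite_plane_measure:
  assumes "\<not> collinear {p1, p2, p3}"
  shows "sigma_finite_measure (plane_measure p1 p2 p3)"
proof
  let ?r = "plane_param p1 p2 p3" and ?X = "plane_measure p1 p2 p3"
  let ?B = "\<lambda>n::nat. ?r ` cball 0 (real n)"
  have closed: "closed (?B n)" for n
    by (intro compact_imp_closed compact_continuous_image continuous_plane_param compact_cball)
  have "?B n \<in> sets borel" for n using closed by (rule borel_closed)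
  then have [measurable]: "?B n \<in> sets borel" "range ?r \<in> sets borel" for n
  proof -
    have "(\<Union>n. cball 0 (real n)) = (UNIV :: (real \<times> real) set)"
      by (auto simp: real_arch_simple)
    then have "range ?r = (\<Union>n. ?B n)" by (metis image_UN)
    then show "range ?r \<in> sets borel" using \<open>\<And>n. ?B n \<in> sets borel\<close> by auto
  qed auto
  have cover: "(\<Union>n. ?B n) = range ?r"
  proof -
    have "(\<Union>n. cball 0 (real n)) = (UNIV :: (real \<times> real) set)"
      by (auto simp: real_arch_simple)
    then show ?thesis by (metis image_UN)
  qed
  have em: "emeasure ?X A = ennreal (norm (cross3 (p2 - p1) (p3 - p1))) * emeasure lborel (?r -` A)"
    if [measurable]: "A \<in> sets borel" for A
  proof -
    have "emeasure ?X A = (\<integral>\<^sup>+x. indicator A x \<partial>?X)" by simp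
    also have "\<dots> = ennreal (norm (cross3 (p2 - p1) (p3 - p1))) * (\<integral>\<^sup>+p. indicator A (?r p) \<partial>lborel)"
      by (rule nn_integral_plane_measure) measurable
    also have "(\<lambda>p. indicator A (?r p) :: ennreal) = indicator (?r -` A)"
      by (auto simp: indicator_def)
    also have "(\<integral>\<^sup>+p. indicator (?r -` A) p \<partial>lborel) = emeasure lborel (?r -` A)"
      using measurable_sets_borel[OF measurable_plane_param that] by simp
    finally show ?thesis .
  qed
  have "emeasure ?X (?B n) \<noteq> \<infinity>" for n
    using inj_plane_param[OF assms] emeasure_lborel_cball_finite[of "0 :: real \<times> real" "real n"]
    by (simp add: em inj_vimage_image_eq ennreal_mult_eq_top_iff)
  moreover have "emeasure ?X (- range ?r) \<noteq> \<infinity>"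
  proof -
    have "?r -` (- range ?r) = {}" by auto
    moreover have "- range ?r \<in> sets borel" by measurable
    ultimately show ?thesis by (simp only: em) simp
  qed
  ultimately show "\<exists>A. countable A \<and> A \<subseteq> sets ?X \<and> \<Union>A = space ?X \<and> (\<forall>a\<in>A. emeasure ?X a \<noteq> \<infinity>)"
    using cover by (intro exI[of _ "insert (- range ?r) (range ?B)"]) auto
qed

section \<open>Monotone convergence to the singular integrand\<close>

lemma base_kernel_nonneg: "t \<ge> 0 \<Longrightarrow> base_kernel n t \<ge> 0"
  by (simp add: base_kernel_def)

lemma base_kernel_mono: "t \<ge> 0 \<Longrightarrow> m \<le> n \<Longrightarrow> base_kernel m t \<le> base_kernel n t"
proof -
  assume t: "t \<ge> 0" and mn: "m \<le> n"
  have pos: "t + (1 / real (Suc k))\<^sup>2 > 0" for k using t by (simp add: add_nonneg_pos)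
  have "1 / real (Suc n) \<le> 1 / real (Suc m)" using mn by (simp add: frac_le)
  then show ?thesis
    unfolding base_kernel_def using pos[of m] pos[of n] mn
    by (intro divide_left_mono real_sqrt_le_mono add_left_mono power_mono mult_pos_pos) auto
qed

text \<open>The regularised kernels increase to \<open>1 / |w|\<close>, also at the singularity \<open>w = 0\<close>.\<close>

definition coulomb :: "real^3 \<Rightarrow> ennreal" where
  "coulomb w = (if w = 0 then \<infinity> else ennreal (1 / norm w))"

lemma base_kernel_tendsto_coulomb:
  "(\<lambda>n. ennreal (base_kernel n (w \<bullet> w))) \<longlonglongrightarrow> coulomb w"
proof (cases "w = 0")
  case True
  have "base_kernel n (w \<bullet> w) = real (Suc n)" for n
    using True by (simp add: base_kernel_def)
  moreover have "(\<lambda>n. ennreal (real (Suc n))) \<longlonglongrightarrow> \<infinity>"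
    using LIMSEQ_Suc[OF of_nat_tendsto_top_ennreal] by (simp only: ennreal_of_nat_eq_real_of_nat infinity_ennreal_def)
  ultimately show ?thesis using True by (simp add: coulomb_def)
next
  case False
  have "(\<lambda>n. base_kernel n (w \<bullet> w)) \<longlonglongrightarrow> 1 / sqrt (w \<bullet> w)"
    using approximates_base_kernel False by (simp add: approximates_def)
  then show ?thesis using False by (simp add: coulomb_def norm_eq_sqrt_inner)
qed

lemma measurable_coulomb [measurable]: "coulomb \<in> borel_measurable borel"
  unfolding coulomb_def by measurable

text \<open>With the value infinity on the singular set the regularised integrands increase to the
  limit at every point. Nonnegativity is recorded because \<open>ennreal\<close> sends negative
  reals to 0, and the real value has to be recovered.\<close>

theorem nn_integral_coulomb:
  fixes w :: "(real \<times> real) \<times> (real \<times> real) \<Rightarrow> real^3"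
  assumes nd: "nondegenerate (I4 a1 a2 a3 a4 e)"
    and w: "\<And>p. w p = e + fst (fst p) *\<^sub>R a1 + snd (fst p) *\<^sub>R a2 + fst (snd p) *\<^sub>R a3 + snd (snd p) *\<^sub>R a4"
  shows "(\<integral>\<^sup>+p. indicator (std_tri \<times> std_tri) p * coulomb (w p) \<partial>lborel) = ennreal (I4_val a1 a2 a3 a4 e)"
    and "I4_val a1 a2 a3 a4 e \<ge> 0"
proof -
  let ?x = "I4 a1 a2 a3 a4 e" and ?B = "std_tri \<times> std_tri"
  have "compact ?B" by (intro compact_Times compact_std_tri)
  then have [measurable]: "?B \<in> sets borel" by (intro borel_closed compact_imp_closed)
  have cw: "continuous_on A w" for A unfolding w by (intro continuous_intros)
  have ck: "continuous_on A (\<lambda>p. base_kernel n (w p \<bullet> w p))" for A n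
    using continuous_kern[of 0 n] cw by (intro continuous_on_kernel_radial) auto
  have [measurable]: "w \<in> borel_measurable borel" "(\<lambda>p. base_kernel n (w p \<bullet> w p)) \<in> borel_measurable borel" for n
    by (intro borel_measurable_continuous_onI cw ck)+
  let ?G = "\<lambda>n p. ennreal (indicator ?B p *\<^sub>R base_kernel n (w p \<bullet> w p))"
  have G: "(\<integral>\<^sup>+p. ?G n p \<partial>lborel) = ennreal (expr_int (base_kernel n) ?x)" for n
  proof -
    have "integrable lborel (\<lambda>p. indicator ?B p *\<^sub>R base_kernel n (w p \<bullet> w p))"
      using \<open>compact ?B\<close> ck by (rule borel_integrable_compact)
    then have "(\<integral>\<^sup>+p. ?G n p \<partial>lborel) = ennreal (lint ?B (\<lambda>p. base_kernel n (w p \<bullet> w p)))"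
      unfolding set_lebesgue_integral_def
      by (rule nn_integral_eq_integral) (simp add: base_kernel_nonneg)
    then show ?thesis by (simp add: Let_def w)
  qed
  have "(\<lambda>n. expr_int (kern n (\<lambda>_. 0) (4 - level ?x)) ?x) \<longlonglongrightarrow> val ?x (\<lambda>_. 0)"
    by (rule expr_int_tendsto_val[OF arises.root]) (use nd in auto)
  then have lim: "(\<lambda>n. expr_int (base_kernel n) ?x) \<longlonglongrightarrow> I4_val a1 a2 a3 a4 e"
    by (simp add: I4_val_def)
  have "(\<lambda>n. \<integral>\<^sup>+p. ?G n p \<partial>lborel) \<longlonglongrightarrow> (\<integral>\<^sup>+p. indicator ?B p * coulomb (w p) \<partial>lborel)"
  proof (rule nn_integral_LIMSEQ)
    show "incseq ?G"
      by (intro incseq_SucI le_funI ennreal_leI) (auto simp: indicator_def intro: base_kernel_mono)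
    show "(\<lambda>n. ?G n p) \<longlonglongrightarrow> indicator ?B p * coulomb (w p)" for p
      using base_kernel_tendsto_coulomb[of "w p"] by (auto simp: indicator_def)
  qed measurable
  then have "(\<lambda>n. ennreal (expr_int (base_kernel n) ?x)) \<longlonglongrightarrow> (\<integral>\<^sup>+p. indicator ?B p * coulomb (w p) \<partial>lborel)"
    by (simp only: G)
  then show "(\<integral>\<^sup>+p. indicator ?B p * coulomb (w p) \<partial>lborel) = ennreal (I4_val a1 a2 a3 a4 e)"
    using tendsto_ennrealI[OF lim] LIMSEQ_unique by blast
  have "expr_int (base_kernel n) ?x \<ge> 0" for n
    unfolding expr_int.simps set_lebesgue_integral_def Let_def
    by (intro integral_nonneg_AE) (auto simp: indicator_def base_kernel_nonneg)
  then show "I4_val a1 a2 a3 a4 e \<ge> 0" using lim by (intro LIMSEQ_le_const) auto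
qed

theorem mainTheorem1:
  fixes x1 x2 x3 y1 y2 y3 :: "real^3"
  assumes "\<not> collinear {x1, x2, x3}" and "\<not> collinear {y1, y2, y3}"
  shows
    "set_integrable (plane_measure y1 y2 y3 \<Otimes>\<^sub>M plane_measure x1 x2 x3)
       (flat_triangle y1 y2 y3 \<times> flat_triangle x1 x2 x3) (\<lambda>(y, x). 1 / norm (x - y)) \<and>
     (LINT y:flat_triangle y1 y2 y3|plane_measure y1 y2 y3.
        LINT x:flat_triangle x1 x2 x3|plane_measure x1 x2 x3. 1 / norm (x - y))
     = 4 * triangle_area x1 x2 x3 * triangle_area y1 y2 y3 *
       I4_val (x2 - x1) (x3 - x1) (- (y2 - y1)) (- (y3 - y1)) (x1 - y1) \<and>
     (\<forall>w P h.
       arises (I4 (x2 - x1) (x3 - x1) (- (y2 - y1)) (- (y3 - y1)) (x1 - y1)) w (F P) h \<longrightarrow>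
         card {i \<in> {1..4}. h i = 0} \<ge> 2 \<and>
         h 3 * h 4 = 0 \<and>
         (w \<noteq> 0 \<longrightarrow>
            h 1 + h 2 \<noteq> 0 \<and>
            ((h 4 = 0 \<and> h 3 = 0 \<and> h 2 = 0 \<and> h 1 \<noteq> 0) \<or>
             (h 4 = 0 \<and> h 3 = 0 \<and> h 1 = 0 \<and> h 2 \<noteq> 0) \<or>
             (h 4 = 0 \<and> h 3 = 0 \<and> h 2 \<noteq> 0 \<and> h 1 \<noteq> 0) \<or>
             (h 4 = 0 \<and> h 2 = 0 \<and> h 3 \<noteq> 0 \<and> h 1 \<noteq> 0) \<or>
             (h 4 = 0 \<and> h 1 = 0 \<and> h 3 \<noteq> 0 \<and> h 2 \<noteq> 0) \<or>
             (h 3 = 0 \<and> h 2 = 0 \<and> h 4 \<noteq> 0 \<and> h 1 \<noteq> 0) \<or>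
             (h 3 = 0 \<and> h 1 = 0 \<and> h 4 \<noteq> 0 \<and> h 2 \<noteq> 0))))"
proof -
  let ?X = "plane_measure x1 x2 x3" and ?Y = "plane_measure y1 y2 y3"
  let ?tx = "flat_triangle x1 x2 x3" and ?ty = "flat_triangle y1 y2 y3"
  let ?rx = "plane_param x1 x2 x3" and ?ry = "plane_param y1 y2 y3"
  let ?cx = "norm (cross3 (x2 - x1) (x3 - x1))" and ?cy = "norm (cross3 (y2 - y1) (y3 - y1))"
  let ?x0 = "I4 (x2 - x1) (x3 - x1) (- (y2 - y1)) (- (y3 - y1)) (x1 - y1)"
  define I where "I = I4_val (x2 - x1) (x3 - x1) (- (y2 - y1)) (- (y3 - y1)) (x1 - y1)"
  define g where "g z = indicator (?ty \<times> ?tx) z *\<^sub>R (case z of (y, x) \<Rightarrow> 1 / norm (x - y))" for z :: "(real^3) \<times> (real^3)"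
  interpret X: sigma_finite_measure ?X by (rule sigma_finite_plane_measure[OF assms(1)])
  interpret Y: sigma_finite_measure ?Y by (rule sigma_finite_plane_measure[OF assms(2)])
  interpret YX: pair_sigma_finite ?Y ?X ..
  have nd: "nondegenerate ?x0"
  proof -
    have neg: "b \<in> span {a}" if ab: "- b \<in> span {- a}" for a b :: "real^3"
    proof -
      obtain k where "- b = k *\<^sub>R - a" using ab unfolding span_singleton by blast
      then have "b = k *\<^sub>R a" by simp
      then show ?thesis by (auto simp: span_singleton)
    qed
    show ?thesis
      using not_collinear_imp_indep[OF assms(1)] not_collinear_imp_indep[OF assms(2)]
        neg[of "y3 - y1" "y2 - y1"] by auto
  qed
  have [measurable]: "std_tri \<times> std_tri \<in> sets borel"
    by (intro borel_closed compact_imp_closed compact_Times compact_std_tri)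
  have [measurable]: "g \<in> borel_measurable (?Y \<Otimes>\<^sub>M ?X)"
    unfolding g_def by measurable
  have g_nonneg: "g z \<ge> 0" for z by (auto simp: g_def split: prod.split)
  define w where "w p = ?rx (fst p) - ?ry (snd p)" for p
  have w: "w p = (x1 - y1) + fst (fst p) *\<^sub>R (x2 - x1) + snd (fst p) *\<^sub>R (x3 - x1)
      + fst (snd p) *\<^sub>R - (y2 - y1) + snd (snd p) *\<^sub>R - (y3 - y1)" for p
    by (simp add: w_def plane_param_eq algebra_simps)
  note cb = nn_integral_coulomb[OF nd w, folded I_def]
  have [measurable]: "w \<in> borel_measurable borel"
    unfolding w by (intro borel_measurable_continuous_onI continuous_intros)
  let ?G = "\<lambda>p. indicator (std_tri \<times> std_tri) p * coulomb (w p)"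
  have "(\<integral>\<^sup>+z. ennreal (g z) \<partial>(?Y \<Otimes>\<^sub>M ?X)) = (\<integral>\<^sup>+y. (\<integral>\<^sup>+x. ennreal (g (y, x)) \<partial>?X) \<partial>?Y)"
    by (rule X.nn_integral_fst[symmetric]) measurable
  also have "\<dots> = (\<integral>\<^sup>+y. ennreal ?cx * (\<integral>\<^sup>+u. ennreal (g (y, ?rx u)) \<partial>lborel) \<partial>?Y)"
    by (intro nn_integral_cong nn_integral_plane_measure) measurable
  also have "\<dots> = ennreal ?cy * (\<integral>\<^sup>+v. ennreal ?cx * (\<integral>\<^sup>+u. ennreal (g (?ry v, ?rx u)) \<partial>lborel) \<partial>lborel)"
    by (rule nn_integral_plane_measure) measurable
  also have "\<dots> = ennreal ?cy * (ennreal ?cx * (\<integral>\<^sup>+v. (\<integral>\<^sup>+u. ennreal (g (?ry v, ?rx u)) \<partial>lborel) \<partial>lborel))"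
    by (subst nn_integral_cmult) measurable
  also have "(\<integral>\<^sup>+v. (\<integral>\<^sup>+u. ennreal (g (?ry v, ?rx u)) \<partial>lborel) \<partial>lborel)
      = (\<integral>\<^sup>+v. (\<integral>\<^sup>+u. ?G (u, v) \<partial>lborel) \<partial>lborel)"
  \<comment> \<open>Where x = y the real integrand is 0, by division by zero, while
    \<open>coulomb\<close> is infinite. For fixed v injectivity leaves at most one such u, a null
    set.\<close>
  proof (rule nn_integral_cong, rule nn_integral_cong_AE)
    fix v
    have "finite (?rx -` {?ry v})"
      by (intro finite_vimageI inj_plane_param[OF assms(1)]) simp
    then have "AE u in lborel. u \<notin> ?rx -` {?ry v}"
      by (intro AE_not_in finite_imp_null_set_lborel)
    then show "AE u in lborel. ennreal (g (?ry v, ?rx u)) = ?G (u, v)"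
    proof eventually_elim
      case (elim u)
      then have "w (u, v) \<noteq> 0" by (simp add: w_def)
      then show ?case
        using plane_param_in_flat_triangle[OF assms(1)] plane_param_in_flat_triangle[OF assms(2)]
        by (auto simp: g_def coulomb_def indicator_def w_def)
    qed
  qed
  also have "\<dots> = (\<integral>\<^sup>+p. ?G p \<partial>(lborel \<Otimes>\<^sub>M lborel))"
    by (rule lborel_pair.nn_integral_snd) (unfold lborel_prod, measurable)
  also have "\<dots> = ennreal I" using cb(1) by (simp add: lborel_prod)
  also have "ennreal ?cy * (ennreal ?cx * ennreal I) = ennreal (?cx * ?cy * I)"
    using cb(2) by (simp add: ennreal_mult mult_ac)
  finally have nn: "(\<integral>\<^sup>+z. ennreal (g z) \<partial>(?Y \<Otimes>\<^sub>M ?X)) = ennreal (?cx * ?cy * I)" .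
  have int: "integrable (?Y \<Otimes>\<^sub>M ?X) g"
    by (rule integrableI_nonneg) (use nn g_nonneg in auto)
  have "integral\<^sup>L (?Y \<Otimes>\<^sub>M ?X) g = ?cx * ?cy * I"
    using cb(2) nn by (subst integral_eq_nn_integral) (auto simp: g_nonneg)
  moreover have "integral\<^sup>L (?Y \<Otimes>\<^sub>M ?X) g = (\<integral>y. (\<integral>x. g (y, x) \<partial>?X) \<partial>?Y)"
    by (rule YX.integral_fst'[OF int, symmetric])
  moreover have "(\<integral>x. g (y, x) \<partial>?X) = indicator ?ty y *\<^sub>R (LINT x:?tx|?X. 1 / norm (x - y))" for y
    unfolding set_lebesgue_integral_def g_def by (auto simp: indicator_def of_bool_def)
  ultimately have "(LINT y:?ty|?Y. LINT x:?tx|?X. 1 / norm (x - y)) = ?cx * ?cy * I"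
    unfolding set_lebesgue_integral_def by simp
  moreover have "set_integrable (?Y \<Otimes>\<^sub>M ?X) (?ty \<times> ?tx) (\<lambda>(y, x). 1 / norm (x - y))"
    using int unfolding set_integrable_def g_def .
  \<comment> \<open>Each cross product has twice the area of its triangle as norm, whence the factor
    4.\<close>
  moreover have "?cx * ?cy * I = 4 * triangle_area x1 x2 x3 * triangle_area y1 y2 y3 * I"
    by (simp add: triangle_area_eq assms)
  ultimately have "set_integrable (?Y \<Otimes>\<^sub>M ?X) (?ty \<times> ?tx) (\<lambda>(y, x). 1 / norm (x - y))"
    and "(LINT y:?ty|?Y. LINT x:?tx|?X. 1 / norm (x - y)) =
      4 * triangle_area x1 x2 x3 * triangle_area y1 y2 y3 * I"
    by simp_all
  moreover have "card {i \<in> {1..4}. h i = 0} \<ge> 2 \<and> h 3 * h 4 = 0 \<and> (w \<noteq> 0 \<longrightarrow> h 1 + h 2 \<noteq> 0 \<and>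
            ((h 4 = 0 \<and> h 3 = 0 \<and> h 2 = 0 \<and> h 1 \<noteq> 0) \<or>
             (h 4 = 0 \<and> h 3 = 0 \<and> h 1 = 0 \<and> h 2 \<noteq> 0) \<or>
             (h 4 = 0 \<and> h 3 = 0 \<and> h 2 \<noteq> 0 \<and> h 1 \<noteq> 0) \<or>
             (h 4 = 0 \<and> h 2 = 0 \<and> h 3 \<noteq> 0 \<and> h 1 \<noteq> 0) \<or>
             (h 4 = 0 \<and> h 1 = 0 \<and> h 3 \<noteq> 0 \<and> h 2 \<noteq> 0) \<or>
             (h 3 = 0 \<and> h 2 = 0 \<and> h 4 \<noteq> 0 \<and> h 1 \<noteq> 0) \<or>
             (h 3 = 0 \<and> h 1 = 0 \<and> h 4 \<noteq> 0 \<and> h 2 \<noteq> 0)))"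
    if a: "arises ?x0 w (F P) h" for w P h
  proof -
    note c = arises_F_cases[OF a _ nd, simplified level.simps, OF refl]
    show ?thesis
      using c(1,2,5) seven_cases[OF c(1,2)] by blast
  qed
  ultimately show ?thesis unfolding I_def by blast
qed

end
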